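(* Let $X_1,X_2\in\mathbb{C}[x_1,x_2]$ with $X_1\not\equiv0$, consider the polynomial differential equation $$\frac{dx_1}{dt}=X_1(x_1,x_2),\qquad \frac{dx_2}{dt}=X_2(x_1,x_2),\qquad (\ast)$$ let $\mathscr{X}=X_1\delta_1+X_2\delta_2$, $r=\mathrm{ord}(\mathscr{X})$, and $$b_i=-X_1\,\delta_2^{i+1}\Big(\frac{X_2}{X_1}\Big)\quad(i=0,1,2).$$ Then: (1) $r=0$ if and only if $K$ contains a first integral of $(\ast)$. (2) $r=1$ if and only if $K$ contains no first integral of $(\ast)$ and there exist $a\in K\setminus\{0\}$ and $n\in\mathbb{Z}\setminus\{0\}$ such that $\mathscr{X}a=n b_0a$. In this case $(\ast)$ has the integrating factor $\eta=a^{1/n}/X_1$. (3) $r=2$ if and only if the equation $\mathscr{X}a=nb_0a$ is not satisfied by any $a\in K\setminus\{0\}$ and $n\in\mathbb{N}$ (positive), and there exists $a\in K$ such that $\mathscr{X}a=b_0a+b_1$. In this case $(\ast)$ has an integrating factor of the form $$\eta=\frac1{X_1}\exp\left[\int_{(x_1^0,x_2^0)}^{(x_1,x_2)}\frac{1}{X_1}\Big(aX_1\,dx_2-(X_2a-b_0)\,dx_1\Big)\right].$$ (4) $r=3$ if and only if the equation $\mathscr{X}a=b_0a+b_1$ is not satisfied by any $a\in K$, and there exists $a\in K$ such that $\mathscr{X}a=2b_0a+b_2$. In this case $(\ast)$ has an integrating factor of the form $$\eta=\frac1{X_1}\exp\left[\int_{(x_1^0,x_2^0)}^{(x_1,x_2)}\Big(-\delta_2\frac{X_2}{X_1}-\frac{X_2}{X_1}u\Big)dx_1+u\,dx_2\right],$$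 where $u$ is a solution of the system of partial differential equations $$\delta_1u=-\delta_2^2\frac{X_2}{X_1}-\frac{X_2}{X_1}a-\Big(\delta_2\frac{X_2}{X_1}\Big)u-\frac12\frac{X_2}{X_1}u^2,\qquad \delta_2u=a+\frac12u^2.$$ (5) $r=\infty$ if and only if the equation $\mathscr{X}a=2b_0a+b_2$ is not satisfied by any $a\in K$.
   Context: Let $K=\mathbb{C}(x_1,x_2)$ with the derivations $\delta_i=\partial/\partial x_i$ ($i=1,2$). $K\{y\}$ is the ring of differential polynomials in one differential indeterminate $y$, i.e. the polynomial ring over $K$ in the symbols $\delta_1^{i_1}\delta_2^{i_2}y$ ($i_1,i_2\ge 0$), with $\delta_1,\delta_2$ extended as commuting derivations in the obvious way. A differential ideal is an ideal closed under $\delta_1,\delta_2$. For $\Sigma\subseteq K\{y\}$, $\{\Sigma\}$ denotes the smallest differential ideal containing $\Sigma$ (no radical is taken). Put $X=\mathscr{X}y=X_1\delta_1y+X_2\delta_2y$. A first integral is a non-constant analytic function $\omega$ on some nonempty connected open subset of $\mathbb{C}^2$ with $\mathscr{X}\omega=0$. An integrating factor of $(\ast)$ is a not identically zero function $\eta$, analytic on some nonempty open subset of $\mathbb{C}^2$, such that the 1-form $\eta\,(X_1dx_2-X_2dx_1)$ is closed. Formulas for integrating factors are understood locally, with a choice of branch of $a^{1/n}$, and with integrals of closed 1-forms taken near a suitable base point $(x_1^0,x_2^0)$ where everything is analytic. Rank. $\delta_1^{j_1}\delta_2^{j_2}y$ is higher than $\delta_1^{i_1}\delta_2^{i_2}y$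 if $j_1>i_1$, or $j_1=i_1$ and $j_2>i_2$. The leader of a differential polynomial that effectively involves $y$ or its derivatives is the highest derivative of $y$ occurring in it. $A_2$ has higher rank than $A_1$ if $A_2$ has a higher leader, or they have the same leader and $A_2$ has larger degree in it; a differential polynomial effectively involving $y$ or its derivatives has higher rank than any element of $K$. Expansions. An expansion of $\mathscr{X}$ is a differential ideal $\Lambda\subseteq K\{y\}$ properly containing $\{X\}$. Let $A$ be a nonzero element of $\Lambda$ of lowest rank. Then either the leader of $A$ is $\delta_2^r y$ for some $r\ge 0$, and one puts $\mathrm{ord}(\Lambda)=r$, or $A\in K$ (so $\Lambda=K\{y\}$), and one puts $\mathrm{ord}(\Lambda)=\infty$. Nontriviality. For $A\in K\{y\}$ and an analytic function $u$ on an open set $\Omega\subseteq\mathbb{C}^2$, $\mathscr{D}_Au$ is the function obtained by substituting $y=u$ in $A$; it is defined on $\Omega\setminus S(\mathscr{D}_A)$, where $S(\mathscr{D}_A)$ is the set of singular points (poles) of the coefficients of $A$. An expansion $\Lambda$ is nontrivial if there are a nonempty connected open set $\Omega\subseteq\mathbb{C}^2$ and a non-constant analytic function $\omega$ on $\Omega$ with $\mathscr{D}_A\omega=0$ on $\Omega\setminus S(\mathscr{D}_A)$ for all $A\in\Lambda$; by convention the unit ideal $K\{y\}$ (of order $\infty$) is also admitted. Order of the operator. $\mathrm{ord}(\mathscr{X})$ is the lowest order of a nontrivial expansion of $\mathscr{X}$. Thus $\mathrm{ord}(\mathscr{X})=\infty$ exactly when no nontrivial expansion has finite order. *)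

theory Defs
  imports
    "HOL-Analysis.Analysis"
    "HOL-Library.Poly_Mapping"
    "HOL-Computational_Algebra.Polynomial"
    "HOL-Computational_Algebra.Fraction_Field"
begin

section \<open>The differential field of rational functions in two variables\<close>

text \<open>
  An element of \<^typ>\<open>complex poly poly\<close> is a polynomial in \<open>x\<^sub>2\<close> whose coefficients are
  polynomials in \<open>x\<^sub>1\<close>.
\<close>

type_synonym bipoly = "complex poly poly"
type_synonym ratfun = "bipoly fract"

definition bipoly_eval :: "bipoly \<Rightarrow> complex \<times> complex \<Rightarrow> complex" where
  "bipoly_eval p z = poly (poly p [:snd z:]) (fst z)"

definition of_bipoly :: "bipoly \<Rightarrow> ratfun" where
  "of_bipoly p = Fract p 1"

lemma quotient_rule_respects:
  fixes D :: "'a::idom \<Rightarrow> 'a"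
  assumes leibniz: "\<And>p q. D (p * q) = D p * q + p * D q"
    and nz: "d \<noteq> 0" "d' \<noteq> 0" and eq: "n * d' = n' * d"
  shows "(D n * d - n * D d) * (d' * d') = (D n' * d' - n' * D d') * (d * d)"
proof -
  have "D n * d' + n * D d' = D n' * d + n' * D d"
    using arg_cong[OF eq, of D] by (simp add: leibniz)
  then have *: "(D n * d' + n * D d') * (d * d') = (D n' * d + n' * D d) * (d * d')"
    by simp
  have "(D n * d - n * D d) * (d' * d')
      = (D n * d' + n * D d') * (d * d') - (n * d') * (d * D d') - (n * d') * (d' * D d)"
    by (simp add: algebra_simps)
  also have "\<dots> = (D n' * d + n' * D d) * (d * d') - (n' * d) * (d * D d') - (n' * d) * (d' * D d)"
    by (simp only: * eq)
  also have "\<dots> = (D n' * d' - n' * D d') * (d * d)"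
    by (simp add: algebra_simps)
  finally show ?thesis .
qed

lemma map_poly_pderiv_mult:
  fixes p q :: bipoly
  shows "map_poly pderiv (p * q) = map_poly pderiv p * q + p * map_poly pderiv q"
proof (rule poly_eqI)
  fix n
  have pderiv_sum: "pderiv (sum f A) = (\<Sum>i\<in>A. pderiv (f i))"
    for f :: "nat \<Rightarrow> complex poly" and A
    by (induction A rule: infinite_finite_induct) (simp_all add: pderiv_add)
  show "coeff (map_poly pderiv (p * q)) n
      = coeff (map_poly pderiv p * q + p * map_poly pderiv q) n"
    unfolding coeff_add coeff_mult
    by (simp add: coeff_map_poly coeff_mult pderiv_sum pderiv_mult sum.distrib
        mult.commute[of _ "pderiv _"] add.commute)
qed

definition fract_deriv :: "('a::idom \<Rightarrow> 'a) \<Rightarrow> 'a fract \<Rightarrow> 'a fract" where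
  "fract_deriv D q = (THE r. \<forall>n d. d \<noteq> 0 \<and> q = Fract n d \<longrightarrow>
     r = Fract (D n * d - n * D d) (d * d))"

lemma fract_deriv_Fract:
  assumes leibniz: "\<And>p q. D (p * q) = D p * q + p * D q" and "d \<noteq> 0"
  shows "fract_deriv D (Fract n d) = Fract (D n * d - n * D d) (d * d)"
  unfolding fract_deriv_def
proof (rule the_equality)
  show "\<forall>n' d'. d' \<noteq> 0 \<and> Fract n d = Fract n' d' \<longrightarrow>
      Fract (D n * d - n * D d) (d * d) = Fract (D n' * d' - n' * D d') (d' * d')"
    using \<open>d \<noteq> 0\<close> by (auto simp: eq_fract intro: quotient_rule_respects[OF leibniz])
qed (use \<open>d \<noteq> 0\<close> in blast)

definition \<delta>1 :: "ratfun \<Rightarrow> ratfun" where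
  "\<delta>1 = fract_deriv (map_poly pderiv)"

definition \<delta>2 :: "ratfun \<Rightarrow> ratfun" where
  "\<delta>2 = fract_deriv pderiv"

lemma \<delta>1_Fract:
  "d \<noteq> 0 \<Longrightarrow> \<delta>1 (Fract n d) = Fract (map_poly pderiv n * d - n * map_poly pderiv d) (d * d)"
  unfolding \<delta>1_def by (rule fract_deriv_Fract) (simp_all add: map_poly_pderiv_mult)

lemma \<delta>2_Fract: "d \<noteq> 0 \<Longrightarrow> \<delta>2 (Fract n d) = Fract (pderiv n * d - n * pderiv d) (d * d)"
  unfolding \<delta>2_def by (rule fract_deriv_Fract) (simp_all add: pderiv_mult algebra_simps)

definition regular_at :: "ratfun \<Rightarrow> complex \<times> complex \<Rightarrow> bool" where
  "regular_at a z \<longleftrightarrow> (\<exists>n d. a = Fract n d \<and> bipoly_eval d z \<noteq> 0)"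

text \<open>Only meaningful at regular points.\<close>

definition ratfun_eval :: "ratfun \<Rightarrow> complex \<times> complex \<Rightarrow> complex" where
  "ratfun_eval a z = (THE c. \<exists>n d. a = Fract n d \<and> bipoly_eval d z \<noteq> 0 \<and>
      c = bipoly_eval n z / bipoly_eval d z)"


section \<open>Analytic functions of two complex variables\<close>

definition analytic2_on :: "(complex \<times> complex \<Rightarrow> complex) \<Rightarrow> (complex \<times> complex) set \<Rightarrow> bool"
  where
  "analytic2_on f S \<longleftrightarrow> (\<forall>p1 p2. (p1, p2) \<in> S \<longrightarrow>
    (\<exists>c :: nat \<times> nat \<Rightarrow> complex. \<exists>e>0. \<forall>z1 z2. dist z1 p1 < e \<and> dist z2 p2 < e \<longrightarrow>
      ((\<lambda>(i, j). c (i, j) * (z1 - p1) ^ i * (z2 - p2) ^ j) has_sum f (z1, z2)) UNIV))"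

definition pd1 :: "(complex \<times> complex \<Rightarrow> complex) \<Rightarrow> complex \<times> complex \<Rightarrow> complex" where
  "pd1 f z = deriv (\<lambda>w. f (w, snd z)) (fst z)"

definition pd2 :: "(complex \<times> complex \<Rightarrow> complex) \<Rightarrow> complex \<times> complex \<Rightarrow> complex" where
  "pd2 f z = deriv (\<lambda>w. f (fst z, w)) (snd z)"

text \<open>
  \<open>form_integral \<Omega> p P Q \<phi>\<close>: for \<open>q\<close> in \<open>\<Omega>\<close>, the integral of \<open>P dx\<^sub>1 + Q dx\<^sub>2\<close> along every path
  in \<open>\<Omega>\<close> from \<open>p\<close> to \<open>q\<close> exists and equals \<open>\<phi> q\<close>.
\<close>

definition form_integral ::
  "(complex \<times> complex) set \<Rightarrow> complex \<times> complex \<Rightarrow> (complex \<times> complex \<Rightarrow> complex) \<Rightarrow>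
    (complex \<times> complex \<Rightarrow> complex) \<Rightarrow> (complex \<times> complex \<Rightarrow> complex) \<Rightarrow> bool" where
  "form_integral \<Omega> p P Q \<phi> \<longleftrightarrow> (\<forall>q\<in>\<Omega>. \<forall>\<gamma>.
     valid_path \<gamma> \<and> path_image \<gamma> \<subseteq> \<Omega> \<and> pathstart \<gamma> = p \<and> pathfinish \<gamma> = q \<longrightarrow>
     ((\<lambda>t. P (\<gamma> t) * fst (vector_derivative \<gamma> (at t within {0..1}))
         + Q (\<gamma> t) * snd (vector_derivative \<gamma> (at t within {0..1})))
       has_integral \<phi> q) {0..1})"


section \<open>Differential polynomials\<close>

text \<open>
  The pair \<open>(i, j)\<close> stands for the symbol \<open>\<delta>\<^sub>1\<^sup>i \<delta>\<^sub>2\<^sup>j y\<close>, a monomial is a finitely supported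
  exponent vector, and a differential polynomial maps monomials to their coefficients.
\<close>

type_synonym dvar = "nat \<times> nat"
type_synonym dpoly = "(dvar \<Rightarrow>\<^sub>0 nat) \<Rightarrow>\<^sub>0 ratfun"

text \<open>
  The derivation that acts as \<open>d\<close> on coefficients and sends the symbol \<open>v\<close> to \<open>s v\<close>. A term
  \<open>c m\<close> goes to \<open>d c m\<close> plus, for each \<open>v\<close> of exponent \<open>e\<close> in \<open>m\<close>, the term \<open>e c (m / v) (s v)\<close>.
\<close>

definition dpoly_deriv :: "(ratfun \<Rightarrow> ratfun) \<Rightarrow> (dvar \<Rightarrow> dvar) \<Rightarrow> dpoly \<Rightarrow> dpoly" where
  "dpoly_deriv d s A = (\<Sum>m\<in>Poly_Mapping.keys A.
     Poly_Mapping.single m (d (Poly_Mapping.lookup A m))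
     + (\<Sum>v\<in>Poly_Mapping.keys m.
          Poly_Mapping.single (m - Poly_Mapping.single v 1 + Poly_Mapping.single (s v) 1)
            (of_nat (Poly_Mapping.lookup m v) * Poly_Mapping.lookup A m)))"

definition dpoly_\<delta>1 :: "dpoly \<Rightarrow> dpoly" where
  "dpoly_\<delta>1 = dpoly_deriv \<delta>1 (\<lambda>(i, j). (Suc i, j))"

definition dpoly_\<delta>2 :: "dpoly \<Rightarrow> dpoly" where
  "dpoly_\<delta>2 = dpoly_deriv \<delta>2 (\<lambda>(i, j). (i, Suc j))"

definition differential_ideal :: "dpoly set \<Rightarrow> bool" where
  "differential_ideal I \<longleftrightarrow>
     0 \<in> I \<and> (\<forall>A\<in>I. \<forall>B\<in>I. A + B \<in> I) \<and> (\<forall>A. \<forall>B\<in>I. A * B \<in> I) \<and>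
     (\<forall>A\<in>I. dpoly_\<delta>1 A \<in> I \<and> dpoly_\<delta>2 A \<in> I)"

definition differential_ideal_hull :: "dpoly set \<Rightarrow> dpoly set" where
  "differential_ideal_hull \<Sigma> = \<Inter>{I. differential_ideal I \<and> \<Sigma> \<subseteq> I}"


subsection \<open>Rank\<close>

definition dvar_less :: "dvar \<Rightarrow> dvar \<Rightarrow> bool" where
  "dvar_less v w \<longleftrightarrow> fst v < fst w \<or> fst v = fst w \<and> snd v < snd w"

definition dvars :: "dpoly \<Rightarrow> dvar set" where
  "dvars A = (\<Union>m\<in>Poly_Mapping.keys A. Poly_Mapping.keys m)"

definition leader :: "dpoly \<Rightarrow> dvar" where
  "leader A = (THE v. v \<in> dvars A \<and> (\<forall>w\<in>dvars A. w = v \<or> dvar_less w v))"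

definition degree_in :: "dvar \<Rightarrow> dpoly \<Rightarrow> nat" where
  "degree_in v A = Max ((\<lambda>m. Poly_Mapping.lookup m v) ` Poly_Mapping.keys A)"

definition rank_less :: "dpoly \<Rightarrow> dpoly \<Rightarrow> bool" where
  "rank_less A B \<longleftrightarrow> dvars B \<noteq> {} \<and>
     (dvars A = {} \<or> dvar_less (leader A) (leader B) \<or>
      leader A = leader B \<and> degree_in (leader A) A < degree_in (leader B) B)"

definition lowest_rank_in :: "dpoly set \<Rightarrow> dpoly \<Rightarrow> bool" where
  "lowest_rank_in \<Lambda> A \<longleftrightarrow> A \<in> \<Lambda> \<and> A \<noteq> 0 \<and> (\<forall>B\<in>\<Lambda>. B \<noteq> 0 \<longrightarrow> \<not> rank_less B A)"


subsection \<open>Evaluation at analytic functions\<close>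

definition dpoly_singular :: "dpoly \<Rightarrow> (complex \<times> complex) set" where
  "dpoly_singular A =
     {z. \<exists>m\<in>Poly_Mapping.keys A. \<not> regular_at (Poly_Mapping.lookup A m) z}"

definition dpoly_apply ::
  "dpoly \<Rightarrow> (complex \<times> complex \<Rightarrow> complex) \<Rightarrow> complex \<times> complex \<Rightarrow> complex" where
  "dpoly_apply A u z = (\<Sum>m\<in>Poly_Mapping.keys A. ratfun_eval (Poly_Mapping.lookup A m) z *
     (\<Prod>v\<in>Poly_Mapping.keys m.
        ((pd1 ^^ fst v) ((pd2 ^^ snd v) u) z) ^ Poly_Mapping.lookup m v))"


section \<open>The differential operator and its expansions\<close>

text \<open>The pair \<open>X1\<close>, \<open>X2\<close> represents the operator \<open>X\<^sub>1 \<delta>\<^sub>1 + X\<^sub>2 \<delta>\<^sub>2\<close>.\<close>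

definition vf :: "bipoly \<Rightarrow> bipoly \<Rightarrow> ratfun \<Rightarrow> ratfun" where
  "vf X1 X2 a = of_bipoly X1 * \<delta>1 a + of_bipoly X2 * \<delta>2 a"

definition vf_dpoly :: "bipoly \<Rightarrow> bipoly \<Rightarrow> dpoly" where
  "vf_dpoly X1 X2 =
     Poly_Mapping.single (Poly_Mapping.single (1, 0) 1) (of_bipoly X1)
     + Poly_Mapping.single (Poly_Mapping.single (0, 1) 1) (of_bipoly X2)"

definition expansion :: "bipoly \<Rightarrow> bipoly \<Rightarrow> dpoly set \<Rightarrow> bool" where
  "expansion X1 X2 \<Lambda> \<longleftrightarrow>
     differential_ideal \<Lambda> \<and> differential_ideal_hull {vf_dpoly X1 X2} \<subset> \<Lambda>"

text \<open>
  All elements of lowest rank have the same rank, so the choice is immaterial. If they involve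
  \<open>y\<close> or its derivatives, their leader is \<open>(0, r)\<close> for some \<open>r\<close>.
\<close>

definition expansion_ord :: "dpoly set \<Rightarrow> enat" where
  "expansion_ord \<Lambda> = (let A = (SOME A. lowest_rank_in \<Lambda> A) in
     if dvars A = {} then \<infinity> else enat (snd (leader A)))"

definition nontrivial_expansion :: "bipoly \<Rightarrow> bipoly \<Rightarrow> dpoly set \<Rightarrow> bool" where
  "nontrivial_expansion X1 X2 \<Lambda> \<longleftrightarrow> expansion X1 X2 \<Lambda> \<and>
     (\<Lambda> = UNIV \<or>
      (\<exists>\<Omega> \<omega>. open \<Omega> \<and> connected \<Omega> \<and> \<Omega> \<noteq> {} \<and> analytic2_on \<omega> \<Omega> \<and> \<not> \<omega> constant_on \<Omega> \<and>
        (\<forall>A\<in>\<Lambda>. \<forall>z\<in>\<Omega> - dpoly_singular A. dpoly_apply A \<omega> z = 0)))"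

definition vf_ord :: "bipoly \<Rightarrow> bipoly \<Rightarrow> enat" where
  "vf_ord X1 X2 = (LEAST r. \<exists>\<Lambda>. nontrivial_expansion X1 X2 \<Lambda> \<and> expansion_ord \<Lambda> = r)"


section \<open>First integrals and integrating factors\<close>

definition first_integral ::
  "bipoly \<Rightarrow> bipoly \<Rightarrow> (complex \<times> complex) set \<Rightarrow> (complex \<times> complex \<Rightarrow> complex) \<Rightarrow> bool" where
  "first_integral X1 X2 \<Omega> \<omega> \<longleftrightarrow>
     open \<Omega> \<and> connected \<Omega> \<and> \<Omega> \<noteq> {} \<and> analytic2_on \<omega> \<Omega> \<and> \<not> \<omega> constant_on \<Omega> \<and>
     (\<forall>z\<in>\<Omega>. bipoly_eval X1 z * pd1 \<omega> z + bipoly_eval X2 z * pd2 \<omega> z = 0)"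

definition has_rational_first_integral :: "bipoly \<Rightarrow> bipoly \<Rightarrow> bool" where
  "has_rational_first_integral X1 X2 \<longleftrightarrow>
     (\<exists>a \<Omega>. (\<forall>z\<in>\<Omega>. regular_at a z) \<and> first_integral X1 X2 \<Omega> (ratfun_eval a))"

definition closed_form_on ::
  "(complex \<times> complex) set \<Rightarrow> (complex \<times> complex \<Rightarrow> complex) \<Rightarrow>
    (complex \<times> complex \<Rightarrow> complex) \<Rightarrow> bool" where
  "closed_form_on \<Omega> P Q \<longleftrightarrow> (\<forall>z\<in>\<Omega>. pd1 Q z = pd2 P z)"

definition integrating_factor ::
  "bipoly \<Rightarrow> bipoly \<Rightarrow> (complex \<times> complex) set \<Rightarrow> (complex \<times> complex \<Rightarrow> complex) \<Rightarrow> bool" where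
  "integrating_factor X1 X2 \<Omega> \<eta> \<longleftrightarrow>
     open \<Omega> \<and> \<Omega> \<noteq> {} \<and> analytic2_on \<eta> \<Omega> \<and> (\<exists>z\<in>\<Omega>. \<eta> z \<noteq> 0) \<and>
     closed_form_on \<Omega> (\<lambda>z. - (\<eta> z * bipoly_eval X2 z)) (\<lambda>z. \<eta> z * bipoly_eval X1 z)"

definition b_coeff :: "bipoly \<Rightarrow> bipoly \<Rightarrow> nat \<Rightarrow> ratfun" where
  "b_coeff X1 X2 i = - of_bipoly X1 * (\<delta>2 ^^ (i + 1)) (of_bipoly X2 / of_bipoly X1)"

text \<open>Connected neighbourhoods of \<open>p\<close> on which \<open>a\<close> and \<open>1 / X\<^sub>1\<close> are analytic.\<close>

definition good_nbhd ::
  "bipoly \<Rightarrow> ratfun \<Rightarrow> complex \<times> complex \<Rightarrow> (complex \<times> complex) set \<Rightarrow> bool" where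
  "good_nbhd X1 a p \<Omega> \<longleftrightarrow> open \<Omega> \<and> connected \<Omega> \<and> p \<in> \<Omega> \<and>
     (\<forall>z\<in>\<Omega>. bipoly_eval X1 z \<noteq> 0 \<and> regular_at a z)"

text \<open>\<open>\<alpha>\<close> is a branch of \<open>a\<close> to the power \<open>1 / n\<close>; note that \<open>n\<close> may be negative.\<close>

definition root_branch ::
  "ratfun \<Rightarrow> int \<Rightarrow> (complex \<times> complex) set \<Rightarrow> (complex \<times> complex \<Rightarrow> complex) \<Rightarrow> bool" where
  "root_branch a n \<Omega> \<alpha> \<longleftrightarrow> analytic2_on \<alpha> \<Omega> \<and>
     (\<forall>z\<in>\<Omega>. regular_at a z \<and> ratfun_eval a z \<noteq> 0 \<and> \<alpha> z powi n = ratfun_eval a z)"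

text \<open>The system of partial differential equations satisfied by \<open>u\<close>, with \<open>f = X\<^sub>2 / X\<^sub>1\<close>.\<close>

definition u_system ::
  "bipoly \<Rightarrow> bipoly \<Rightarrow> ratfun \<Rightarrow> (complex \<times> complex) set \<Rightarrow>
    (complex \<times> complex \<Rightarrow> complex) \<Rightarrow> bool" where
  "u_system X1 X2 a \<Omega> u \<longleftrightarrow> analytic2_on u \<Omega> \<and>
     (let f = of_bipoly X2 / of_bipoly X1 in \<forall>z\<in>\<Omega>.
       pd1 u z = - ratfun_eval (\<delta>2 (\<delta>2 f)) z - ratfun_eval f z * ratfun_eval a z
                 - ratfun_eval (\<delta>2 f) z * u z - 1 / 2 * ratfun_eval f z * (u z)\<^sup>2 \<and>
       pd2 u z = ratfun_eval a z + 1 / 2 * (u z)\<^sup>2)"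

end

theory Submission
  imports Defs "HOL-Complex_Analysis.Complex_Analysis"
begin

text \<open>
  Put \<open>f = X\<^sub>2 / X\<^sub>1\<close> and \<open>D = \<delta>1 + f \<delta>2\<close>, and write \<open>y\<^sub>j\<close> for \<open>\<delta>2\<^sup>j y\<close> and a prime for \<open>\<delta>2\<close>. Modulo the
  equation, \<open>D\<close> acts on \<open>K[y\<^sub>0, y\<^sub>1, \<dots>]\<close> as \<open>D\<^sub>K - \<Sum>\<^sub>k f\<^sup>(\<^sup>k\<^sup>+\<^sup>1\<^sup>) L\<^sub>k\<close>, where \<open>D\<^sub>K\<close> acts on coefficients and the
  derivation \<open>L\<^sub>k\<close> sends \<open>y\<^sub>j\<close> to \<open>C(j, k + 1) y\<^sub>j\<^sub>-\<^sub>k\<close>. With \<open>y\<^sub>j\<close> of weight \<open>j\<close>, \<open>L\<^sub>0\<close> is multiplication by the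
  weight and \<open>L\<^sub>k\<close> lowers the weight by \<open>k\<close>.

  Let \<open>\<Lambda>\<close> be a nontrivial expansion of order \<open>r\<close>. Among its nonzero elements in \<open>K[y\<^sub>0, \<dots>, y\<^sub>r]\<close>
  choose \<open>A\<close> with the least top weight \<open>w\<close> and then the fewest monomials of that weight, and normalize
  one of their coefficients to 1. Minimality gives \<open>D A = - w f' A\<close>. Comparing coefficients in weight
  \<open>w - k\<close> yields a solution \<open>a \<in> K\<close> of \<open>D a = - k f' a - f\<^sup>(\<^sup>k\<^sup>+\<^sup>1\<^sup>)\<close> unless \<open>L\<^sub>k\<close> kills the top part of \<open>A\<close>.
  If the equations for \<open>k = 1, 2\<close> have no solution, then all \<open>L\<^sub>k\<close> with \<open>k \<ge> 1\<close> kill the top part, because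
  they are generated by \<open>L\<^sub>1\<close> and \<open>L\<^sub>2\<close> under brackets. Hence \<open>A = p(y) y\<^sub>1\<^sup>w\<close> with constant coefficients,
  which has no nonconstant solution. So some equation is solvable, and the three equations imply each
  other in one direction.

  Conversely, a solution in \<open>K\<close> makes an explicit 1-form closed or an explicit Riccati system
  integrable. This gives the integrating factors, and the resulting first integral satisfies an
  equation in \<open>y\<close>, in \<open>y\<^sub>1\<close>, in \<open>y\<^sub>1, y\<^sub>2\<close> or (of Schwarzian type) in \<open>y\<^sub>1, y\<^sub>2, y\<^sub>3\<close>.
\<close>

section \<open>The coefficient field\<close>

text \<open>The equations are those satisfied by quantities attached to a first integral \<omega>.
  Since [D, \<delta>2] = - f' \<delta>2, the function \<alpha> = \<delta>2 \<omega> satisfies D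
  \<alpha> = - f' \<alpha>. Then \<alpha>^n, the logarithmic derivative \<alpha>' / \<alpha> and the
  Schwarzian derivative of \<omega> in x2 solve the equations for orders 1, 2 and 3. The order tells
  which of \<omega>, \<alpha>^n, \<alpha>' / \<alpha> and the Schwarzian can be found in K.

  The obstacle is that an expansion is an arbitrary differential ideal, not assumed prime or
  radical, so its elements of lowest rank may have any degree and shape. The choice by weight and
  number of monomials gets around this: it needs only a K-subspace stable under D, and it produces
  linear equations for single coefficients. The absence of a rational first integral enters at the
  end, where it turns coefficients killed by D into constants.\<close>

instance fract :: ("{idom,ring_char_0}") field_char_0
proof
  have "(of_nat n :: 'a fract) = Fract (of_nat n) 1" for n
    by (induction n) (simp_all add: Zero_fract_def One_fract_def)
  then show "inj (of_nat :: nat \<Rightarrow> 'a fract)"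
    by (intro injI) (simp add: eq_fract)
qed

text \<open>Instances are \<open>\<delta>1\<close>, \<open>\<delta>2\<close> and D on the field as
  well as all operators on differential polynomials. Differences and commutators of derivations are
  derivations again, so identities between such operators reduce to a check on generators
  (\<open>derivation_eqI\<close>).\<close>

locale derivation =
  fixes d :: "'a::comm_ring_1 \<Rightarrow> 'a"
  assumes add: "d (x + y) = d x + d y"
    and mult: "d (x * y) = d x * y + x * d y"
begin

lemma zero [simp]: "d 0 = 0"
  using add[of 0 0] by simp

lemma one [simp]: "d 1 = 0"
  using mult[of 1 1] by simp

lemma minus: "d (- x) = - d x"
  using add[of x "- x"] by (simp add: eq_neg_iff_add_eq_0 add.commute)

lemma diff: "d (x - y) = d x - d y"
  using add[of x "- y"] by (simp add: minus)

lemma sum: "d (sum g A) = (\<Sum>i\<in>A. d (g i))"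
  by (induction A rule: infinite_finite_induct) (simp_all add: add)

lemma of_nat [simp]: "d (of_nat n) = 0"
  by (induction n) (simp_all add: add)

lemma of_int [simp]: "d (of_int n) = 0"
  by (cases n) (simp_all add: minus diff)

lemma numeral [simp]: "d (numeral n) = 0"
  using of_nat[of "numeral n"] by simp

end

lemma fract_deriv_derivation:
  fixes D :: "'a::idom \<Rightarrow> 'a"
  assumes "derivation D"
  shows "derivation (fract_deriv D)"
proof
  interpret derivation D by fact
  have Fr: "fract_deriv D (Fract n d) = Fract (D n * d - n * D d) (d * d)" if "d \<noteq> 0" for n d
    using that by (intro fract_deriv_Fract) (simp_all add: mult)
  fix x y :: "'a fract"
  obtain n d n' d' where x: "x = Fract n d" "d \<noteq> 0" and y: "y = Fract n' d'" "d' \<noteq> 0"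
    by (metis Fract_cases)
  show "fract_deriv D (x + y) = fract_deriv D x + fract_deriv D y"
    using x y by (simp add: Fr eq_fract mult add) (simp add: algebra_simps)
  show "fract_deriv D (x * y) = fract_deriv D x * y + x * fract_deriv D y"
    using x y by (simp add: Fr eq_fract mult add) (simp add: algebra_simps)
qed

lemma map_poly_pderiv_add:
  "map_poly pderiv (p + q) = map_poly pderiv p + map_poly pderiv (q :: bipoly)"
  by (intro poly_eqI) (simp add: coeff_map_poly pderiv_add)

lemma map_poly_pderiv_diff:
  "map_poly pderiv (p - q) = map_poly pderiv p - map_poly pderiv (q :: bipoly)"
  by (intro poly_eqI) (simp add: coeff_map_poly pderiv_diff)

interpretation \<delta>1: derivation \<delta>1
  unfolding \<delta>1_def
  by (intro fract_deriv_derivation derivation.intro map_poly_pderiv_add map_poly_pderiv_mult)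

interpretation \<delta>2: derivation \<delta>2
  unfolding \<delta>2_def
  by (intro fract_deriv_derivation derivation.intro pderiv_add)
    (simp add: pderiv_mult algebra_simps)

lemma pderiv_map_poly_pderiv: "pderiv (map_poly pderiv p) = map_poly pderiv (pderiv (p :: bipoly))"
proof -
  have "pderiv (of_nat n * q) = of_nat n * pderiv q" for n and q :: "complex poly"
    by (simp add: of_nat_poly pderiv_smult)
  then show ?thesis
    by (intro poly_eqI) (simp add: coeff_map_poly coeff_pderiv del: of_nat_Suc)
qed

lemma \<delta>_commute: "\<delta>1 (\<delta>2 a) = \<delta>2 (\<delta>1 a)"
proof (cases a)
  case (Fract n d)
  let ?D = "map_poly pderiv :: bipoly \<Rightarrow> bipoly"
  show ?thesis using Fract
    by (simp add: \<delta>1_Fract \<delta>2_Fract eq_fract map_poly_pderiv_mult map_poly_pderiv_diff pderiv_mult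
        pderiv_diff pderiv_map_poly_pderiv) (simp add: algebra_simps)
qed

context derivation
begin

text \<open>Phrased through \<open>x * y = 1\<close> because the locale assumes only a commutative
  ring.\<close>

lemma inverse:
  fixes x :: "'a"
  assumes "x * y = 1"
  shows "d y = - (d x * y * y)"
proof -
  have "d x * y + x * d y = 0"
    using mult[of x y] assms by simp
  then have "y * (d x * y) + (x * y) * d y = 0"
    by (metis (no_types, lifting) distrib_left mult.assoc mult.commute mult_zero_right)
  then show ?thesis
    using assms by (simp add: algebra_simps eq_neg_iff_add_eq_0)
qed

end

lemma derivation_divide:
  fixes d :: "'a::field \<Rightarrow> 'a"
  assumes "derivation d" "y \<noteq> 0"
  shows "d (x / y) = (d x * y - x * d y) / (y * y)"
proof -
  interpret derivation d by fact
  have "d (inverse y) = - (d y * inverse y * inverse y)"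
    by (rule inverse) (use \<open>y \<noteq> 0\<close> in simp)
  then show ?thesis
    using \<open>y \<noteq> 0\<close> by (simp add: divide_inverse mult) (simp add: field_simps)
qed

section \<open>The three equations over the coefficient field\<close>

definition slope :: "bipoly \<Rightarrow> bipoly \<Rightarrow> ratfun" where
  "slope X1 X2 = of_bipoly X2 / of_bipoly X1"

definition slope_deriv :: "ratfun \<Rightarrow> ratfun \<Rightarrow> ratfun" where
  "slope_deriv f a = \<delta>1 a + f * \<delta>2 a"

lemma slope_deriv_derivation: "derivation (slope_deriv f)"
  by standard (simp_all add: slope_deriv_def \<delta>1.add \<delta>2.add \<delta>1.mult \<delta>2.mult algebra_simps)

interpretation slope: derivation "slope_deriv f" for f
  by (rule slope_deriv_derivation)

lemma of_bipoly_nonzero: "p \<noteq> 0 \<Longrightarrow> of_bipoly p \<noteq> 0"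
  by (simp add: of_bipoly_def Zero_fract_def eq_fract)

lemma vf_eq: "X1 \<noteq> 0 \<Longrightarrow> vf X1 X2 a = of_bipoly X1 * slope_deriv (slope X1 X2) a"
  using of_bipoly_nonzero[of X1] by (simp add: vf_def slope_deriv_def slope_def field_simps)

text \<open>The commutator rule [D, \<delta>2] = - f' \<delta>2, a consequence of
  \<open>\<delta>_commute\<close>. The passages between the three equations rest on it.\<close>

lemma slope_deriv_\<delta>2: "slope_deriv f (\<delta>2 a) = \<delta>2 (slope_deriv f a) - \<delta>2 f * \<delta>2 a"
  by (simp add: slope_deriv_def \<delta>_commute \<delta>2.add \<delta>2.mult)

text \<open>The equations of the statement for orders 1, 2 and 3, divided by X1. The last two are
  the cases k = 1, 2 of D a = - k f' a - f^(k+1); the first is its homogeneous form, with k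
  arbitrary and positive.\<close>

definition slope_sol1 :: "ratfun \<Rightarrow> bool" where
  "slope_sol1 f \<longleftrightarrow> (\<exists>a n. a \<noteq> 0 \<and> n > (0::nat) \<and> slope_deriv f a = - (of_nat n * \<delta>2 f * a))"

definition slope_sol2 :: "ratfun \<Rightarrow> bool" where
  "slope_sol2 f \<longleftrightarrow> (\<exists>a. slope_deriv f a = - (\<delta>2 f * a) - \<delta>2 (\<delta>2 f))"

definition slope_sol3 :: "ratfun \<Rightarrow> bool" where
  "slope_sol3 f \<longleftrightarrow> (\<exists>a. slope_deriv f a = - (2 * \<delta>2 f * a) - \<delta>2 (\<delta>2 (\<delta>2 f)))"

text \<open>The witness is the logarithmic derivative of the formal root a^(1/n), which already lies
  in K.\<close>

lemma slope_sol1_imp_sol2: "slope_sol1 f \<Longrightarrow> slope_sol2 f"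
  unfolding slope_sol1_def slope_sol2_def
proof (elim exE conjE)
  fix a n assume a: "a \<noteq> 0" "n > (0::nat)" "slope_deriv f a = - (of_nat n * \<delta>2 f * a)"
  let ?b = "\<delta>2 a / (of_nat n * a)"
  have n: "(of_nat n :: ratfun) \<noteq> 0" using a by simp
  have "slope_deriv f ?b = - (\<delta>2 f * ?b) - \<delta>2 (\<delta>2 f)"
    using a n
    by (simp add: derivation_divide[OF slope_deriv_derivation] slope_deriv_\<delta>2 slope.mult
        \<delta>2.minus \<delta>2.mult) (simp add: field_simps)
  then show "\<exists>a. slope_deriv f a = - (\<delta>2 f * a) - \<delta>2 (\<delta>2 f)" by blast
qed

text \<open>If b is the logarithmic derivative of \<delta>2 \<omega>, then b' - b^2/2 is the
  Schwarzian derivative of \<omega>; the same expression serves for any solution b in K.\<close>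

lemma slope_sol2_imp_sol3: "slope_sol2 f \<Longrightarrow> slope_sol3 f"
  unfolding slope_sol2_def slope_sol3_def
proof (elim exE)
  fix b assume b: "slope_deriv f b = - (\<delta>2 f * b) - \<delta>2 (\<delta>2 f)"
  have half: "slope_deriv f (b * b / 2) = slope_deriv f b * b"
    by (subst derivation_divide[OF slope_deriv_derivation]) (simp_all add: slope.mult)
  have "slope_deriv f (\<delta>2 b - b * b / 2)
      = \<delta>2 (- (\<delta>2 f * b) - \<delta>2 (\<delta>2 f)) - \<delta>2 f * \<delta>2 b - (- (\<delta>2 f * b) - \<delta>2 (\<delta>2 f)) * b"
    unfolding slope.diff slope_deriv_\<delta>2 half b ..
  also have "\<dots> = - (2 * \<delta>2 f * (\<delta>2 b - b * b / 2)) - \<delta>2 (\<delta>2 (\<delta>2 f))"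
    by (simp add: \<delta>2.diff \<delta>2.minus \<delta>2.mult field_simps)
  finally have "slope_deriv f (\<delta>2 b - b * b / 2)
      = - (2 * \<delta>2 f * (\<delta>2 b - b * b / 2)) - \<delta>2 (\<delta>2 (\<delta>2 f))" .
  then show "\<exists>a. slope_deriv f a = - (2 * \<delta>2 f * a) - \<delta>2 (\<delta>2 (\<delta>2 f))" by blast
qed

text \<open>Replacing a by 1/a changes the sign of n. This connects the integer exponents in the
  condition for order 1 with the positive ones in the condition for order 2.\<close>

lemma slope_sol1_int:
  "slope_sol1 f \<longleftrightarrow> (\<exists>a n. a \<noteq> 0 \<and> n \<noteq> (0::int) \<and> slope_deriv f a = - (of_int n * \<delta>2 f * a))"
proof
  assume "slope_sol1 f"
  then show "\<exists>a n. a \<noteq> 0 \<and> n \<noteq> (0::int) \<and> slope_deriv f a = - (of_int n * \<delta>2 f * a)"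
    unfolding slope_sol1_def by (metis of_int_of_nat_eq of_nat_0_less_iff less_irrefl)
next
  assume "\<exists>a n. a \<noteq> 0 \<and> n \<noteq> (0::int) \<and> slope_deriv f a = - (of_int n * \<delta>2 f * a)"
  then obtain a n where a: "a \<noteq> 0" "n \<noteq> (0::int)" "slope_deriv f a = - (of_int n * \<delta>2 f * a)"
    by blast
  show "slope_sol1 f"
  proof (cases "n > 0")
    case True
    then have "slope_deriv f a = - (of_nat (nat n) * \<delta>2 f * a)" using a by simp
    then show ?thesis unfolding slope_sol1_def using a True
      by (metis zero_less_nat_eq)
  next
    case False
    have "slope_deriv f (inverse a) = - (slope_deriv f a * inverse a * inverse a)"
      by (rule slope.inverse) (use a in simp)
    also have "\<dots> = - (of_int (- n) * \<delta>2 f * inverse a)"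
      using a by simp
    also have "\<dots> = - (of_nat (nat (- n)) * \<delta>2 f * inverse a)"
      using False by simp
    finally show ?thesis unfolding slope_sol1_def using a False
      by (metis inverse_nonzero_iff_nonzero zero_less_nat_eq neg_0_less_iff_less linorder_neqE_linordered_idom)
  qed
qed

lemma b_coeff_eq:
  "b_coeff X1 X2 0 = - (of_bipoly X1 * \<delta>2 (slope X1 X2))"
  "b_coeff X1 X2 1 = - (of_bipoly X1 * \<delta>2 (\<delta>2 (slope X1 X2)))"
  "b_coeff X1 X2 2 = - (of_bipoly X1 * \<delta>2 (\<delta>2 (\<delta>2 (slope X1 X2))))"
  by (simp_all add: b_coeff_def slope_def numeral_2_eq_2)

context
  fixes X1 X2 :: bipoly
  assumes X1: "X1 \<noteq> 0"
begin

lemma vf_eq_iff: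
  "vf X1 X2 a = - (of_bipoly X1 * c) \<longleftrightarrow> slope_deriv (slope X1 X2) a = - c"
  using of_bipoly_nonzero[OF X1] mult_cancel_left[of "of_bipoly X1" "slope_deriv (slope X1 X2) a" "- c"]
  by (simp add: vf_eq[OF X1])

lemma vf_sol1_iff:
  "vf X1 X2 a = c * b_coeff X1 X2 0 * a \<longleftrightarrow>
    slope_deriv (slope X1 X2) a = - (c * \<delta>2 (slope X1 X2) * a)"
  unfolding vf_eq_iff[symmetric] by (simp add: b_coeff_eq algebra_simps)

lemma vf_sol2_iff:
  "vf X1 X2 a = b_coeff X1 X2 0 * a + b_coeff X1 X2 1 \<longleftrightarrow>
    slope_deriv (slope X1 X2) a = - (\<delta>2 (slope X1 X2) * a) - \<delta>2 (\<delta>2 (slope X1 X2))"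
proof -
  have "- (of_bipoly X1 * (c * a + c')) = - (of_bipoly X1 * c) * a + - (of_bipoly X1 * c')"
    and "- (c * a + c') = - (c * a) - c'" for c c'
    by (simp_all add: algebra_simps)
  then show ?thesis
    using vf_eq_iff[of a "\<delta>2 (slope X1 X2) * a + \<delta>2 (\<delta>2 (slope X1 X2))"]
    unfolding b_coeff_eq by metis
qed

lemma vf_sol3_iff:
  "vf X1 X2 a = 2 * b_coeff X1 X2 0 * a + b_coeff X1 X2 2 \<longleftrightarrow>
    slope_deriv (slope X1 X2) a
      = - (2 * \<delta>2 (slope X1 X2) * a) - \<delta>2 (\<delta>2 (\<delta>2 (slope X1 X2)))"
proof -
  have "- (of_bipoly X1 * (2 * c * a + c')) = 2 * - (of_bipoly X1 * c) * a + - (of_bipoly X1 * c')"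
    and "- (2 * c * a + c') = - (2 * c * a) - c'" for c c'
    by (simp_all add: algebra_simps)
  then show ?thesis
    using vf_eq_iff[of a "2 * \<delta>2 (slope X1 X2) * a + \<delta>2 (\<delta>2 (\<delta>2 (slope X1 X2)))"]
    unfolding b_coeff_eq by metis
qed

end

section \<open>Holomorphic functions of two variables\<close>

definition circle_kernel :: "complex \<Rightarrow> real \<Rightarrow> complex \<Rightarrow> real \<Rightarrow> complex" where
  "circle_kernel a r z s = r * exp (2 * of_real pi * \<i> * s) / (circlepath a r s - z)\<^sup>2"

lemma circlepath_in_sphere: "0 \<le> r \<Longrightarrow> circlepath a r s \<in> sphere a r"
  by (simp add: circlepath dist_norm norm_mult mult.assoc)

text \<open>As an integral over [0, 1], the derivative becomes accessible to the theorems on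
  continuity and differentiation of parameter integrals. The velocity of the circle contributes a
  factor 2 pi i that cancels the one in Cauchy's formula, which explains the form of
  \<open>circle_kernel\<close>.\<close>

lemma Cauchy_deriv_circle_kernel:
  assumes "continuous_on (cball a r) h" "h holomorphic_on ball a r" "z \<in> ball a r"
  shows "deriv h z = integral (cbox 0 1) (\<lambda>s. h (circlepath a r s) * circle_kernel a r z s)"
proof -
  have "deriv h z
      = 1 / (2 * of_real pi * \<i>) * contour_integral (circlepath a r) (\<lambda>u. h u / (u - z)\<^sup>2)"
    by (rule DERIV_imp_deriv[OF Cauchy_derivative_integral_circlepath(2)[OF assms]])
  also have "\<dots> = integral {0..1} (\<lambda>s. 1 / (2 * of_real pi * \<i>) *
      (h (circlepath a r s) / (circlepath a r s - z)\<^sup>2 * vector_derivative (circlepath a r) (at s)))"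
    unfolding contour_integral_integral by (rule integral_mult_right[symmetric])
  also have "\<dots> = integral (cbox 0 1) (\<lambda>s. h (circlepath a r s) * circle_kernel a r z s)"
    by (simp add: vector_derivative_circlepath circle_kernel_def cbox_interval mult_ac)
  finally show ?thesis .
qed

lemma continuous_on_circlepath [continuous_intros]:
  "continuous_on A g \<Longrightarrow> continuous_on A (\<lambda>x. circlepath a r (g x))"
  by (simp add: circlepath continuous_intros)

lemma continuous_on_circle_kernel [continuous_intros]:
  assumes "continuous_on A u" "continuous_on A v" "\<And>x. x \<in> A \<Longrightarrow> u x \<in> ball a r"
  shows "continuous_on A (\<lambda>x. circle_kernel a r (u x) (v x))"
proof -
  have "circlepath a r (v x) \<noteq> u x" if "x \<in> A" for x
    using assms(3)[OF that] circlepath_in_sphere[of r a "v x"]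
    by (metis dual_order.strict_implies_order dist_not_less_zero linorder_neqE_linordered_idom
        mem_ball mem_sphere order_less_irrefl not_le order_less_le_trans)
  then show ?thesis
    unfolding circle_kernel_def by (intro continuous_intros assms) auto
qed

lemma open_contains_cball_box:
  fixes S :: "('a::metric_space \<times> 'b::metric_space) set"
  assumes "open S" "z \<in> S"
  obtains r where "r > 0" "cball (fst z) r \<times> cball (snd z) r \<subseteq> S"
proof -
  obtain A B where "open A" "open B" "z \<in> A \<times> B" and AB: "A \<times> B \<subseteq> S"
    using open_prod_elim[OF assms] by blast
  then obtain r1 r2 where "r1 > 0" "cball (fst z) r1 \<subseteq> A" "r2 > 0" "cball (snd z) r2 \<subseteq> B"
    using open_contains_cball by (metis mem_Times_iff)
  then have "min r1 r2 > 0" "cball (fst z) (min r1 r2) \<times> cball (snd z) (min r1 r2) \<subseteq> S"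
    using AB by (auto simp: subset_eq)
  then show ?thesis using that by blast
qed

text \<open>Near a point the derivative in z is a Cauchy integral over one fixed circle, and its
  integrand is jointly continuous in the parameter, the point and the circle variable.\<close>

lemma continuous_on_deriv_param:
  fixes h :: "'t::metric_space \<Rightarrow> complex \<Rightarrow> complex"
  assumes "open S" and cont: "continuous_on S (\<lambda>(t, z). h t z)"
    and diff: "\<And>t z. (t, z) \<in> S \<Longrightarrow> h t field_differentiable at z"
  shows "continuous_on S (\<lambda>(t, z). deriv (h t) z)"
proof (rule continuous_at_imp_continuous_on, rule ballI)
  fix p assume "p \<in> S"
  obtain t0 z0 where p: "p = (t0, z0)" by (cases p)
  obtain r where r: "r > 0" and sub: "cball t0 r \<times> cball z0 r \<subseteq> S"
    using open_contains_cball_box[OF \<open>open S\<close> \<open>p \<in> S\<close>] p by auto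
  let ?U = "ball t0 r \<times> ball z0 r"
  have "continuous_on (?U \<times> cbox 0 1)
      (\<lambda>(q, s). h (fst q) (circlepath z0 r s) * circle_kernel z0 r (snd q) s)"
    unfolding split_beta
  proof (intro continuous_intros)
    have "(fst (fst x), circlepath z0 r (snd x)) \<in> S" if "x \<in> ?U \<times> cbox 0 1" for x
      using that sub circlepath_in_sphere[of r z0 "snd x"] r by (auto simp: subset_eq)
    then have "continuous_on (?U \<times> cbox 0 1)
        (\<lambda>x. (\<lambda>(t, z). h t z) (fst (fst x), circlepath z0 r (snd x)))"
      by (intro continuous_on_compose2[OF cont] continuous_intros) auto
    then show "continuous_on (?U \<times> cbox 0 1) (\<lambda>x. h (fst (fst x)) (circlepath z0 r (snd x)))"
      by simp
  qed auto
  then have "continuous_on ?U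
      (\<lambda>q. integral (cbox 0 1) (\<lambda>s. h (fst q) (circlepath z0 r s) * circle_kernel z0 r (snd q) s))"
    by (rule integral_continuous_on_param)
  moreover have "(\<lambda>(t, z). deriv (h t) z) q
      = integral (cbox 0 1) (\<lambda>s. h (fst q) (circlepath z0 r s) * circle_kernel z0 r (snd q) s)"
    if "q \<in> ?U" for q
  proof -
    have "h (fst q) field_differentiable at z" if "z \<in> cball z0 r" for z
      using diff[of "fst q" z] sub \<open>q \<in> ?U\<close> that by (auto simp: subset_eq)
    then have "h (fst q) holomorphic_on cball z0 r"
      by (simp add: holomorphic_on_def field_differentiable_at_within)
    then show ?thesis
      using that Cauchy_deriv_circle_kernel[of z0 r "h (fst q)" "snd q"]
      by (auto simp: holomorphic_on_imp_continuous_on holomorphic_on_subset split_beta)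
  qed
  ultimately have "continuous_on ?U (\<lambda>(t, z). deriv (h t) z)"
    by (simp cong: continuous_on_cong)
  then show "isCont (\<lambda>(t, z). deriv (h t) z) p"
    using r p by (simp add: continuous_on_eq_continuous_at open_Times)
qed

text \<open>Joint continuity with holomorphy in each variable is much easier to verify than the
  existence of double power series. On open sets the two agree (\<open>analytic2_iff_hol2\<close>),
  so the analysis is carried out with \<open>hol2\<close>.\<close>

definition hol2 :: "(complex \<times> complex \<Rightarrow> complex) \<Rightarrow> (complex \<times> complex) set \<Rightarrow> bool" where
  "hol2 f S \<longleftrightarrow> continuous_on S f \<and>
     (\<forall>z\<in>S. (\<lambda>w. f (w, snd z)) field_differentiable at (fst z) \<and>
            (\<lambda>w. f (fst z, w)) field_differentiable at (snd z))"

lemma hol2_D: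
  assumes "hol2 f S"
  shows "continuous_on S f"
    and "z \<in> S \<Longrightarrow> ((\<lambda>w. f (w, snd z)) has_field_derivative pd1 f z) (at (fst z))"
    and "z \<in> S \<Longrightarrow> ((\<lambda>w. f (fst z, w)) has_field_derivative pd2 f z) (at (snd z))"
  using assms by (auto simp: hol2_def pd1_def pd2_def DERIV_deriv_iff_field_differentiable)

lemma hol2_subset: "hol2 f S \<Longrightarrow> T \<subseteq> S \<Longrightarrow> hol2 f T"
  unfolding hol2_def using continuous_on_subset by blast

lemma continuous_on_comp_swap:
  assumes "continuous_on S f"
  shows "continuous_on (prod.swap ` S) (f \<circ> prod.swap)"
proof (rule continuous_on_compose)
  show "continuous_on (prod.swap ` prod.swap ` S) f"
    using assms by (simp add: image_image)
qed (rule continuous_on_swap)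

text \<open>Exchanging the coordinates transfers results about one partial derivative to the
  other.\<close>

lemma hol2_swap: "hol2 f S \<Longrightarrow> hol2 (f \<circ> prod.swap) (prod.swap ` S)"
  unfolding hol2_def using continuous_on_comp_swap by force

lemma comp_swap_swap: "(f \<circ> prod.swap) \<circ> prod.swap = f"
  by (simp add: fun_eq_iff)

lemma pd_swap: "pd1 (f \<circ> prod.swap) = pd2 f \<circ> prod.swap" "pd2 (f \<circ> prod.swap) = pd1 f \<circ> prod.swap"
  by (simp_all add: fun_eq_iff pd1_def pd2_def)

lemma open_prod_swap: "open S \<Longrightarrow> open (prod.swap ` (S :: (complex \<times> complex) set))"
proof -
  assume "open S"
  then have "open (prod.swap -` S :: (complex \<times> complex) set)"
    by (intro open_vimage continuous_on_swap)
  moreover have "prod.swap -` S = prod.swap ` S"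
    by force
  ultimately show ?thesis by simp
qed

section \<open>Partial derivatives of holomorphic functions\<close>

lemma continuous_on_pd2:
  assumes "open S" "hol2 f S"
  shows "continuous_on S (pd2 f)"
proof -
  have "continuous_on S (\<lambda>(t, z). deriv (\<lambda>w. f (t, w)) z)"
    using assms by (intro continuous_on_deriv_param) (force simp: hol2_def)+
  then show ?thesis
    by (simp add: pd2_def split_beta cong: continuous_on_cong)
qed

lemma continuous_on_pd1:
  assumes "open S" "hol2 f S"
  shows "continuous_on S (pd1 f)"
proof -
  have "continuous_on (prod.swap ` S) (pd2 (f \<circ> prod.swap))"
    by (intro continuous_on_pd2 open_prod_swap hol2_swap assms)
  from continuous_on_comp_swap[OF this] show ?thesis
    by (simp add: pd_swap comp_swap_swap image_image)
qed

lemma hol2_slice1: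
  assumes "hol2 f S" "A \<times> {b} \<subseteq> S"
  shows "(\<lambda>w. f (w, b)) holomorphic_on A"
  using assms unfolding hol2_def holomorphic_on_def
  by (metis SigmaI field_differentiable_at_within fst_conv insertI1 snd_conv subsetD)

lemma hol2_slice2:
  assumes "hol2 f S" "{a} \<times> B \<subseteq> S"
  shows "(\<lambda>w. f (a, w)) holomorphic_on B"
  using assms unfolding hol2_def holomorphic_on_def
  by (metis SigmaI field_differentiable_at_within fst_conv insertI1 snd_conv subsetD)

text \<open>Near z, \<open>pd1 f\<close> is a Cauchy integral over a circle in the first variable,
  and differentiation under the integral sign moves \<open>pd2\<close> onto f. This yields both the
  differentiability of \<open>pd1 f\<close> in the second variable and a formula for the mixed
  derivative.\<close>

lemma pd2_pd1_integral:
  assumes f: "hol2 f S" "open S" and r: "r > 0" and sub: "cball a r \<times> cball b r \<subseteq> S"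
    and z: "z \<in> ball a r \<times> ball b r"
  shows "((\<lambda>w. pd1 f (fst z, w)) has_field_derivative
      integral (cbox 0 1) (\<lambda>s. pd2 f (circlepath a r s, snd z) * circle_kernel a r (fst z) s)) (at (snd z))"
proof -
  let ?c = "circlepath a r" and ?k = "circle_kernel a r (fst z)"
  have c: "?c s \<in> cball a r" for s
    using circlepath_in_sphere[of r a s] r by auto
  have sl: "(\<lambda>w. f (w, t)) holomorphic_on cball a r" if "t \<in> ball b r" for t
    using sub that by (intro hol2_slice1[OF f(1)]) auto
  have eq: "integral (cbox 0 1) (\<lambda>s. f (?c s, t) * ?k s) = pd1 f (fst z, t)" if "t \<in> ball b r" for t
    using z sl[OF that] Cauchy_deriv_circle_kernel[of a r "\<lambda>w. f (w, t)" "fst z"]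
    by (auto simp: pd1_def holomorphic_on_imp_continuous_on holomorphic_on_subset)
  have "((\<lambda>t. integral (cbox 0 1) (\<lambda>s. f (?c s, t) * ?k s)) has_field_derivative
      integral (cbox 0 1) (\<lambda>s. pd2 f (?c s, snd z) * ?k s)) (at (snd z) within ball b r)"
  proof (rule leibniz_rule_field_derivative)
    show "snd z \<in> ball b r" "convex (ball b r)" using z by auto
    fix t assume t: "t \<in> ball b r"
    show "((\<lambda>t. f (?c s, t) * ?k s) has_field_derivative pd2 f (?c s, t) * ?k s) (at t within ball b r)" for s
    proof -
      have "((\<lambda>t. f (?c s, t)) has_field_derivative pd2 f (?c s, t)) (at t)"
        using hol2_D(3)[OF f(1) subsetD[OF sub], of "(?c s, t)"] c[of s] t by simp
      then show ?thesis
        by (rule DERIV_cmult_right[OF has_field_derivative_at_within])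
    qed
    show "(\<lambda>s. f (?c s, t) * ?k s) integrable_on cbox 0 1"
    proof (intro integrable_continuous continuous_intros)
      show "continuous_on (cbox 0 1) (\<lambda>s. f (?c s, t))"
        by (rule continuous_on_compose2[OF hol2_D(1)[OF f(1)]])
          (use c t in \<open>auto intro!: subsetD[OF sub] continuous_intros\<close>)
    qed (use z in auto)
  next
    show "continuous_on (ball b r \<times> cbox 0 1) (\<lambda>(t, s). pd2 f (?c s, t) * ?k s)"
      unfolding split_beta
    proof (intro continuous_intros)
      show "continuous_on (ball b r \<times> cbox 0 1) (\<lambda>x. pd2 f (?c (snd x), fst x))"
        by (rule continuous_on_compose2[OF continuous_on_pd2[OF f(2,1)]])
          (use c in \<open>auto intro!: subsetD[OF sub] continuous_intros\<close>)
    qed (use z in auto)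
  qed
  then have "((\<lambda>t. integral (cbox 0 1) (\<lambda>s. f (?c s, t) * ?k s)) has_field_derivative
      integral (cbox 0 1) (\<lambda>s. pd2 f (?c s, snd z) * ?k s)) (at (snd z))"
    using z by (simp add: at_within_open[OF _ open_ball] mem_Times_iff)
  then show ?thesis
    by (rule has_field_derivative_transform_within_open[where S = "ball b r"]) (use z eq in auto)
qed

lemma hol2_pd1:
  assumes f: "hol2 f S" "open S"
  shows "hol2 (pd1 f) S"
  unfolding hol2_def
proof (intro conjI ballI)
  show "continuous_on S (pd1 f)" by (rule continuous_on_pd1[OF f(2,1)])
  fix z assume z: "z \<in> S"
  obtain r where r: "r > 0" "cball (fst z) r \<times> cball (snd z) r \<subseteq> S"
    using open_contains_cball_box[OF f(2) z] .
  show "(\<lambda>w. pd1 f (fst z, w)) field_differentiable at (snd z)"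
    using pd2_pd1_integral[OF f r, of z] r by (auto simp: field_differentiable_def mem_Times_iff)
  have "(\<lambda>w. f (w, snd z)) holomorphic_on ball (fst z) r"
    using r by (intro hol2_slice1[OF f(1)]) auto
  then have "deriv (\<lambda>w. f (w, snd z)) holomorphic_on ball (fst z) r"
    by (rule holomorphic_deriv) simp
  then show "(\<lambda>w. pd1 f (w, snd z)) field_differentiable at (fst z)"
    using r by (auto simp: pd1_def holomorphic_on_open field_differentiable_def)
qed

lemma hol2_pd2:
  assumes f: "hol2 f S" "open S"
  shows "hol2 (pd2 f) S"
proof -
  have "hol2 (pd1 (f \<circ> prod.swap)) (prod.swap ` S)"
    by (intro hol2_pd1 hol2_swap open_prod_swap f)
  from hol2_swap[OF this] show ?thesis
    by (simp add: pd_swap comp_swap_swap image_image)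
qed

text \<open>Both sides equal the same Cauchy integral of \<open>pd2 f\<close> over a circle in the
  first variable.\<close>

lemma pd2_pd1:
  assumes f: "hol2 f S" "open S" and z: "z \<in> S"
  shows "pd2 (pd1 f) z = pd1 (pd2 f) z"
proof -
  obtain r where r: "r > 0" "cball (fst z) r \<times> cball (snd z) r \<subseteq> S"
    using open_contains_cball_box[OF f(2) z] .
  have "pd2 (pd1 f) z = integral (cbox 0 1)
      (\<lambda>s. pd2 f (circlepath (fst z) r s, snd z) * circle_kernel (fst z) r (fst z) s)"
    unfolding pd2_def[of "pd1 f"] using r
    by (intro DERIV_imp_deriv pd2_pd1_integral[OF f r]) (simp add: mem_Times_iff)
  also have "\<dots> = deriv (\<lambda>w. pd2 f (w, snd z)) (fst z)"
  proof (rule Cauchy_deriv_circle_kernel[symmetric])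
    have *: "(\<lambda>w. pd2 f (w, snd z)) holomorphic_on cball (fst z) r"
      using r by (intro hol2_slice1[OF hol2_pd2[OF f]]) auto
    show "continuous_on (cball (fst z) r) (\<lambda>w. pd2 f (w, snd z))"
      using * by (rule holomorphic_on_imp_continuous_on)
    show "(\<lambda>w. pd2 f (w, snd z)) holomorphic_on ball (fst z) r"
      using * by (rule holomorphic_on_subset) auto
  qed (use r in auto)
  finally show ?thesis by (simp add: pd1_def)
qed

text \<open>Continuous partial derivatives give a total derivative, which the chain rule along real
  paths requires.\<close>

lemma hol2_has_derivative:
  assumes f: "hol2 f S" "open S" and z: "z \<in> S"
  shows "(f has_derivative (\<lambda>v. pd1 f z * fst v + pd2 f z * snd v)) (at z)"
proof -
  obtain r where r: "r > 0" "cball (fst z) r \<times> cball (snd z) r \<subseteq> S"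
    using open_contains_cball_box[OF f(2) z] .
  let ?X = "ball (fst z) r" and ?Y = "ball (snd z) r"
  have sub: "?X \<times> ?Y \<subseteq> S" using r by (auto simp: subset_eq)
  have "((\<lambda>(x, y). f (x, y)) has_derivative
      (\<lambda>(tx, ty). pd1 f z * tx + blinfun_apply (blinfun_mult_right (pd2 f (fst z, snd z))) ty))
      (at (fst z, snd z) within ?X \<times> ?Y)"
  proof (rule has_derivative_partialsI)
    show "((\<lambda>x. f (x, snd z)) has_derivative (*) (pd1 f z)) (at (fst z) within ?X)"
      using hol2_D(2)[OF f(1) z, THEN has_field_derivative_at_within]
      by (simp add: has_field_derivative_def)
    show "((\<lambda>y. f (x, y)) has_derivative blinfun_apply (blinfun_mult_right (pd2 f (x, y))))
        (at y within ?Y)" if "x \<in> ?X" "y \<in> ?Y" for x y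
    proof -
      have "(x, y) \<in> S" using that sub by blast
      then show ?thesis
        using hol2_D(3)[OF f(1), of "(x, y)", THEN has_field_derivative_at_within]
        by (simp add: has_field_derivative_def)
    qed
    have "continuous_on (?X \<times> ?Y) (\<lambda>(x, y). blinfun_mult_right (pd2 f (x, y)))"
      unfolding split_beta
      by (intro bounded_linear.continuous_on[OF bounded_linear_blinfun_mult_right])
        (simp add: continuous_on_subset[OF continuous_on_pd2[OF f(2,1)] sub])
    then show "continuous (at (fst z, snd z) within ?X \<times> ?Y)
        (\<lambda>(x, y). blinfun_mult_right (pd2 f (x, y)))"
      unfolding continuous_on_eq_continuous_within by (rule bspec) (use r in \<open>simp add: mem_Times_iff\<close>)
  qed (use r in auto)
  moreover have "at (fst z, snd z) within ?X \<times> ?Y = at z"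
    using r by (simp add: at_within_open[OF _ open_Times] mem_Times_iff)
  ultimately show ?thesis
    by (simp add: case_prod_unfold)
qed

lemma hol2_chain:
  assumes "hol2 f S" "open S" "\<gamma> t \<in> S" "(\<gamma> has_vector_derivative v) (at t within T)"
  shows "((\<lambda>t. f (\<gamma> t)) has_vector_derivative pd1 f (\<gamma> t) * fst v + pd2 f (\<gamma> t) * snd v) (at t within T)"
  using vector_derivative_diff_chain_within[OF assms(4)
      has_derivative_at_withinI[OF hol2_has_derivative[OF assms(1-3)]]]
  by (simp add: comp_def)

lemma hol2_zero_partials_constant:
  assumes f: "hol2 f S" "open S" "connected S"
    and "\<And>z. z \<in> S \<Longrightarrow> pd1 f z = 0" "\<And>z. z \<in> S \<Longrightarrow> pd2 f z = 0"
  shows "f constant_on S"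
proof -
  have "(f has_derivative (\<lambda>h. 0)) (at z)" if "z \<in> S" for z
    using hol2_has_derivative[OF f(1,2) that] assms(4,5) that by simp
  then have "f x = f y" if "x \<in> S" "y \<in> S" for x y
    by (rule has_derivative_zero_unique_connected[OF f(2,3) _ that])
  then show ?thesis
    unfolding constant_on_def by blast
qed

section \<open>Path integrals and potentials of closed forms\<close>

lemma form_integral_potential:
  assumes \<phi>: "hol2 \<phi> S" "open S" "\<phi> p = 0"
    and "\<And>z. z \<in> S \<Longrightarrow> pd1 \<phi> z = P z" "\<And>z. z \<in> S \<Longrightarrow> pd2 \<phi> z = Q z"
  shows "form_integral S p P Q \<phi>"
  unfolding form_integral_def
proof (intro ballI allI impI, elim conjE)
  fix q \<gamma> assume "q \<in> S" "valid_path \<gamma>" and im: "path_image \<gamma> \<subseteq> S"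
    and ends: "pathstart \<gamma> = p" "pathfinish \<gamma> = q"
  have in_S: "\<gamma> t \<in> S" if "t \<in> {0..1}" for t
    using im that by (auto simp: path_image_def)
  obtain K where K: "finite K" "\<gamma> C1_differentiable_on {0..1} - K" and cont: "continuous_on {0..1} \<gamma>"
    using \<open>valid_path \<gamma>\<close> unfolding valid_path_def piecewise_C1_differentiable_on_def by blast
  let ?v = "\<lambda>t. vector_derivative \<gamma> (at t within {0..1})"
  have "((\<lambda>t. P (\<gamma> t) * fst (?v t) + Q (\<gamma> t) * snd (?v t)) has_integral \<phi> (\<gamma> 1) - \<phi> (\<gamma> 0)) {0..1}"
  \<comment> \<open>A valid path is only piecewise C1; this version of the fundamental theorem
    tolerates the finite set \<open>K\<close> of exceptional parameters.\<close>
  proof (rule fundamental_theorem_of_calculus_interior_strong[OF K(1)])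
    show "continuous_on {0..1} (\<lambda>t. \<phi> (\<gamma> t))"
      by (rule continuous_on_compose2[OF hol2_D(1)[OF \<phi>(1)] cont]) (use in_S in auto)
    fix t :: real assume t: "t \<in> {0<..<1} - K"
    then have "(\<gamma> has_vector_derivative vector_derivative \<gamma> (at t)) (at t)"
      using K(2) by (auto simp: C1_differentiable_on_eq vector_derivative_works)
    moreover from this have "?v t = vector_derivative \<gamma> (at t)"
      by (rule vector_derivative_at_within_ivl) (use t in auto)
    ultimately have "((\<lambda>t. \<phi> (\<gamma> t)) has_vector_derivative
        pd1 \<phi> (\<gamma> t) * fst (?v t) + pd2 \<phi> (\<gamma> t) * snd (?v t)) (at t)"
      using in_S[of t] t by (intro hol2_chain[OF \<phi>(1,2)]) auto
    then show "((\<lambda>t. \<phi> (\<gamma> t)) has_vector_derivative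
        P (\<gamma> t) * fst (?v t) + Q (\<gamma> t) * snd (?v t)) (at t)"
      using in_S[of t] t assms(4,5) by simp
  qed simp
  then show "((\<lambda>t. P (\<gamma> t) * fst (?v t) + Q (\<gamma> t) * snd (?v t)) has_integral \<phi> q) {0..1}"
    using ends \<phi>(3) by (simp add: pathstart_def pathfinish_def)
qed

definition ray :: "complex \<times> complex \<Rightarrow> real \<Rightarrow> complex \<times> complex \<Rightarrow> complex \<times> complex" where
  "ray p s z = (fst p + of_real s * (fst z - fst p), snd p + of_real s * (snd z - snd p))"

lemma ray_in_convex:
  assumes "convex S" "p \<in> S" "z \<in> S" "s \<in> {0..1}"
  shows "ray p s z \<in> S"
proof -
  have "ray p s z = (1 - s) *\<^sub>R p + s *\<^sub>R z"
    by (simp add: ray_def prod_eq_iff scaleR_conv_of_real algebra_simps)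
  then show ?thesis using assms by (simp add: convexD_alt)
qed

lemma ray_1 [simp]: "ray p 1 z = z"
  by (simp add: ray_def)

lemma continuous_on_ray [continuous_intros]:
  "continuous_on A u \<Longrightarrow> continuous_on A v \<Longrightarrow> continuous_on A (\<lambda>x. ray p (u x) (v x))"
  unfolding ray_def by (intro continuous_intros)

definition radial_integral :: "complex \<times> complex \<Rightarrow> (complex \<times> complex \<Rightarrow> complex) \<Rightarrow>
    (complex \<times> complex \<Rightarrow> complex) \<Rightarrow> complex \<times> complex \<Rightarrow> complex" where
  "radial_integral p P Q z = integral (cbox 0 1)
     (\<lambda>s. P (ray p s z) * (fst z - fst p) + Q (ray p s z) * (snd z - snd p))"

text \<open>The candidate potential integrates the form along the segment from p to z.
  Differentiated under the integral sign, its integrand becomes, by closedness, the s-derivative of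
  s * P(\<open>ray p s z\<close>), whose integral over [0, 1] is P z.\<close>

lemma radial_integral_derivative1:
  assumes S: "open S" "convex S" and P: "hol2 P S" and Q: "hol2 Q S"
    and closed: "\<And>z. z \<in> S \<Longrightarrow> pd1 Q z = pd2 P z" and p: "p \<in> S" and z: "z \<in> S"
  shows "((\<lambda>w. radial_integral p P Q (w, snd z)) has_field_derivative P z) (at (fst z))"
proof -
  let ?U = "(\<lambda>w. (w, snd z)) -` S"
  have U: "open ?U" "convex ?U" "fst z \<in> ?U"
  proof -
    show "open ?U" by (intro open_vimage S continuous_intros)
    show "convex ?U"
    proof (rule convexI)
      fix x y and u v :: real assume "x \<in> ?U" "y \<in> ?U" "0 \<le> u" "0 \<le> v" "u + v = 1"
      then have "u *\<^sub>R (x, snd z) + v *\<^sub>R (y, snd z) \<in> S"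
        by (intro convexD[OF S(2)]) auto
      moreover have "u *\<^sub>R (x, snd z) + v *\<^sub>R (y, snd z) = (u *\<^sub>R x + v *\<^sub>R y, snd z)"
        using \<open>u + v = 1\<close> by (simp add: scaleR_add_left[symmetric])
      ultimately show "u *\<^sub>R x + v *\<^sub>R y \<in> ?U" by simp
    qed
    show "fst z \<in> ?U" using z by simp
  qed
  let ?l = "\<lambda>w s. ray p s (w, snd z)"
  let ?F = "\<lambda>w s. P (?l w s) * (w - fst p) + Q (?l w s) * (snd z - snd p)"
  let ?F' = "\<lambda>w s. pd1 P (?l w s) * of_real s * (w - fst p) + P (?l w s)
                   + pd1 Q (?l w s) * of_real s * (snd z - snd p)"
  have l_in: "?l w s \<in> S" if "w \<in> ?U" "s \<in> cbox 0 1" for w s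
    using that by (intro ray_in_convex S p) (auto simp: cbox_interval)
  have deriv_l: "((\<lambda>w. g (?l w s)) has_field_derivative pd1 g (?l w s) * of_real s) (at w within ?U)"
    if "hol2 g S" "w \<in> ?U" "s \<in> cbox 0 1" for g w s
  proof -
    have "((\<lambda>v. g (v, snd (?l w s))) has_field_derivative pd1 g (?l w s)) (at (fst (?l w s)))"
      by (rule hol2_D(2)[OF that(1) l_in[OF that(2,3)]])
    then have "((\<lambda>v. g (v, snd p + of_real s * (snd z - snd p))) has_field_derivative pd1 g (?l w s))
        (at (fst p + of_real s * (w - fst p)))"
      by (simp add: ray_def)
    then have "((\<lambda>w. g (fst p + of_real s * (w - fst p), snd p + of_real s * (snd z - snd p)))
        has_field_derivative pd1 g (?l w s) * of_real s) (at w within ?U)"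
      by (rule DERIV_chain2) (auto intro!: derivative_eq_intros)
    then show ?thesis by (simp add: ray_def)
  qed
  have cont_l: "continuous_on (?U \<times> cbox 0 1) (\<lambda>x. g (?l (fst x) (snd x)))" if "continuous_on S g"
    for g :: "complex \<times> complex \<Rightarrow> complex"
    by (rule continuous_on_compose2[OF that]) (use l_in in \<open>auto intro!: continuous_intros\<close>)
  have "((\<lambda>w. integral (cbox 0 1) (?F w)) has_field_derivative integral (cbox 0 1) (?F' (fst z)))
      (at (fst z) within ?U)"
  proof (rule leibniz_rule_field_derivative)
    fix w s assume ws: "w \<in> ?U" "s \<in> cbox (0::real) 1"
    show "((\<lambda>w. ?F w s) has_field_derivative ?F' w s) (at w within ?U)"
      by (rule derivative_eq_intros deriv_l[OF P ws] deriv_l[OF Q ws] refl)+ simp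
  next
    fix w assume w: "w \<in> ?U"
    have "continuous_on (cbox 0 1) (\<lambda>s. g (?l w s))" if "hol2 g S" for g
      by (rule continuous_on_compose2[OF hol2_D(1)[OF that]])
        (use l_in[OF w] in \<open>auto intro!: continuous_intros\<close>)
    then show "?F w integrable_on cbox 0 1"
      by (intro integrable_continuous continuous_intros) (use P Q in auto)
  next
    show "continuous_on (?U \<times> cbox 0 1) (\<lambda>(w, s). ?F' w s)"
      unfolding split_beta
      by (intro continuous_intros cont_l continuous_on_pd1 hol2_D(1)[OF P] S P Q)
  qed (use U in auto)
  then have "((\<lambda>w. radial_integral p P Q (w, snd z)) has_field_derivative
      integral (cbox 0 1) (?F' (fst z))) (at (fst z))"
    using U by (simp add: at_within_open[OF U(3,1)] radial_integral_def)
  moreover have "(?F' (fst z) has_integral P z) (cbox 0 1)"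
  proof -
    have "((\<lambda>s. of_real s * P (?l (fst z) s)) has_vector_derivative ?F' (fst z) s) (at s within {0..1})"
      if s: "s \<in> {0..1}" for s
    proof -
      have l: "?l (fst z) s \<in> S" using l_in[OF U(3)] s by (auto simp: cbox_interval)
      have "((\<lambda>s. ray p s z) has_vector_derivative (fst z - fst p, snd z - snd p)) (at s within {0..1})"
        unfolding ray_def by (auto intro!: derivative_eq_intros simp: has_vector_derivative_Pair)
      from hol2_chain[OF P S(1) _ this] l
      have "((\<lambda>s. P (ray p s z)) has_vector_derivative
          pd1 P (ray p s z) * (fst z - fst p) + pd2 P (ray p s z) * (snd z - snd p)) (at s within {0..1})"
        by simp
      moreover have "pd2 P (ray p s z) = pd1 Q (ray p s z)"
        using closed l by simp
      ultimately show ?thesis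
        by (auto intro!: derivative_eq_intros simp: algebra_simps)
    qed
    then have "(?F' (fst z) has_integral of_real 1 * P (?l (fst z) 1) - of_real 0 * P (?l (fst z) 0)) {0..1}"
      by (intro fundamental_theorem_of_calculus) auto
    then show ?thesis
      by (simp add: cbox_interval)
  qed
  ultimately show ?thesis
    by (simp add: integral_unique)
qed

lemma radial_integral_swap:
  "radial_integral p P Q \<circ> prod.swap = radial_integral (prod.swap p) (Q \<circ> prod.swap) (P \<circ> prod.swap)"
proof -
  have "ray p s (prod.swap z) = prod.swap (ray (prod.swap p) s z)" for s z
    by (simp add: ray_def prod.swap_def)
  then show ?thesis
    by (simp add: fun_eq_iff radial_integral_def add.commute)
qed

lemma Poincare_hol2:
  assumes S: "open S" "convex S" and P: "hol2 P S" and Q: "hol2 Q S"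
    and closed: "\<And>z. z \<in> S \<Longrightarrow> pd1 Q z = pd2 P z" and p: "p \<in> S"
  obtains \<phi> where "hol2 \<phi> S" "\<phi> p = 0" "\<And>z. z \<in> S \<Longrightarrow> pd1 \<phi> z = P z" "\<And>z. z \<in> S \<Longrightarrow> pd2 \<phi> z = Q z"
proof
  let ?\<phi> = "radial_integral p P Q"
  let ?sw = "prod.swap :: complex \<times> complex \<Rightarrow> _"
  have d1: "((\<lambda>w. ?\<phi> (w, snd z)) has_field_derivative P z) (at (fst z))" if "z \<in> S" for z
    by (rule radial_integral_derivative1[OF S P Q closed p that])
  \<comment> \<open>Swapping the coordinates exchanges P and Q and preserves closedness, so the
    derivative in x2 is the previous lemma for the swapped form.\<close>
  have d2: "((\<lambda>w. ?\<phi> (fst z, w)) has_field_derivative Q z) (at (snd z))" if z: "z \<in> S" for z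
  proof -
    have "convex (?sw ` S)"
      by (rule convex_linear_image[OF _ S(2)]) (auto intro!: linearI simp: prod.swap_def)
    then have "((\<lambda>w. (?\<phi> \<circ> ?sw) (w, snd (?sw z))) has_field_derivative (Q \<circ> ?sw) (?sw z)) (at (fst (?sw z)))"
      unfolding radial_integral_swap
      using closed p z
      by (intro radial_integral_derivative1[of "?sw ` S"] open_prod_swap S hol2_swap P Q)
        (auto simp: pd_swap)
    then show ?thesis by simp
  qed
  have "continuous_on (S \<times> cbox 0 1)
      (\<lambda>(z, s). P (ray p s z) * (fst z - fst p) + Q (ray p s z) * (snd z - snd p))"
  proof -
    have "continuous_on (S \<times> cbox 0 1) (\<lambda>x. g (ray p (snd x) (fst x)))" if "hol2 g S" for g
      by (rule continuous_on_compose2[OF hol2_D(1)[OF that]])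
        (use ray_in_convex[OF S(2) p] in \<open>auto intro!: continuous_intros simp: cbox_interval\<close>)
    then show ?thesis
      unfolding split_beta by (intro continuous_intros) (use P Q in auto)
  qed
  then have "continuous_on S ?\<phi>"
    unfolding radial_integral_def by (rule integral_continuous_on_param)
  then show "hol2 ?\<phi> S"
    unfolding hol2_def field_differentiable_def using d1 d2 by blast
  show "pd1 ?\<phi> z = P z" "pd2 ?\<phi> z = Q z" if "z \<in> S" for z
    using DERIV_imp_deriv[OF d1[OF that]] DERIV_imp_deriv[OF d2[OF that]]
    by (simp_all add: pd1_def pd2_def)
  show "?\<phi> p = 0"
    by (simp add: radial_integral_def)
qed

section \<open>Closure properties and rules of differentiation\<close>

lemma hol2_const [intro, simp]: "hol2 (\<lambda>z. c) S"
  by (simp add: hol2_def)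

lemma hol2_fst [intro, simp]: "hol2 fst S"
  by (simp add: hol2_def continuous_on_fst)

lemma hol2_snd [intro, simp]: "hol2 snd S"
  by (simp add: hol2_def continuous_on_snd)

lemma hol2_add: "hol2 f S \<Longrightarrow> hol2 g S \<Longrightarrow> hol2 (\<lambda>z. f z + g z) S"
  by (simp add: hol2_def continuous_on_add field_differentiable_add)

lemma hol2_diff: "hol2 f S \<Longrightarrow> hol2 g S \<Longrightarrow> hol2 (\<lambda>z. f z - g z) S"
  by (simp add: hol2_def continuous_on_diff field_differentiable_diff)

lemma hol2_minus: "hol2 f S \<Longrightarrow> hol2 (\<lambda>z. - f z) S"
  by (simp add: hol2_def continuous_on_minus field_differentiable_minus)

lemma hol2_mult: "hol2 f S \<Longrightarrow> hol2 g S \<Longrightarrow> hol2 (\<lambda>z. f z * g z) S"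
  by (simp add: hol2_def continuous_on_mult field_differentiable_mult)

lemma hol2_divide:
  "hol2 f S \<Longrightarrow> hol2 g S \<Longrightarrow> (\<And>z. z \<in> S \<Longrightarrow> g z \<noteq> 0) \<Longrightarrow> hol2 (\<lambda>z. f z / g z) S"
  by (simp add: hol2_def continuous_on_divide field_differentiable_divide)

lemma hol2_power: "hol2 f S \<Longrightarrow> hol2 (\<lambda>z. f z ^ n) S"
  by (simp add: hol2_def continuous_on_power field_differentiable_power)

lemma hol2_compose:
  assumes f: "hol2 f S" and g: "g holomorphic_on T" "open T" and sub: "\<And>z. z \<in> S \<Longrightarrow> f z \<in> T"
  shows "hol2 (\<lambda>z. g (f z)) S"
  unfolding hol2_def
proof (intro conjI ballI)
  show "continuous_on S (\<lambda>z. g (f z))"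
    using sub by (intro continuous_on_compose2[OF holomorphic_on_imp_continuous_on[OF g(1)] hol2_D(1)[OF f]]) auto
  fix z assume z: "z \<in> S"
  have g': "g field_differentiable at (f z)"
    using g sub[OF z] holomorphic_on_imp_differentiable_at by blast
  show "(\<lambda>w. g (f (w, snd z))) field_differentiable at (fst z)"
    using field_differentiable_compose[of "\<lambda>w. f (w, snd z)" "fst z" g] f g' z
    by (simp add: hol2_def comp_def)
  show "(\<lambda>w. g (f (fst z, w))) field_differentiable at (snd z)"
    using field_differentiable_compose[of "\<lambda>w. f (fst z, w)" "snd z" g] f g' z
    by (simp add: hol2_def comp_def)
qed

lemma hol2_exp: "hol2 f S \<Longrightarrow> hol2 (\<lambda>z. exp (f z)) S"
  by (rule hol2_compose[of f S exp UNIV]) (auto intro: holomorphic_intros)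

lemmas hol2_intros = hol2_const hol2_fst hol2_snd hol2_add hol2_diff hol2_minus hol2_mult
  hol2_power hol2_exp

lemma pd_eqI:
  "((\<lambda>w. f (w, snd z)) has_field_derivative D) (at (fst z)) \<Longrightarrow> pd1 f z = D"
  "((\<lambda>w. f (fst z, w)) has_field_derivative D) (at (snd z)) \<Longrightarrow> pd2 f z = D"
  by (simp_all add: pd1_def pd2_def DERIV_imp_deriv)

lemma eventually_nhds_slice:
  assumes "open S" "z \<in> S"
  shows "eventually (\<lambda>w. (w, snd z) \<in> S) (nhds (fst z))"
    and "eventually (\<lambda>w. (fst z, w) \<in> S) (nhds (snd z))"
proof -
  have "open ((\<lambda>w. (w, snd z)) -` S)" "open ((\<lambda>w. (fst z, w)) -` S)"
    by (intro open_vimage assms continuous_intros)+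
  then show "eventually (\<lambda>w. (w, snd z) \<in> S) (nhds (fst z))"
    and "eventually (\<lambda>w. (fst z, w) \<in> S) (nhds (snd z))"
    using assms(2) by (auto simp: eventually_nhds)
qed

lemma pd_cong_open:
  assumes "open S" "z \<in> S" "\<And>w. w \<in> S \<Longrightarrow> f w = g w"
  shows "pd1 f z = pd1 g z" "pd2 f z = pd2 g z"
  unfolding pd1_def pd2_def
  by (intro deriv_cong_ev refl eventually_mono[OF eventually_nhds_slice(1)[OF assms(1,2)]]
      eventually_mono[OF eventually_nhds_slice(2)[OF assms(1,2)]] assms(3); simp)+

lemma hol2_cong: 
  assumes "open S" "\<And>w. w \<in> S \<Longrightarrow> f w = g w" "hol2 f S"
  shows "hol2 g S"
  unfolding hol2_def
proof (intro conjI ballI)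
  show "continuous_on S g"
    using continuous_on_eq[OF hol2_D(1)[OF assms(3)] assms(2)] .
  fix z assume z: "z \<in> S"
  have ev1: "eventually (\<lambda>w. f (w, snd z) = g (w, snd z)) (nhds (fst z))"
    using eventually_nhds_slice(1)[OF assms(1) z] by eventually_elim (rule assms(2))
  show "(\<lambda>w. g (w, snd z)) field_differentiable at (fst z)"
    using DERIV_cong_ev[OF refl ev1 refl, THEN iffD1, OF hol2_D(2)[OF assms(3) z]]
    unfolding field_differentiable_def by blast
  have ev2: "eventually (\<lambda>w. f (fst z, w) = g (fst z, w)) (nhds (snd z))"
    using eventually_nhds_slice(2)[OF assms(1) z] by eventually_elim (rule assms(2))
  show "(\<lambda>w. g (fst z, w)) field_differentiable at (snd z)"
    using DERIV_cong_ev[OF refl ev2 refl, THEN iffD1, OF hol2_D(3)[OF assms(3) z]]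
    unfolding field_differentiable_def by blast
qed

lemma pd_add:
  assumes "hol2 f S" "hol2 g S" "z \<in> S"
  shows "pd1 (\<lambda>z. f z + g z) z = pd1 f z + pd1 g z" "pd2 (\<lambda>z. f z + g z) z = pd2 f z + pd2 g z"
  by (rule pd_eqI; use assms in \<open>auto intro!: derivative_eq_intros hol2_D\<close>)+

lemma pd_minus:
  assumes "hol2 f S" "z \<in> S"
  shows "pd1 (\<lambda>z. - f z) z = - pd1 f z" "pd2 (\<lambda>z. - f z) z = - pd2 f z"
  by (rule pd_eqI; use assms in \<open>auto intro!: derivative_eq_intros hol2_D\<close>)+

lemma pd_diff:
  assumes "hol2 f S" "hol2 g S" "z \<in> S"
  shows "pd1 (\<lambda>z. f z - g z) z = pd1 f z - pd1 g z" "pd2 (\<lambda>z. f z - g z) z = pd2 f z - pd2 g z"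
  by (rule pd_eqI; use assms in \<open>auto intro!: derivative_eq_intros hol2_D\<close>)+

lemma pd_mult:
  assumes "hol2 f S" "hol2 g S" "z \<in> S"
  shows "pd1 (\<lambda>z. f z * g z) z = pd1 f z * g z + f z * pd1 g z"
    and "pd2 (\<lambda>z. f z * g z) z = pd2 f z * g z + f z * pd2 g z"
proof -
  show "pd1 (\<lambda>z. f z * g z) z = pd1 f z * g z + f z * pd1 g z"
    by (rule pd_eqI(1), rule DERIV_cong[OF DERIV_mult[OF hol2_D(2)[OF assms(1,3)] hol2_D(2)[OF assms(2,3)]]])
      (simp add: algebra_simps)
  show "pd2 (\<lambda>z. f z * g z) z = pd2 f z * g z + f z * pd2 g z"
    by (rule pd_eqI(2), rule DERIV_cong[OF DERIV_mult[OF hol2_D(3)[OF assms(1,3)] hol2_D(3)[OF assms(2,3)]]])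
      (simp add: algebra_simps)
qed

lemma pd_compose:
  assumes "hol2 f S" "z \<in> S" "(g has_field_derivative D) (at (f z))"
  shows "pd1 (\<lambda>z. g (f z)) z = D * pd1 f z" "pd2 (\<lambda>z. g (f z)) z = D * pd2 f z"
proof -
  show "pd1 (\<lambda>z. g (f z)) z = D * pd1 f z"
    by (rule pd_eqI(1), rule DERIV_chain2[OF _ hol2_D(2)[OF assms(1,2)]]) (simp add: assms(3))
  show "pd2 (\<lambda>z. g (f z)) z = D * pd2 f z"
    by (rule pd_eqI(2), rule DERIV_chain2[OF _ hol2_D(3)[OF assms(1,2)]]) (simp add: assms(3))
qed

lemma pd_exp:
  assumes "hol2 f S" "z \<in> S"
  shows "pd1 (\<lambda>z. exp (f z)) z = exp (f z) * pd1 f z" "pd2 (\<lambda>z. exp (f z)) z = exp (f z) * pd2 f z"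
  by (rule pd_compose[OF assms DERIV_exp])+

lemma pd_power:
  assumes "hol2 f S" "z \<in> S"
  shows "pd1 (\<lambda>z. f z ^ n) z = of_nat n * f z ^ (n - 1) * pd1 f z"
    and "pd2 (\<lambda>z. f z ^ n) z = of_nat n * f z ^ (n - 1) * pd2 f z"
proof -
  have "((\<lambda>x. x ^ n) has_field_derivative of_nat n * f z ^ (n - 1)) (at (f z))"
    by (auto intro!: derivative_eq_intros)
  from pd_compose[OF assms this] show "pd1 (\<lambda>z. f z ^ n) z = of_nat n * f z ^ (n - 1) * pd1 f z"
    and "pd2 (\<lambda>z. f z ^ n) z = of_nat n * f z ^ (n - 1) * pd2 f z" .
qed

lemma hol2_pd_funpow:
  assumes "hol2 f S" "open S"
  shows "hol2 ((pd1 ^^ i) ((pd2 ^^ j) f)) S"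
proof -
  have "hol2 ((pd2 ^^ j) f) S"
    by (induction j) (use assms hol2_pd2 in auto)
  then show ?thesis
    by (induction i) (use assms hol2_pd1 in auto)
qed

section \<open>Power series in two variables\<close>

lemma analytic2_imp_hol2:
  assumes "analytic2_on f S" "open S"
  shows "hol2 f S"
proof -
  have "continuous (at z) f \<and> (\<lambda>w. f (w, snd z)) field_differentiable at (fst z)
      \<and> (\<lambda>w. f (fst z, w)) field_differentiable at (snd z)" if "z \<in> S" for z
  proof -
    obtain a b where ab: "z = (a, b)" by (cases z)
    have "\<exists>c e. e > 0 \<and> (\<forall>z1 z2. dist z1 a < e \<and> dist z2 b < e \<longrightarrow>
        ((\<lambda>(i, j). c (i, j) * (z1 - a) ^ i * (z2 - b) ^ j) has_sum f (z1, z2)) UNIV)"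
      using assms(1) that unfolding analytic2_on_def ab by blast
    then obtain c e where e: "e > 0" and sums: "\<And>z1 z2. dist z1 a < e \<Longrightarrow> dist z2 b < e \<Longrightarrow>
        ((\<lambda>(i, j). c (i, j) * (z1 - a) ^ i * (z2 - b) ^ j) has_sum f (z1, z2)) UNIV"
      by (elim exE conjE) blast
    \<comment> \<open>Any positive radius below e would do: absolute convergence at the corner (a +
      r, b + r) supplies the majorant \<open>M\<close> for all terms on the closed polydisc of
      radius r.\<close>
    define r where "r = e / 2"
    have r: "r > 0" "r < e" using e by (auto simp: r_def)
    define M where "M = (\<lambda>x. norm (c x * of_real r ^ fst x * of_real r ^ snd x))"
    have "(\<lambda>(i, j). c (i, j) * (a + of_real r - a) ^ i * (b + of_real r - b) ^ j) summable_on UNIV"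
      using r by (intro has_sum_imp_summable[OF sums]) (auto simp: dist_norm)
    then have M: "M summable_on UNIV"
      using summable_on_iff_abs_summable_on_complex[THEN iffD1] by (simp add: M_def case_prod_unfold)
    let ?t = "\<lambda>x z. c x * (fst z - a) ^ fst x * (snd z - b) ^ snd x"
    \<comment> \<open>Stated along an arbitrary map g, so that one M-test covers the polydisc, for
      joint continuity, and both slices, for holomorphy in each variable.\<close>
    have ul: "uniform_limit T (\<lambda>X w. \<Sum>x\<in>X. ?t x (g w)) (\<lambda>w. f (g w)) (finite_subsets_at_top UNIV)"
      if g: "\<And>w. w \<in> T \<Longrightarrow> g w \<in> cball a r \<times> cball b r" for T and g :: "'t \<Rightarrow> complex \<times> complex"
    proof (rule Weierstrass_m_test_general'[OF _ _ M])
      fix x w assume "w \<in> T"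
      then have "norm (fst (g w) - a) \<le> r" "norm (snd (g w) - b) \<le> r"
        using g[of w] by (auto simp: dist_norm norm_minus_commute mem_Times_iff)
      then show "norm (?t x (g w)) \<le> M x"
        unfolding M_def norm_mult norm_power using r
        by (intro mult_mono power_mono mult_nonneg_nonneg) auto
    next
      fix w assume "w \<in> T"
      then have "dist (fst (g w)) a < e" "dist (snd (g w)) b < e"
        using g[of w] r by (auto simp: dist_commute mem_Times_iff)
      from sums[OF this] show "((\<lambda>x. ?t x (g w)) has_sum f (g w)) UNIV"
        by (simp add: case_prod_unfold)
    qed
    have "continuous_on (cball a r \<times> cball b r) f"
      by (rule uniform_limit_theorem[OF _ ul[of _ "\<lambda>w. w"]])
        (auto intro!: always_eventually continuous_intros)
    then have "continuous_on (ball a r \<times> ball b r) f"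
      by (rule continuous_on_subset) auto
    then have "continuous (at z) f"
      using r ab by (simp add: continuous_on_eq_continuous_at open_Times)
    moreover have "(\<lambda>w. f (w, b)) holomorphic_on ball a r"
      by (rule holomorphic_uniform_limit[OF _ ul[of "cball a r" "\<lambda>w. (w, b)"]])
        (use r in \<open>auto intro!: always_eventually continuous_intros holomorphic_intros\<close>)
    moreover have "(\<lambda>w. f (a, w)) holomorphic_on ball b r"
      by (rule holomorphic_uniform_limit[OF _ ul[of "cball b r" "\<lambda>w. (a, w)"]])
        (use r in \<open>auto intro!: always_eventually continuous_intros holomorphic_intros\<close>)
    ultimately show ?thesis
      using r ab by (simp add: holomorphic_on_imp_differentiable_at[OF _ open_ball])
  qed
  then show ?thesis
    unfolding hol2_def by (simp add: continuous_at_imp_continuous_on)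
qed

lemma summable_on_geometric_pairs:
  fixes p q :: real
  assumes "0 \<le> p" "p < 1" "0 \<le> q" "q < 1" "M \<ge> 0"
  shows "(\<lambda>(i, j). M * p ^ i * q ^ j) summable_on UNIV"
proof -
  have geom: "((\<lambda>j. q ^ j) has_sum 1 / (1 - q)) UNIV" if "0 \<le> q" "q < 1" for q :: real
    using that geometric_sums[of q] by (intro norm_summable_imp_has_sum) (auto simp: norm_power)
  have "(\<lambda>(i, j). M * p ^ i * q ^ j) summable_on (SIGMA i:UNIV. UNIV)"
  proof (rule summable_on_SigmaI)
    show "((\<lambda>j. case (i, j) of (i, j) \<Rightarrow> M * p ^ i * q ^ j) has_sum M * p ^ i * (1 / (1 - q))) UNIV"
      for i using has_sum_cmult_right[OF geom[OF assms(3,4)], of "M * p ^ i"] by simp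
    have "(\<lambda>i. (M * (1 / (1 - q))) * p ^ i) summable_on UNIV"
      by (intro summable_on_cmult_right has_sum_imp_summable[OF geom] assms)
    then show "(\<lambda>i. M * p ^ i * (1 / (1 - q))) summable_on UNIV"
      by (simp add: mult_ac)
  qed (use assms in auto)
  then show ?thesis by simp
qed

text \<open>Osgood's lemma, by expanding first in one variable and then the coefficients in the other.\<close>

lemma hol2_imp_analytic2:
  assumes f: "hol2 f S" "open S"
  shows "analytic2_on f S"
  unfolding analytic2_on_def
proof (intro allI impI)
  fix a b assume ab: "(a, b) \<in> S"
  obtain r where r: "r > 0" and sub: "cball a r \<times> cball b r \<subseteq> S"
    using open_contains_cball_box[OF f(2) ab] by auto
  have "compact (f ` (cball a r \<times> cball b r))"
    by (intro compact_continuous_image continuous_on_subset[OF hol2_D(1)[OF f(1)] sub] compact_Times compact_cball)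
  then obtain M where "\<forall>y\<in>f ` (cball a r \<times> cball b r). norm y \<le> M"
    using compact_imp_bounded bounded_iff by blast
  then have M: "norm (f z) \<le> M" if "z \<in> cball a r \<times> cball b r" for z
    using that by blast
  have "M \<ge> 0"
    using order_trans[OF norm_ge_zero M[of "(a, b)"]] r by simp
  \<comment> \<open>\<open>g i\<close> is the i-th Taylor coefficient in the first variable, as a
    function of the second; \<open>c\<close> collects the Taylor coefficients of all
    \<open>g i\<close>.\<close>
  define g where "g = (\<lambda>i t. (pd1 ^^ i) f (a, t) / fact i)"
  define c where "c = (\<lambda>(i, j). (deriv ^^ j) (g i) b / fact j)"
  have pd1_deriv: "(pd1 ^^ i) f (w, t) = (deriv ^^ i) (\<lambda>w. f (w, t)) w" for i w t
    by (induction i arbitrary: w) (simp_all add: pd1_def)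
  have slice: "(\<lambda>w. f (w, t)) holomorphic_on cball a r" if "t \<in> cball b r" for t
    using that sub by (intro hol2_slice1[OF f(1)]) auto
  have slice_ball: "(\<lambda>w. f (w, t)) holomorphic_on ball a r" if "t \<in> cball b r" for t
    by (rule holomorphic_on_subset[OF slice[OF that]]) auto
  have g_hol: "g i holomorphic_on cball b r" for i
  proof -
    have "{a} \<times> cball b r \<subseteq> S" using sub r by (auto simp: subset_eq)
    then show ?thesis
      unfolding g_def using hol2_slice2[OF hol2_pd_funpow[OF f, of i 0]]
      by (intro holomorphic_intros) auto
  qed
  have g_hol_ball: "g i holomorphic_on ball b r" for i
    by (rule holomorphic_on_subset[OF g_hol]) auto
  have g_bound: "norm (g i t) \<le> M / r ^ i" if "t \<in> cball b r" for i t
  proof -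
    have "norm ((deriv ^^ i) (\<lambda>w. f (w, t)) a) \<le> fact i * M / r ^ i"
      using slice[OF that] slice_ball[OF that] r that M
      by (intro Cauchy_inequality holomorphic_on_imp_continuous_on) (auto simp: dist_norm)
    then show ?thesis
      using r by (simp add: g_def pd1_deriv norm_divide field_simps)
  qed
  have c_bound: "norm (c (i, j)) \<le> M / r ^ i / r ^ j" for i j
  proof -
    have "norm ((deriv ^^ j) (g i) b) \<le> fact j * (M / r ^ i) / r ^ j"
      using g_hol[of i] g_hol_ball[of i] r g_bound
      by (intro Cauchy_inequality holomorphic_on_imp_continuous_on) (auto simp: dist_norm)
    then show ?thesis
      using r by (simp add: c_def norm_divide field_simps)
  qed
  have "((\<lambda>(i, j). c (i, j) * (z1 - a) ^ i * (z2 - b) ^ j) has_sum f (z1, z2)) UNIV"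
    if z: "dist z1 a < r" "dist z2 b < r" for z1 z2
  proof -
    let ?t = "\<lambda>(i, j). c (i, j) * (z1 - a) ^ i * (z2 - b) ^ j"
    define p where "p = norm (z1 - a) / r"
    define q where "q = norm (z2 - b) / r"
    have pq: "0 \<le> p" "p < 1" "0 \<le> q" "q < 1"
      using z r by (auto simp: p_def q_def dist_norm)
    have bound: "norm (c (i, j) * (z1 - a) ^ i * (z2 - b) ^ j) \<le> M * p ^ i * q ^ j" for i j
    proof -
      have "norm (c (i, j) * (z1 - a) ^ i * (z2 - b) ^ j)
          \<le> M / r ^ i / r ^ j * norm (z1 - a) ^ i * norm (z2 - b) ^ j"
        unfolding norm_mult norm_power by (intro mult_right_mono c_bound) auto
      also have "\<dots> = M * p ^ i * q ^ j"
        by (simp add: p_def q_def power_divide)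
      finally show ?thesis .
    qed
    \<comment> \<open>Cauchy's estimates make the double series absolutely summable, which justifies
      summing it row by row.\<close>
    have summ: "(\<lambda>x. norm (?t x)) summable_on UNIV"
      by (rule summable_on_comparison_test[OF summable_on_geometric_pairs[OF pq \<open>M \<ge> 0\<close>]])
        (use bound in auto)
    have rows: "((\<lambda>j. ?t (i, j)) has_sum g i z2 * (z1 - a) ^ i) UNIV" for i
    proof (rule norm_summable_imp_has_sum)
      have "(\<lambda>j. norm (?t (i, j))) summable_on UNIV"
        using Infinite_Sum.abs_summable_on_Sigma_iff[of ?t UNIV "\<lambda>_. UNIV"] summ by simp
      then show "summable (\<lambda>j. norm (?t (i, j)))"
        by (rule summable_on_imp_summable)
      have "(\<lambda>j. (deriv ^^ j) (g i) b / fact j * (z2 - b) ^ j) sums g i z2"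
        using z by (intro holomorphic_power_series[OF g_hol_ball]) (simp add: dist_commute)
      from sums_mult2[OF this, of "(z1 - a) ^ i"] show "(\<lambda>j. ?t (i, j)) sums (g i z2 * (z1 - a) ^ i)"
        by (simp add: c_def mult_ac)
    qed
    have cols: "((\<lambda>i. g i z2 * (z1 - a) ^ i) has_sum f (z1, z2)) UNIV"
    proof (rule norm_summable_imp_has_sum)
      have le: "norm (g i z2 * (z1 - a) ^ i) \<le> M * p ^ i" for i
      proof -
        have "norm (g i z2 * (z1 - a) ^ i) \<le> M / r ^ i * norm (z1 - a) ^ i"
          unfolding norm_mult norm_power using z
          by (intro mult_right_mono g_bound) (auto simp: dist_commute)
        then show ?thesis by (simp add: p_def power_divide)
      qed
      show "summable (\<lambda>i. norm (g i z2 * (z1 - a) ^ i))"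
        by (rule summable_comparison_test[of _ "\<lambda>i. M * p ^ i"])
          (use le pq in \<open>auto intro!: summable_mult summable_geometric\<close>)
      have "(\<lambda>i. (deriv ^^ i) (\<lambda>w. f (w, z2)) a / fact i * (z1 - a) ^ i) sums f (z1, z2)"
        using z by (intro holomorphic_power_series[OF slice_ball]) (auto simp: dist_commute)
      then show "(\<lambda>i. g i z2 * (z1 - a) ^ i) sums f (z1, z2)"
        by (simp add: g_def pd1_deriv)
    qed
    have "(?t has_sum f (z1, z2)) (SIGMA i:UNIV. UNIV)"
      by (rule has_sum_SigmaI[OF rows cols]) (use abs_summable_summable[OF summ] in simp)
    then show ?thesis by simp
  qed
  then show "\<exists>c e. e > 0 \<and> (\<forall>z1 z2. dist z1 a < e \<and> dist z2 b < e \<longrightarrow>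
      ((\<lambda>(i, j). c (i, j) * (z1 - a) ^ i * (z2 - b) ^ j) has_sum f (z1, z2)) UNIV)"
    using r by blast
qed

lemma analytic2_iff_hol2: "open S \<Longrightarrow> analytic2_on f S \<longleftrightarrow> hol2 f S"
  using analytic2_imp_hol2 hol2_imp_analytic2 by blast

section \<open>Riccati equations with a parameter\<close>

text \<open>The integral of h(z1, .) from b to z2 along the segment, rescaled to [0, 1] so that the
  domain of integration does not move with z.\<close>

definition fibre_integral ::
  "complex \<Rightarrow> (complex \<times> complex \<Rightarrow> complex) \<Rightarrow> complex \<times> complex \<Rightarrow> complex" where
  "fibre_integral b h z =
     integral (cbox 0 1) (\<lambda>s. h (fst z, b + of_real s * (snd z - b)) * (snd z - b))"

lemma segment_in_ball:
  fixes b w :: complex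
  assumes "w \<in> ball b r" "s \<in> cbox (0::real) 1"
  shows "b + of_real s * (w - b) \<in> ball b r"
proof -
  have "norm (of_real s * (w - b)) \<le> 1 * norm (w - b)"
    unfolding norm_mult using assms by (intro mult_right_mono) (auto simp: cbox_interval)
  then show ?thesis
    using assms(1) by (simp add: dist_norm norm_minus_commute)
qed

context
  fixes a b :: complex and r :: real and h :: "complex \<times> complex \<Rightarrow> complex"
  assumes h: "hol2 h (ball a r \<times> ball b r)"
begin

lemma fibre_integrand_continuous:
  assumes "continuous_on (ball a r \<times> ball b r) g"
  shows "continuous_on ((ball a r \<times> ball b r) \<times> cbox 0 1)
    (\<lambda>(z, s). g (fst z, b + of_real s * (snd z - b)))"
  unfolding split_beta
  by (rule continuous_on_compose2[OF assms])
    (use segment_in_ball in \<open>auto intro!: continuous_intros\<close>)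

lemma fibre_integrable:
  assumes "z \<in> ball a r \<times> ball b r"
  shows "(\<lambda>s. h (fst z, b + of_real s * (snd z - b)) * (snd z - b)) integrable_on cbox 0 1"
proof (intro integrable_continuous continuous_intros)
  show "continuous_on (cbox 0 1) (\<lambda>s. h (fst z, b + of_real s * (snd z - b)))"
    by (rule continuous_on_compose2[OF hol2_D(1)[OF h]])
      (use assms segment_in_ball in \<open>auto intro!: continuous_intros\<close>)
qed

lemma fibre_integral_derivative2:
  assumes z: "z \<in> ball a r \<times> ball b r"
  shows "((\<lambda>w. fibre_integral b h (fst z, w)) has_field_derivative h z) (at (snd z))"
proof -
  have "(\<lambda>w. h (fst z, w)) holomorphic_on ball b r"
    using z by (intro hol2_slice2[OF h]) auto
  then obtain g where g: "\<And>w. w \<in> ball b r \<Longrightarrow> (g has_field_derivative h (fst z, w)) (at w within ball b r)"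
    using holomorphic_convex_primitive'[OF convex_ball open_ball] by blast
  have g': "(g has_field_derivative h (fst z, w)) (at w)" if "w \<in> ball b r" for w
    using g[OF that] at_within_open[OF that open_ball] by simp
  \<comment> \<open>On a disc the slice has a primitive g, and the segment integral is its
    increment.\<close>
  have "fibre_integral b h (fst z, w) = g w - g b" if w: "w \<in> ball b r" for w
  proof -
    have "((\<lambda>s. g (b + of_real s * (w - b))) has_vector_derivative
        h (fst z, b + of_real s * (w - b)) * (w - b)) (at s within {0..1})" if s: "s \<in> {0..1}" for s
    proof -
      have g: "(g has_field_derivative h (fst z, b + of_real s * (w - b))) (at (b + of_real s * (w - b)))"
        using segment_in_ball[OF w] s by (intro g') (simp add: cbox_interval)
      have l: "((\<lambda>s. b + of_real s * (w - b)) has_vector_derivative w - b) (at s within {0..1})"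
        by (auto intro!: derivative_eq_intros)
      show ?thesis
        using field_vector_diff_chain_within[OF l has_field_derivative_at_within[OF g]]
        by (simp add: comp_def mult.commute)
    qed
    then have "((\<lambda>s. h (fst z, b + of_real s * (w - b)) * (w - b)) has_integral
        g (b + of_real 1 * (w - b)) - g (b + of_real 0 * (w - b))) {0..1}"
      by (intro fundamental_theorem_of_calculus) auto
    then have "integral {0..1} (\<lambda>s. h (fst z, b + of_real s * (w - b)) * (w - b))
        = g (b + of_real 1 * (w - b)) - g (b + of_real 0 * (w - b))"
      by (rule integral_unique)
    then show ?thesis
      unfolding fibre_integral_def cbox_interval fst_conv snd_conv by simp
  qed
  moreover have "((\<lambda>w. g w - g b) has_field_derivative h z) (at (snd z))"
    using g'[of "snd z"] z by (auto intro!: derivative_eq_intros)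
  ultimately show ?thesis
    by (elim has_field_derivative_transform_within_open[where S = "ball b r"]) (use z in auto)
qed

lemma hol2_fibre_integral: "hol2 (fibre_integral b h) (ball a r \<times> ball b r)"
  unfolding hol2_def
proof (intro conjI ballI)
  have "continuous_on ((ball a r \<times> ball b r) \<times> cbox 0 1)
      (\<lambda>(z, s). h (fst z, b + of_real s * (snd z - b)) * (snd z - b))"
    using fibre_integrand_continuous[OF hol2_D(1)[OF h]]
    unfolding split_beta by (intro continuous_intros) auto
  then show "continuous_on (ball a r \<times> ball b r) (fibre_integral b h)"
    unfolding fibre_integral_def by (rule integral_continuous_on_param)
  fix z assume z: "z \<in> ball a r \<times> ball b r"
  show "(\<lambda>w. fibre_integral b h (fst z, w)) field_differentiable at (snd z)"
    using fibre_integral_derivative2[OF z] unfolding field_differentiable_def by blast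
  have "(\<lambda>w. integral (cbox 0 1) (\<lambda>s. h (w, b + of_real s * (snd z - b)) * (snd z - b)))
      holomorphic_on ball a r"
  proof (rule leibniz_rule_holomorphic)
    fix w s assume ws: "w \<in> ball a r" "s \<in> cbox (0::real) 1"
    then have "(w, b + of_real s * (snd z - b)) \<in> ball a r \<times> ball b r"
      using segment_in_ball[of "snd z" b r s] z by auto
    from hol2_D(2)[OF h this]
    have "((\<lambda>w. h (w, b + of_real s * (snd z - b))) has_field_derivative
        pd1 h (w, b + of_real s * (snd z - b))) (at w within ball a r)"
      by (simp add: has_field_derivative_at_within)
    then show "((\<lambda>w. h (w, b + of_real s * (snd z - b)) * (snd z - b)) has_field_derivative
        pd1 h (w, b + of_real s * (snd z - b)) * (snd z - b)) (at w within ball a r)"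
      by (rule DERIV_cmult_right)
  next
    fix w assume "w \<in> ball a r"
    then show "(\<lambda>s. h (w, b + of_real s * (snd z - b)) * (snd z - b)) integrable_on cbox 0 1"
      using fibre_integrable[of "(w, snd z)"] z by auto
  next
    have "continuous_on (ball a r \<times> ball b r) (pd1 h)"
      by (intro continuous_on_pd1 h open_Times open_ball)
    then have "continuous_on (ball a r \<times> cbox 0 1) (\<lambda>x. pd1 h (fst x, b + of_real (snd x) * (snd z - b)))"
      by (rule continuous_on_compose2)
        (use z segment_in_ball in \<open>auto intro!: continuous_intros\<close>)
    then show "continuous_on (ball a r \<times> cbox 0 1)
        (\<lambda>(w, s). pd1 h (w, b + of_real s * (snd z - b)) * (snd z - b))"
      unfolding split_beta by (intro continuous_intros)
  qed simp
  then show "(\<lambda>w. fibre_integral b h (w, snd z)) field_differentiable at (fst z)"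
    unfolding fibre_integral_def fst_conv snd_conv
    by (rule holomorphic_on_imp_differentiable_at) (use z in auto)
qed

end

lemma fibre_integral_bound:
  assumes h: "hol2 h (ball a r \<times> ball b r)" and z: "z \<in> ball a r \<times> ball b r"
    and le: "\<And>z. z \<in> ball a r \<times> ball b r \<Longrightarrow> norm (h z) \<le> C"
  shows "norm (fibre_integral b h z) \<le> C * r"
proof -
  have "norm (fibre_integral b h z) \<le> integral (cbox 0 1) (\<lambda>s::real. C * r)"
    unfolding fibre_integral_def
  proof (rule integral_norm_bound_integral[OF fibre_integrable[OF h z]])
    fix s assume "s \<in> cbox (0::real) 1"
    then have "norm (h (fst z, b + of_real s * (snd z - b))) \<le> C"
      using segment_in_ball[of "snd z" b r s] z by (intro le) auto
    moreover have "norm (snd z - b) \<le> r"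
      using z by (auto simp: dist_norm norm_minus_commute mem_Times_iff)
    ultimately show "norm (h (fst z, b + of_real s * (snd z - b)) * (snd z - b)) \<le> C * r"
      unfolding norm_mult by (intro mult_mono) (auto intro: order_trans[OF norm_ge_zero])
  qed (rule integrable_const)
  then show ?thesis by simp
qed

lemma fibre_integral_diff:
  assumes "hol2 g (ball a r \<times> ball b r)" "hol2 h (ball a r \<times> ball b r)" "z \<in> ball a r \<times> ball b r"
  shows "fibre_integral b g z - fibre_integral b h z = fibre_integral b (\<lambda>z. g z - h z) z"
  using integral_diff[OF fibre_integrable[OF assms(1,3)] fibre_integrable[OF assms(2,3)]]
  by (simp add: fibre_integral_def algebra_simps)

text \<open>Weierstrass's theorem in one variable, applied to the slices: uniform convergence on S
  restricts to discs in either variable.\<close>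

lemma hol2_uniform_limit:
  assumes S: "open S" and hol: "\<And>n. hol2 (v n) S" and lim: "uniform_limit S v u sequentially"
  shows "hol2 u S"
  unfolding hol2_def
proof (intro conjI ballI)
  show "continuous_on S u"
    by (rule uniform_limit_theorem[OF _ lim]) (auto intro!: always_eventually hol2_D(1)[OF hol])
  fix z assume z: "z \<in> S"
  obtain r where r: "r > 0" and sub: "cball (fst z) r \<times> cball (snd z) r \<subseteq> S"
    using open_contains_cball_box[OF S z] .
  have *: "uniform_limit T (\<lambda>n w. v n (g w)) (\<lambda>w. u (g w)) sequentially"
    if "\<And>w. w \<in> T \<Longrightarrow> g w \<in> S" for T and g :: "complex \<Rightarrow> complex \<times> complex"
    unfolding uniform_limit_iff
  proof (intro allI impI)
    fix e :: real assume "e > 0"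
    then have "\<forall>\<^sub>F n in sequentially. \<forall>x\<in>S. dist (v n x) (u x) < e"
      using lim by (simp add: uniform_limit_iff)
    then show "\<forall>\<^sub>F n in sequentially. \<forall>x\<in>T. dist (v n (g x)) (u (g x)) < e"
      by eventually_elim (use that in blast)
  qed
  have "(\<lambda>w. u (w, snd z)) holomorphic_on ball (fst z) r"
  proof (rule holomorphic_uniform_sequence)
    show "(\<lambda>w. v n (w, snd z)) holomorphic_on ball (fst z) r" for n
      using sub r by (intro hol2_slice1[OF hol]) auto
    fix x assume "x \<in> ball (fst z) r"
    then obtain d where d: "d > 0" "cball x d \<subseteq> ball (fst z) r"
      using open_contains_cball open_ball by blast
    have "(w, snd z) \<in> S" if "w \<in> cball x d" for w
      using d(2) that r by (intro subsetD[OF sub]) auto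
    then show "\<exists>d>0. cball x d \<subseteq> ball (fst z) r \<and>
        uniform_limit (cball x d) (\<lambda>n w. v n (w, snd z)) (\<lambda>w. u (w, snd z)) sequentially"
      by (intro exI[of _ d] conjI d *)
  qed simp
  then show "(\<lambda>w. u (w, snd z)) field_differentiable at (fst z)"
    by (rule holomorphic_on_imp_differentiable_at) (use r in auto)
  have "(\<lambda>w. u (fst z, w)) holomorphic_on ball (snd z) r"
  proof (rule holomorphic_uniform_sequence)
    show "(\<lambda>w. v n (fst z, w)) holomorphic_on ball (snd z) r" for n
      using sub r by (intro hol2_slice2[OF hol]) auto
    fix x assume "x \<in> ball (snd z) r"
    then obtain d where d: "d > 0" "cball x d \<subseteq> ball (snd z) r"
      using open_contains_cball open_ball by blast
    have "(fst z, w) \<in> S" if "w \<in> cball x d" for w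
      using d(2) that r by (intro subsetD[OF sub]) auto
    then show "\<exists>d>0. cball x d \<subseteq> ball (snd z) r \<and>
        uniform_limit (cball x d) (\<lambda>n w. v n (fst z, w)) (\<lambda>w. u (fst z, w)) sequentially"
      by (intro exI[of _ d] conjI d *)
  qed simp
  then show "(\<lambda>w. u (fst z, w)) field_differentiable at (snd z)"
    by (rule holomorphic_on_imp_differentiable_at) (use r in auto)
qed

lemma compact_norm_bound:
  fixes f :: "'a::topological_space \<Rightarrow> complex"
  assumes "compact T" "continuous_on T f"
  obtains M where "\<And>z. z \<in> T \<Longrightarrow> norm (f z) \<le> M"
proof -
  have "bounded (f ` T)"
    by (intro compact_imp_bounded compact_continuous_image assms)
  then show ?thesis using that by (auto simp: bounded_iff)
qed

text \<open>Picard iteration on functions of both variables, so that the solution is holomorphic in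
  the parameter z1 as well. Because of the quadratic term, the domain is shrunk until the iterates
  stay bounded and the integral operator contracts.\<close>

lemma Riccati_hol2:
  assumes S: "open S" "(a, b) \<in> S" and coeffs: "hol2 \<alpha> S" "hol2 \<beta> S" "hol2 \<gamma> S"
    and u0: "u0 holomorphic_on ball a r0" "r0 > 0"
  shows "\<exists>r u. r > 0 \<and> ball a r \<times> ball b r \<subseteq> S \<and> hol2 u (ball a r \<times> ball b r) \<and>
    (\<forall>z1\<in>ball a r. u (z1, b) = u0 z1) \<and>
    (\<forall>z\<in>ball a r \<times> ball b r. pd2 u z = \<alpha> z + \<beta> z * u z + \<gamma> z * (u z)\<^sup>2)"
proof -
  obtain R1 where R1: "R1 > 0" "cball a R1 \<times> cball b R1 \<subseteq> S"
    using open_contains_cball_box[OF S] by auto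
  define R where "R = min R1 (r0 / 2)"
  have R: "R > 0" "cball a R \<times> cball b R \<subseteq> S" "cball a R \<subseteq> ball a r0"
    using R1 u0(2) by (auto simp: R_def subset_eq)
  have comp: "compact (cball a R \<times> cball b R)"
    by (intro compact_Times compact_cball)
  obtain M1 where M1: "\<And>z. z \<in> cball a R \<times> cball b R \<Longrightarrow> norm (\<alpha> z) \<le> M1"
    using compact_norm_bound[OF comp continuous_on_subset[OF hol2_D(1)[OF coeffs(1)] R(2)]] by blast
  obtain M2 where M2: "\<And>z. z \<in> cball a R \<times> cball b R \<Longrightarrow> norm (\<beta> z) \<le> M2"
    using compact_norm_bound[OF comp continuous_on_subset[OF hol2_D(1)[OF coeffs(2)] R(2)]] by blast
  obtain M3 where M3: "\<And>z. z \<in> cball a R \<times> cball b R \<Longrightarrow> norm (\<gamma> z) \<le> M3"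
    using compact_norm_bound[OF comp continuous_on_subset[OF hol2_D(1)[OF coeffs(3)] R(2)]] by blast
  obtain K0 where K0: "\<And>w. w \<in> cball a R \<Longrightarrow> norm (u0 w) \<le> K0"
    using compact_norm_bound[OF compact_cball holomorphic_on_imp_continuous_on[OF holomorphic_on_subset[OF u0(1) R(3)]]]
    by blast
  define M where "M = max 1 (max M1 (max M2 M3))"
  \<comment> \<open>\<open>L\<close> exceeds the bound of the initial value by 1, the room left for
    the integral term. \<open>C\<close> bounds the right-hand side on functions bounded by
    \<open>L\<close>, and \<open>C'\<close> is its Lipschitz constant there. The radius
    \<open>r\<close> keeps the integral term at most 1 and the contraction factor at most
    1/2.\<close>
  define L where "L = max 0 K0 + 1"
  have M: "M \<ge> 1" and L: "L \<ge> 1" by (simp_all add: M_def L_def)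
  define C where "C = M + M * L + M * L\<^sup>2"
  define C' where "C' = M * (1 + 2 * L)"
  have C: "C > 0" "C' > 0" using M L by (auto simp: C_def C'_def intro!: add_pos_nonneg)
  define r where "r = min R (min (1 / C) (1 / (2 * C')))"
  have r: "r > 0" "r \<le> R" "C * r \<le> 1" "C' * r \<le> 1 / 2"
  proof -
    show "r > 0" "r \<le> R" using R C by (auto simp: r_def)
    have "r \<le> 1 / C" "r \<le> 1 / (2 * C')" by (auto simp: r_def)
    then show "C * r \<le> 1" "C' * r \<le> 1 / 2" using C by (auto simp: field_simps)
  qed
  define B where "B = ball a r \<times> ball b r"
  have B: "open B" "B \<subseteq> S" "B \<subseteq> cball a R \<times> cball b R"
  proof -
    show "open B" by (simp add: B_def open_Times)
    show "B \<subseteq> cball a R \<times> cball b R" using r by (auto simp: B_def)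
    then show "B \<subseteq> S" using R by blast
  qed
  have u0_le: "norm (u0 (fst z)) \<le> L - 1" if "z \<in> B" for z
    using K0[of "fst z"] that B(3) by (auto simp: L_def mem_Times_iff)
  have coeff_le: "norm (\<alpha> z) \<le> M" "norm (\<beta> z) \<le> M" "norm (\<gamma> z) \<le> M" if "z \<in> B" for z
    using M1[of z] M2[of z] M3[of z] that B(3) by (auto simp: M_def)
  define rhs where "rhs = (\<lambda>v z. \<alpha> z + \<beta> z * v z + \<gamma> z * (v z)\<^sup>2)"
  define T where "T = (\<lambda>v z. u0 (fst z) + fibre_integral b (rhs v) z)"
  have hol_u0: "hol2 (\<lambda>z. u0 (fst z)) B"
    by (rule hol2_compose[OF hol2_fst u0(1)]) (use B(3) R(3) in \<open>auto simp: mem_Times_iff subset_eq\<close>)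
  have hol_rhs: "hol2 (rhs v) B" if "hol2 v B" for v
    unfolding rhs_def using that B(2) by (intro hol2_intros hol2_subset[OF coeffs(1)]
        hol2_subset[OF coeffs(2)] hol2_subset[OF coeffs(3)]) auto
  have hol_T: "hol2 (T v) B" if "hol2 v B" for v
    unfolding T_def using hol2_fibre_integral[of "rhs v" a r b] hol_rhs[OF that] hol_u0
    by (intro hol2_add) (auto simp: B_def)
  have T_le: "norm (T v z - u0 (fst z)) \<le> 1" if v: "hol2 v B" "\<And>z. z \<in> B \<Longrightarrow> norm (v z) \<le> L" and z: "z \<in> B" for v z
  proof -
    have "norm (rhs v z) \<le> C" if "z \<in> B" for z
    proof -
      have "norm (\<beta> z * v z) \<le> M * L" "norm (\<gamma> z * (v z)\<^sup>2) \<le> M * L\<^sup>2"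
        unfolding norm_mult norm_power using coeff_le[OF that] v(2)[OF that] M
        by (intro mult_mono power_mono; simp)+
      then show ?thesis
        unfolding rhs_def C_def
        using coeff_le(1)[OF that] by (intro order_trans[OF norm_triangle_ineq] add_mono) auto
    qed
    then have "norm (fibre_integral b (rhs v) z) \<le> C * r"
      using fibre_integral_bound[of "rhs v" a r b z C] hol_rhs[OF v(1)] z by (auto simp: B_def)
    then show ?thesis using r by (simp add: T_def)
  qed
  have T_bound: "norm (T v z) \<le> L" if v: "hol2 v B" "\<And>z. z \<in> B \<Longrightarrow> norm (v z) \<le> L" and z: "z \<in> B" for v z
    using norm_triangle_ineq[of "T v z - u0 (fst z)" "u0 (fst z)"] T_le[OF that] u0_le[OF z] by simp
  have T_contract: "norm (T v z - T w z) \<le> d / 2"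
    if v: "hol2 v B" "\<And>z. z \<in> B \<Longrightarrow> norm (v z) \<le> L" and w: "hol2 w B" "\<And>z. z \<in> B \<Longrightarrow> norm (w z) \<le> L"
      and d: "\<And>z. z \<in> B \<Longrightarrow> norm (v z - w z) \<le> d" and z: "z \<in> B" for v w z d
  proof -
    have "d \<ge> 0" using order_trans[OF norm_ge_zero d[OF z]] .
    have "norm (rhs v z - rhs w z) \<le> C' * d" if z: "z \<in> B" for z
    proof -
      have "rhs v z - rhs w z = (\<beta> z + \<gamma> z * (v z + w z)) * (v z - w z)"
        by (simp add: rhs_def power2_eq_square algebra_simps)
      moreover have "norm (\<gamma> z * (v z + w z)) \<le> M * (2 * L)"
        unfolding norm_mult using coeff_le[OF z] v(2)[OF z] w(2)[OF z] M
        by (intro mult_mono order_trans[OF norm_triangle_ineq]) auto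
      then have "norm (\<beta> z + \<gamma> z * (v z + w z)) \<le> C'"
        unfolding C'_def using coeff_le(2)[OF z]
        by (intro order_trans[OF norm_triangle_ineq]) (simp add: algebra_simps)
      ultimately show ?thesis
        unfolding norm_mult using d[OF z] C by (simp add: norm_mult mult_mono)
    qed
    then have "norm (fibre_integral b (\<lambda>z. rhs v z - rhs w z) z) \<le> C' * d * r"
      using hol2_diff[OF hol_rhs[OF v(1)] hol_rhs[OF w(1)]] z
        fibre_integral_bound[of "\<lambda>z. rhs v z - rhs w z" a r b z "C' * d"]
      by (auto simp: B_def)
    moreover have "T v z - T w z = fibre_integral b (\<lambda>z. rhs v z - rhs w z) z"
      using fibre_integral_diff[of "rhs v" a r b "rhs w" z] hol_rhs[OF v(1)] hol_rhs[OF w(1)] z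
      by (simp add: T_def B_def)
    moreover have "C' * d * r \<le> d / 2"
      using mult_right_mono[OF r(4) \<open>d \<ge> 0\<close>] by (simp add: mult_ac)
    ultimately show ?thesis by simp
  qed
  define v where "v = (\<lambda>n. (T ^^ n) (\<lambda>z. u0 (fst z)))"
  have v_Suc: "v (Suc n) = T (v n)" and v_0: "v 0 = (\<lambda>z. u0 (fst z))" for n
    by (simp_all add: v_def)
  have hol_v: "hol2 (v n) B" for n
    by (induction n) (use hol_u0 hol_T in \<open>auto simp: v_Suc v_0\<close>)
  have v_le: "norm (v n z) \<le> L" if "z \<in> B" for n z
    using that
  proof (induction n arbitrary: z)
    case 0
    then show ?case using u0_le by (fastforce simp: v_0)
  next
    case (Suc n)
    then show ?case unfolding v_Suc by (intro T_bound hol_v)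
  qed
  have step: "norm (v (Suc n) z - v n z) \<le> (1 / 2) ^ n" if "z \<in> B" for n z
    using that
  proof (induction n arbitrary: z)
    case 0
    then show ?case using T_le[OF hol_v[of 0] v_le] by (simp add: v_Suc v_0)
  next
    case (Suc n)
    then show ?case
      using T_contract[OF hol_v v_le hol_v v_le Suc.IH] by (simp add: v_Suc)
  qed
  \<comment> \<open>The limit is written as a telescoping series, to which the M-test with majorant
    (1/2)^n applies.\<close>
  define u where "u = (\<lambda>z. v 0 z + suminf (\<lambda>n. v (Suc n) z - v n z))"
  have "uniform_limit B (\<lambda>n z. \<Sum>i<n. v (Suc i) z - v i z) (\<lambda>z. suminf (\<lambda>n. v (Suc n) z - v n z)) sequentially"
    by (rule Weierstrass_m_test[OF step]) (auto intro: summable_geometric)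
  then have "uniform_limit B (\<lambda>n z. v 0 z + (\<Sum>i<n. v (Suc i) z - v i z)) u sequentially"
    unfolding u_def by (intro uniform_limit_add uniform_limit_const)
  moreover have "v 0 z + (\<Sum>i<n. v (Suc i) z - v i z) = v n z" for n z
    using sum_lessThan_telescope[of "\<lambda>i. v i z" n] by simp
  ultimately have lim: "uniform_limit B v u sequentially"
    by simp
  have hol_u: "hol2 u B"
    by (rule hol2_uniform_limit[OF B(1) hol_v lim])
  have u_tendsto: "(\<lambda>n. v n z) \<longlonglongrightarrow> u z" if "z \<in> B" for z
    by (rule tendsto_uniform_limitI[OF lim that])
  have u_le: "norm (u z) \<le> L" if "z \<in> B" for z
    by (rule tendsto_upperbound[OF tendsto_norm[OF u_tendsto[OF that]]]) (auto simp: v_le[OF that])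
  have fixpoint: "T u z = u z" if z: "z \<in> B" for z
  proof (rule LIMSEQ_unique)
    show "(\<lambda>n. v (Suc n) z) \<longlonglongrightarrow> u z"
      using u_tendsto[OF z] by (rule LIMSEQ_Suc)
    show "(\<lambda>n. v (Suc n) z) \<longlonglongrightarrow> T u z"
    proof (rule tendstoI)
      fix e :: real assume "e > 0"
      then have "\<forall>\<^sub>F n in sequentially. \<forall>z\<in>B. dist (v n z) (u z) < e"
        using lim by (simp add: uniform_limit_iff)
      then show "\<forall>\<^sub>F n in sequentially. dist (v (Suc n) z) (T u z) < e"
      proof eventually_elim
        case (elim n)
        then have "norm (T (v n) z - T u z) \<le> e / 2"
          by (intro T_contract[OF hol_v v_le hol_u u_le _ z]) (auto simp: dist_norm less_imp_le)
        then show ?case using \<open>e > 0\<close> by (simp add: v_Suc dist_norm)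
      qed
    qed
  qed
  show ?thesis
  proof (intro exI[of _ r] exI[of _ u] conjI ballI)
    show "r > 0" by fact
    show "ball a r \<times> ball b r \<subseteq> S" "hol2 u (ball a r \<times> ball b r)"
      using B(2) hol_u by (simp_all add: B_def)
    show "u (z1, b) = u0 z1" if "z1 \<in> ball a r" for z1
      using fixpoint[of "(z1, b)"] that r by (simp add: B_def T_def fibre_integral_def)
    fix z assume "z \<in> ball a r \<times> ball b r"
    then have z: "z \<in> B" by (simp add: B_def)
    have "pd2 u z = pd2 (T u) z"
      by (rule pd_cong_open[OF B(1) z]) (simp add: fixpoint)
    also have "\<dots> = rhs u z"
    proof (rule pd_eqI)
      show "((\<lambda>w. T u (fst z, w)) has_field_derivative rhs u z) (at (snd z))"
        using fibre_integral_derivative2[of "rhs u" a r b z] hol_rhs[OF hol_u] z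
        by (auto simp: T_def B_def intro!: derivative_eq_intros)
    qed
    finally show "pd2 u z = \<alpha> z + \<beta> z * u z + \<gamma> z * (u z)\<^sup>2"
      by (simp add: rhs_def)
  qed
qed

section \<open>Differential polynomials modulo the operator\<close>

abbreviation lookup :: "('a \<Rightarrow>\<^sub>0 'b::zero) \<Rightarrow> 'a \<Rightarrow> 'b" where "lookup \<equiv> Poly_Mapping.lookup"
abbreviation keys :: "('a \<Rightarrow>\<^sub>0 'b::zero) \<Rightarrow> 'a set" where "keys \<equiv> Poly_Mapping.keys"
abbreviation single :: "'a \<Rightarrow> 'b::zero \<Rightarrow> 'a \<Rightarrow>\<^sub>0 'b" where "single \<equiv> Poly_Mapping.single"

type_synonym monom = "dvar \<Rightarrow>\<^sub>0 nat"

abbreviation const :: "ratfun \<Rightarrow> dpoly" where "const c \<equiv> single 0 c"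
definition var :: "dvar \<Rightarrow> dpoly" where "var v = single (single v 1) 1"

lemma poly_mapping_sum_single: "(A :: 'a \<Rightarrow>\<^sub>0 'b::comm_monoid_add) = (\<Sum>m\<in>keys A. single m (lookup A m))"
  by (rule poly_mapping_eqI)
    (simp add: lookup_sum lookup_single when_def in_keys_iff sum.delta')

lemma poly_mapping_induct [case_names zero single add]:
  fixes A :: "'a \<Rightarrow>\<^sub>0 'b::comm_monoid_add"
  assumes "P 0" "\<And>m c. m \<in> keys A \<Longrightarrow> P (single m c)" "\<And>B C. P B \<Longrightarrow> P C \<Longrightarrow> P (B + C)"
  shows "P A"
proof -
  have "P (\<Sum>m\<in>M. single m (lookup A m))" if "finite M" "M \<subseteq> keys A" for M
    using that by (induction M rule: finite_induct) (auto intro: assms)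
  from this[of "keys A"] show ?thesis
    using poly_mapping_sum_single[of A] by simp
qed

lemma monom_split: "lookup m v > 0 \<Longrightarrow> (m - single v 1) + single v 1 = (m :: monom)"
  by (rule poly_mapping_eqI) (auto simp: lookup_add lookup_minus lookup_single when_def)

lemma single_eq_const_mult: "single m c = const c * single m (1 :: ratfun)"
  by (simp add: mult_single)

lemma monom_induct [case_names zero add]:
  fixes m :: monom
  assumes "P 0" "\<And>m v. P m \<Longrightarrow> v \<in> V \<Longrightarrow> P (m + single v 1)" "keys m \<subseteq> V"
  shows "P m"
  using assms(3)
proof (induction "\<Sum>v\<in>keys m. lookup m v" arbitrary: m rule: less_induct)
  case less
  show ?case
  proof (cases "m = 0")
    case True
    then show ?thesis using assms(1) by simp
  next
    case False
    then obtain v where v: "v \<in> keys m" by (metis ex_in_conv keys_eq_empty)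
    let ?n = "m - single v 1"
    have sub: "keys ?n \<subseteq> keys m"
      by (auto simp: in_keys_iff lookup_minus)
    have "(\<Sum>v\<in>keys ?n. lookup ?n v) = (\<Sum>v\<in>keys m. lookup ?n v)"
      using sub by (intro sum.mono_neutral_left) (auto simp: in_keys_iff)
    also have "\<dots> < (\<Sum>v\<in>keys m. lookup m v)"
      using v by (intro sum_strict_mono_ex1)
        (auto simp: lookup_minus lookup_single in_keys_iff intro!: bexI[of _ v])
    finally have "P ?n"
      using sub less.prems by (intro less.hyps) auto
    then have "P (?n + single v 1)"
      using v less.prems by (intro assms(2)) auto
    then show ?thesis
      using monom_split[of m v] v by (simp add: in_keys_iff)
  qed
qed

lemma keys_monom_add: "keys (m + n) = keys m \<union> keys (n :: monom)"
  by (auto simp: in_keys_iff lookup_add)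

text \<open>On a single term: the derivation acting as d on coefficients and sending the symbol v to
  an arbitrary differential polynomial \<open>t v\<close>. This goes beyond
  \<open>dpoly_deriv\<close>, where symbols go to symbols: the lowering operators send them to
  multiples of symbols, and the action of D on coefficients alone sends them to 0.\<close>

definition gterm :: "(ratfun \<Rightarrow> ratfun) \<Rightarrow> (dvar \<Rightarrow> dpoly) \<Rightarrow> monom \<Rightarrow> ratfun \<Rightarrow> dpoly" where
  "gterm d t m c = single m (d c)
     + (\<Sum>v\<in>keys m. single (m - single v 1) (of_nat (lookup m v) * c) * t v)"

definition gder :: "(ratfun \<Rightarrow> ratfun) \<Rightarrow> (dvar \<Rightarrow> dpoly) \<Rightarrow> dpoly \<Rightarrow> dpoly" where
  "gder d t A = (\<Sum>m\<in>keys A. gterm d t m (lookup A m))"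

lemma gterm_superset:
  assumes "finite V" "keys m \<subseteq> V"
  shows "gterm d t m c
    = single m (d c) + (\<Sum>v\<in>V. single (m - single v 1) (of_nat (lookup m v) * c) * t v)"
  unfolding gterm_def using assms
  by (intro arg_cong2[where f = "(+)"] refl sum.mono_neutral_left) (auto simp: in_keys_iff)

context
  fixes d :: "ratfun \<Rightarrow> ratfun"
  assumes d: "derivation d"
begin

interpretation d: derivation d by (rule d)

lemma gterm_zero: "gterm d t m 0 = 0"
  by (simp add: gterm_def)

lemma gterm_add: "gterm d t m (c + e) = gterm d t m c + gterm d t m e"
  by (simp add: gterm_def d.add single_add distrib_left distrib_right sum.distrib)

lemma gder_single: "gder d t (single m c) = gterm d t m c"
  by (simp add: gder_def gterm_zero)

lemma gder_add: "gder d t (A + B) = gder d t A + gder d t B"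
  unfolding gder_def by (rule setsum_keys_plus_distrib) (simp_all add: gterm_zero gterm_add)

text \<open>The Leibniz rule for two terms; \<open>gder_derivation\<close> extends it by additivity
  in each factor.\<close>

lemma gterm_mult:
  "gterm d t (m + n) (c * e) = gterm d t m c * single n e + single m c * gterm d t n e"
proof -
  let ?V = "keys m \<union> keys n"
  have V: "finite ?V" "keys m \<subseteq> ?V" "keys n \<subseteq> ?V" "keys (m + n) \<subseteq> ?V"
    by (auto simp: keys_monom_add)
  have step: "single (m + n - single v 1) (of_nat (lookup (m + n) v) * (c * e)) * t v
      = single (m - single v 1) (of_nat (lookup m v) * c) * t v * single n e
        + single m c * (single (n - single v 1) (of_nat (lookup n v) * e) * t v)" for v
  proof -
    \<comment> \<open>Subtraction of exponents is truncated: removing one v from a + b amounts to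
      removing it from a only if v occurs in a, and otherwise the coefficient is 0.\<close>
    have *: "single (a + b - single v 1) (of_nat (lookup a v) * (x * y))
        = single (a - single v 1) (of_nat (lookup a v) * x) * single b y" for a b and x y :: ratfun
    proof (cases "lookup a v = 0")
      case False
      then have "a + b - single v 1 = (a - single v 1) + b"
        by (intro poly_mapping_eqI) (auto simp: lookup_add lookup_minus lookup_single when_def)
      then show ?thesis by (simp add: mult_single mult_ac add_ac)
    qed simp
    have "single (m + n - single v 1) (of_nat (lookup (m + n) v) * (c * e))
        = single (m + n - single v 1) (of_nat (lookup m v) * (c * e))
          + single (n + m - single v 1) (of_nat (lookup n v) * (e * c))"
      by (simp add: lookup_add single_add algebra_simps)
    then show ?thesis
      unfolding * by (simp add: algebra_simps)
  qed
  show ?thesis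
    unfolding gterm_superset[OF V(1,2)] gterm_superset[OF V(1,3)] gterm_superset[OF V(1,4)] step
    by (simp add: d.mult single_add mult_single sum.distrib distrib_left distrib_right
        sum_distrib_left sum_distrib_right add_ac)
qed

lemma gder_derivation: "derivation (gder d t)"
proof
  fix A B :: dpoly
  show "gder d t (A + B) = gder d t A + gder d t B" by (rule gder_add)
  have zero: "gder d t 0 = 0" by (simp add: gder_def)
  have "gder d t (A * single n e) = gder d t A * single n e + A * gder d t (single n e)" for n e
    by (induction A rule: poly_mapping_induct)
      (simp_all add: zero mult_single gder_single gterm_mult gder_add algebra_simps)
  then show "gder d t (A * B) = gder d t A * B + A * gder d t B"
    by (induction B rule: poly_mapping_induct) (simp_all add: zero gder_add algebra_simps)
qed

lemma gder_const: "gder d t (const c) = const (d c)"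
  by (simp add: gder_single gterm_def)

lemma gder_var: "gder d t (var v) = t v"
  by (simp add: var_def gder_single gterm_def)

end

lemma dpoly_\<delta>1_gder: "dpoly_\<delta>1 = gder \<delta>1 (\<lambda>v. var (Suc (fst v), snd v))"
  and dpoly_\<delta>2_gder: "dpoly_\<delta>2 = gder \<delta>2 (\<lambda>v. var (fst v, Suc (snd v)))"
  by (simp_all add: fun_eq_iff dpoly_\<delta>1_def dpoly_\<delta>2_def dpoly_deriv_def gder_def gterm_def
      mult_single case_prod_unfold var_def)

interpretation dp1: derivation dpoly_\<delta>1
  unfolding dpoly_\<delta>1_gder by (intro gder_derivation \<delta>1.derivation_axioms)

interpretation dp2: derivation dpoly_\<delta>2
  unfolding dpoly_\<delta>2_gder by (intro gder_derivation \<delta>2.derivation_axioms)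

lemma zero_derivation: "derivation (\<lambda>_. 0)"
  by standard simp_all

lemma dpoly_\<delta>_const [simp]:
  "dpoly_\<delta>1 (const c) = const (\<delta>1 c)" "dpoly_\<delta>2 (const c) = const (\<delta>2 c)"
  by (simp_all add: dpoly_\<delta>1_gder dpoly_\<delta>2_gder gder_const \<delta>1.derivation_axioms \<delta>2.derivation_axioms)

lemma dpoly_\<delta>_var [simp]:
  "dpoly_\<delta>1 (var (i, j)) = var (Suc i, j)" "dpoly_\<delta>2 (var (i, j)) = var (i, Suc j)"
  by (simp_all add: dpoly_\<delta>1_gder dpoly_\<delta>2_gder gder_var \<delta>1.derivation_axioms \<delta>2.derivation_axioms
     )

section \<open>Occurring symbols, and derivations determined by generators\<close>

lemma dvars_add: "dvars (A + B) \<subseteq> dvars A \<union> dvars B"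
  unfolding dvars_def using keys_add[of A B] by blast

lemma dvars_mult: "dvars (A * B) \<subseteq> dvars A \<union> dvars B"
  unfolding dvars_def using keys_mult[of A B] by (fastforce simp: keys_monom_add)

lemma dvars_uminus [simp]: "dvars (- A) = dvars A"
proof -
  have "keys (- A) = keys A"
    by (intro set_eqI) (simp only: in_keys_iff lookup_uminus neg_equal_0_iff_equal)
  then show ?thesis by (simp add: dvars_def)
qed

lemma dvars_diff: "dvars (A - B) \<subseteq> dvars A \<union> dvars B"
  using dvars_add[of A "- B"] by simp

lemma dvars_single: "dvars (single m c) \<subseteq> keys m"
  by (auto simp: dvars_def)

lemma dvars_var: "dvars (var v) = {v}"
  by (simp add: dvars_def var_def)

lemma dvars_zero [simp]: "dvars 0 = {}"
  by (simp add: dvars_def)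

lemma dvars_sum: "(\<And>i. i \<in> I \<Longrightarrow> dvars (g i) \<subseteq> V) \<Longrightarrow> dvars (sum g I) \<subseteq> V"
proof (induction I rule: infinite_finite_induct)
  case (insert x F)
  then show ?case using dvars_add[of "g x" "sum g F"] by auto
qed auto

lemma dvars_const_mult: "dvars A \<subseteq> V \<Longrightarrow> dvars (const c * A) \<subseteq> V"
  using dvars_mult[of "const c" A] dvars_single[of 0 c] by auto

lemma finite_dvars: "finite (dvars A)"
  by (simp add: dvars_def)

lemma dvars_gder:
  assumes "dvars A \<subseteq> V" "V \<subseteq> W" "\<And>v. v \<in> V \<Longrightarrow> dvars (t v) \<subseteq> W"
  shows "dvars (gder d t A) \<subseteq> W"
  unfolding gder_def
proof (rule dvars_sum)
  fix m assume "m \<in> keys A"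
  then have m: "keys m \<subseteq> V" using assms(1) by (auto simp: dvars_def)
  have "dvars (single (m - single v 1) c * t v) \<subseteq> W" if "v \<in> keys m" for v c
  proof -
    have "keys (m - single v 1) \<subseteq> keys m"
      by (auto simp: in_keys_iff lookup_minus)
    then show ?thesis
      using dvars_mult[of "single (m - single v 1) c" "t v"] dvars_single[of "m - single v 1" c]
        assms(2,3) m that by blast
  qed
  then have "dvars (\<Sum>v\<in>keys m. single (m - single v 1) (of_nat (lookup m v) * lookup A m) * t v) \<subseteq> W"
    by (intro dvars_sum)
  then show "dvars (gterm d t m (lookup A m)) \<subseteq> W"
    unfolding gterm_def
    using dvars_add dvars_single[of m "d (lookup A m)"] m assms(2) by blast
qed

text \<open>By the Leibniz rule, membership of G in an ideal passes from coefficients and symbols to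
  all polynomials in them. The ideal {0} gives an equality test for derivations; a differential
  ideal gives congruences.\<close>

lemma derivation_into_ideal:
  fixes I :: "dpoly set"
  assumes G: "derivation G" and I: "0 \<in> I" "\<And>A B. A \<in> I \<Longrightarrow> B \<in> I \<Longrightarrow> A + B \<in> I" "\<And>A B. B \<in> I \<Longrightarrow> A * B \<in> I"
    and const: "\<And>c. G (const c) \<in> I" and var: "\<And>v. v \<in> V \<Longrightarrow> G (var v) \<in> I"
    and A: "dvars A \<subseteq> V"
  shows "G A \<in> I"
proof -
  interpret G: derivation G by (rule G)
  have mult: "G (B * C) \<in> I" if "G B \<in> I" "G C \<in> I" for B C
    using that I by (simp add: G.mult mult.commute[of "G B"])
  have monom: "G (single m 1) \<in> I" if "keys m \<subseteq> V" for m
  proof (induction m rule: monom_induct[where V = V])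
    case zero
    then show ?case using I(1) by simp
  next
    case (add m v)
    then have "G (single m 1 * var v) \<in> I" by (intro mult var)
    then show ?case by (simp add: mult_single var_def)
  qed (use that in simp)
  show ?thesis
  proof (induction A rule: poly_mapping_induct)
    case zero
    then show ?case using I(1) by simp
  next
    case (single m c)
    then have "keys m \<subseteq> V" using A by (auto simp: dvars_def)
    then show ?case
      unfolding single_eq_const_mult[of m c] by (intro mult const monom)
  next
    case (add B C)
    then show ?case using I(2) by (simp add: G.add)
  qed
qed

lemma derivation_eqI:
  assumes E: "derivation E" and F: "derivation F"
    and "\<And>c. E (const c) = F (const c)" "\<And>v. v \<in> V \<Longrightarrow> E (var v) = F (var v)" "dvars A \<subseteq> V"
  shows "E A = F A"
proof -
  interpret E: derivation E by (rule E)
  interpret F: derivation F by (rule F)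
  have "derivation (\<lambda>A. E A - F A)"
    by standard (simp_all add: E.add F.add E.mult F.mult algebra_simps)
  from derivation_into_ideal[OF this, of "{0}" V A] show ?thesis
    using assms by simp
qed

context derivation
begin

text \<open>Leibniz's formula for higher derivatives. Expanding
  \<open>\<delta>2\<^sup>j (f y\<^sub>1)\<close> with it is the origin of the binomial coefficients
  in \<open>lower\<close>.\<close>

lemma funpow_mult: "(d ^^ n) (x * y) = (\<Sum>i\<le>n. of_nat (n choose i) * (d ^^ i) x * (d ^^ (n - i)) y)"
proof (induction n)
  case (Suc n)
  let ?g = "\<lambda>i j. (d ^^ i) x * (d ^^ j) y"
  have "(d ^^ Suc n) (x * y) = (\<Sum>i\<le>n. d (of_nat (n choose i) * ?g i (n - i)))"
    by (simp add: Suc sum mult.assoc)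
  also have "\<dots> = (\<Sum>i\<le>n. of_nat (n choose i) * ?g (Suc i) (n - i) + of_nat (n choose i) * ?g i (Suc n - i))"
    by (intro sum.cong refl) (simp add: mult Suc_diff_le algebra_simps)
  also have "\<dots> = (\<Sum>i\<le>n. of_nat (n choose i) * ?g (Suc i) (n - i)) + (\<Sum>i\<le>n. of_nat (n choose i) * ?g i (Suc n - i))"
    by (rule sum.distrib)
  also have "(\<Sum>i\<le>n. of_nat (n choose i) * ?g i (Suc n - i)) = (\<Sum>i\<le>Suc n. of_nat (n choose i) * ?g i (Suc n - i))"
    by (simp add: binomial_eq_0)
  also have "\<dots> = ?g 0 (Suc n) + (\<Sum>i\<le>n. of_nat (n choose Suc i) * ?g (Suc i) (n - i))"
    by (subst sum.atMost_Suc_shift) simp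
  also have "(\<Sum>i\<le>n. of_nat (n choose i) * ?g (Suc i) (n - i)) +
      (?g 0 (Suc n) + (\<Sum>i\<le>n. of_nat (n choose Suc i) * ?g (Suc i) (n - i)))
      = ?g 0 (Suc n) + (\<Sum>i\<le>n. of_nat (Suc n choose Suc i) * ?g (Suc i) (n - i))"
    by (simp add: sum.distrib distrib_right algebra_simps)
  also have "\<dots> = (\<Sum>i\<le>Suc n. of_nat (Suc n choose i) * ?g i (Suc n - i))"
    by (subst sum.atMost_Suc_shift) simp
  finally show ?case by (simp add: mult.assoc)
qed simp

end

lemma differential_idealD:
  assumes "differential_ideal I"
  shows "0 \<in> I" "\<And>A B. A \<in> I \<Longrightarrow> B \<in> I \<Longrightarrow> A + B \<in> I" "\<And>A B. B \<in> I \<Longrightarrow> A * B \<in> I"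
    "\<And>A. A \<in> I \<Longrightarrow> dpoly_\<delta>1 A \<in> I" "\<And>A. A \<in> I \<Longrightarrow> dpoly_\<delta>2 A \<in> I"
    "\<And>A. A \<in> I \<Longrightarrow> - A \<in> I" "\<And>A B. A \<in> I \<Longrightarrow> B \<in> I \<Longrightarrow> A - B \<in> I"
proof -
  show *: "0 \<in> I" "\<And>A B. A \<in> I \<Longrightarrow> B \<in> I \<Longrightarrow> A + B \<in> I" "\<And>A B. B \<in> I \<Longrightarrow> A * B \<in> I"
    "\<And>A. A \<in> I \<Longrightarrow> dpoly_\<delta>1 A \<in> I" "\<And>A. A \<in> I \<Longrightarrow> dpoly_\<delta>2 A \<in> I"
    using assms by (auto simp: differential_ideal_def)
  show **: "- A \<in> I" if "A \<in> I" for A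
    using *(3)[OF that, of "- 1"] by simp
  show "A - B \<in> I" if "A \<in> I" "B \<in> I" for A B
    using *(2)[OF that(1) **[OF that(2)]] by simp
qed

text \<open>The operator \<open>L\<^sub>k\<close> on symbols. If the order of v is at most k, the
  binomial coefficient is 0, so the truncated subtraction does no harm.\<close>

definition lower :: "nat \<Rightarrow> dvar \<Rightarrow> dpoly" where
  "lower k v = single (single (fst v, snd v - k) 1) (of_nat (snd v choose Suc k))"

definition lowering :: "nat \<Rightarrow> dpoly \<Rightarrow> dpoly" where
  "lowering k = gder (\<lambda>_. 0) (lower k)"

interpretation lowering: derivation "lowering k" for k
  unfolding lowering_def by (intro gder_derivation zero_derivation)

lemma lowering_const [simp]: "lowering k (const c) = 0"
  by (simp add: lowering_def gder_const zero_derivation)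

lemma lowering_var: "lowering k (var v) = lower k v"
  by (simp add: lowering_def gder_var zero_derivation)

lemma dvars_lower: "dvars (lower k v) \<subseteq> {(fst v, snd v - k)}"
  using dvars_single[of "single (fst v, snd v - k) (1::nat)"] by (fastforce simp: lower_def)

definition coeff_der :: "ratfun \<Rightarrow> dpoly \<Rightarrow> dpoly" where
  "coeff_der f = gder (slope_deriv f) (\<lambda>_. 0)"

interpretation coeff_der: derivation "coeff_der f" for f
  unfolding coeff_der_def by (intro gder_derivation slope_deriv_derivation)

lemma coeff_der_const [simp]: "coeff_der f (const c) = const (slope_deriv f c)"
  by (simp add: coeff_der_def gder_const slope_deriv_derivation)

lemma coeff_der_var [simp]: "coeff_der f (var v) = 0"
  by (simp add: coeff_der_def gder_var slope_deriv_derivation)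

lemma lookup_coeff_der: "lookup (coeff_der f A) m = slope_deriv f (lookup A m)"
  by (simp add: coeff_der_def gder_def gterm_def lookup_sum lookup_single when_def in_keys_iff sum.delta')

text \<open>On differential polynomials in \<open>\<delta>2\<^sup>j y\<close> with \<open>j \<le> N\<close>, this is \<open>\<delta>1 + f \<delta>2\<close> modulo
  \<open>\<delta>1 y + f \<delta>2 y\<close>.\<close>

definition reduced_der :: "ratfun \<Rightarrow> nat \<Rightarrow> dpoly \<Rightarrow> dpoly" where
  "reduced_der f N A = coeff_der f A - (\<Sum>k\<le>N. const ((\<delta>2 ^^ Suc k) f) * lowering k A)"

interpretation reduced_der: derivation "reduced_der f N" for f N
proof
  fix A B :: dpoly
  show "reduced_der f N (A + B) = reduced_der f N A + reduced_der f N B"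
    by (simp add: reduced_der_def coeff_der.add lowering.add distrib_left sum.distrib)
  show "reduced_der f N (A * B) = reduced_der f N A * B + A * reduced_der f N B"
    by (simp add: reduced_der_def coeff_der.mult lowering.mult distrib_left sum.distrib left_diff_distrib
        right_diff_distrib sum_distrib_left sum_distrib_right mult.left_commute mult.assoc)
qed

lemma reduced_der_const: "reduced_der f N (const c) = const (slope_deriv f c)"
  by (simp add: reduced_der_def)

text \<open>The right-hand side is \<open>\<delta>1 y\<^sub>j + f \<delta>2 y\<^sub>j\<close> after
  substituting \<open>- \<delta>2\<^sup>j (f y\<^sub>1)\<close> for
  \<open>\<delta>1 y\<^sub>j\<close>. In Leibniz's formula the term i = 0 cancels against
  \<open>f y\<^sub>j\<^sub>+\<^sub>1\<close>, and the term i = k + 1 is the contribution of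
  \<open>lowering k\<close>.\<close>

lemma reduced_der_var:
  assumes "j \<le> N"
  shows "reduced_der f N (var (0, j))
    = const f * var (0, Suc j) - (dpoly_\<delta>2 ^^ j) (const f * var (0, Suc 0))"
proof -
  have [simp]: "(dpoly_\<delta>2 ^^ i) (const c) = const ((\<delta>2 ^^ i) c)" for i c
    by (induction i) simp_all
  have [simp]: "(dpoly_\<delta>2 ^^ i) (var (0, Suc 0)) = var (0, Suc i)" for i
    by (induction i) (simp_all)
  let ?t = "\<lambda>i. of_nat (j choose i) * const ((\<delta>2 ^^ i) f) * var (0, Suc (j - i))"
  have "(dpoly_\<delta>2 ^^ j) (const f * var (0, Suc 0)) = (\<Sum>i\<le>j. ?t i)"
    by (simp add: dp2.funpow_mult)
  also have "\<dots> = (\<Sum>i\<le>Suc N. ?t i)"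
    using assms by (intro sum.mono_neutral_left) (auto simp: binomial_eq_0)
  also have "\<dots> = const f * var (0, Suc j) + (\<Sum>k\<le>N. ?t (Suc k))"
    by (subst sum.atMost_Suc_shift) simp
  also have "(\<Sum>k\<le>N. ?t (Suc k)) = (\<Sum>k\<le>N. const ((\<delta>2 ^^ Suc k) f) * lowering k (var (0, j)))"
  proof (intro sum.cong refl)
    fix k
    show "?t (Suc k) = const ((\<delta>2 ^^ Suc k) f) * lowering k (var (0, j))"
    proof (cases "k < j")
      case True
      then have "Suc (j - Suc k) = j - k" by simp
      then show ?thesis
        unfolding lowering_var lower_def
        by (simp add: var_def of_nat_single mult_single mult_ac del: single_of_nat funpow.simps)
    next
      case False
      then show ?thesis by (simp add: lowering_var lower_def binomial_eq_0)
    qed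
  qed
  finally show ?thesis
    by (simp add: reduced_der_def)
qed

section \<open>Elimination of the derivatives with respect to x1\<close>

definition ycols :: "nat \<Rightarrow> dvar set" where
  "ycols N = {0} \<times> {..N}"

lemma dvars_reduced_der:
  assumes "dvars A \<subseteq> ycols N"
  shows "dvars (reduced_der f N A) \<subseteq> ycols N"
proof -
  have "dvars (coeff_der f A) \<subseteq> ycols N"
    unfolding coeff_der_def using assms by (intro dvars_gder) auto
  moreover have "dvars (lowering k A) \<subseteq> ycols N" for k
    unfolding lowering_def
    by (rule dvars_gder[OF assms order_refl]) (use dvars_lower in \<open>fastforce simp: ycols_def\<close>)
  then have "dvars (\<Sum>k\<le>N. const ((\<delta>2 ^^ Suc k) f) * lowering k A) \<subseteq> ycols N"
    by (intro dvars_sum dvars_const_mult)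
  ultimately show ?thesis
    unfolding reduced_der_def using dvars_diff by blast
qed

context
  fixes I :: "dpoly set" and f :: ratfun
  assumes I: "differential_ideal I" and base: "var (Suc 0, 0) + const f * var (0, Suc 0) \<in> I"
begin

text \<open>The difference is a derivation. It vanishes on coefficients, and on
  \<open>y\<^sub>j\<close> it is the j-th \<delta>2-derivative of the base element.\<close>

lemma reduced_der_congruent:
  assumes A: "dvars A \<subseteq> ycols N"
  shows "dpoly_\<delta>1 A + const f * dpoly_\<delta>2 A - reduced_der f N A \<in> I"
proof (rule derivation_into_ideal[where V = "ycols N"
      and G = "\<lambda>A. dpoly_\<delta>1 A + const f * dpoly_\<delta>2 A - reduced_der f N A"])
  show "derivation (\<lambda>A. dpoly_\<delta>1 A + const f * dpoly_\<delta>2 A - reduced_der f N A)"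
    by standard (simp_all add: dp1.add dp2.add reduced_der.add dp1.mult dp2.mult reduced_der.mult algebra_simps)
  show "dpoly_\<delta>1 (const c) + const f * dpoly_\<delta>2 (const c) - reduced_der f N (const c) \<in> I" for c
    using differential_idealD(1)[OF I]
    by (simp add: reduced_der_const slope_deriv_def mult_single single_add)
  fix v assume "v \<in> ycols N"
  then obtain j where v: "v = (0, j)" "j \<le> N" by (auto simp: ycols_def)
  have "(dpoly_\<delta>2 ^^ j) (var (Suc 0, 0) + const f * var (0, Suc 0)) \<in> I"
    by (induction j) (simp_all add: base differential_idealD(5)[OF I])
  moreover have "(dpoly_\<delta>2 ^^ j) (B + C) = (dpoly_\<delta>2 ^^ j) B + (dpoly_\<delta>2 ^^ j) C" for B C
    by (induction j) (simp_all add: dp2.add)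
  moreover have "(dpoly_\<delta>2 ^^ j) (var (Suc 0, 0)) = var (Suc 0, j)"
    by (induction j) (simp_all)
  ultimately show "dpoly_\<delta>1 (var v) + const f * dpoly_\<delta>2 (var v) - reduced_der f N (var v) \<in> I"
    using v by (simp add: reduced_der_var algebra_simps)
qed (use differential_idealD[OF I] A in auto)

lemma reduced_der_in_ideal:
  assumes "dvars A \<subseteq> ycols N" "A \<in> I"
  shows "reduced_der f N A \<in> I"
proof -
  have "dpoly_\<delta>1 A + const f * dpoly_\<delta>2 A \<in> I"
    by (intro differential_idealD(2-5)[OF I] assms(2))
  from differential_idealD(7)[OF I this reduced_der_congruent[OF assms(1)]] show ?thesis by simp
qed

text \<open>If \<open>var (i, j)\<close> is congruent to B, then \<open>var (Suc i, j)\<close> is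
  congruent to \<delta>1 B, and hence to \<open>reduced_der f N B\<close> - f \<delta>2 B. The last
  term may raise the order by one, whence \<open>ycols (Suc N)\<close>.\<close>

lemma reduce_mod_ideal: "\<exists>N B'. dvars B' \<subseteq> ycols N \<and> B - B' \<in> I"
proof -
  note D = differential_idealD[OF I]
  define R where "R B \<longleftrightarrow> (\<exists>N B'. dvars B' \<subseteq> ycols N \<and> B - B' \<in> I)" for B
  have mono: "ycols M \<subseteq> ycols (max M N)" "ycols N \<subseteq> ycols (max M N)" for M N
    by (auto simp: ycols_def)
  have R_add: "R (B + C)" if RBC: "R B" "R C" for B C
  proof -
    obtain M B' N C' where B: "dvars B' \<subseteq> ycols M" "B - B' \<in> I" and C: "dvars C' \<subseteq> ycols N" "C - C' \<in> I"
      using RBC unfolding R_def by blast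
    have "dvars (B' + C') \<subseteq> ycols (max M N)"
      using dvars_add[of B' C'] B C mono by blast
    moreover have "(B + C) - (B' + C') \<in> I"
      using D(2)[OF B(2) C(2)] by (simp add: algebra_simps)
    ultimately show ?thesis unfolding R_def by blast
  qed
  have R_mult: "R (B * C)" if RBC: "R B" "R C" for B C
  proof -
    obtain M B' N C' where B: "dvars B' \<subseteq> ycols M" "B - B' \<in> I" and C: "dvars C' \<subseteq> ycols N" "C - C' \<in> I"
      using RBC unfolding R_def by blast
    have "dvars (B' * C') \<subseteq> ycols (max M N)"
      using dvars_mult[of B' C'] B C mono by blast
    moreover have "B * C - B' * C' = C * (B - B') + B' * (C - C')"
      by (simp add: algebra_simps)
    then have "B * C - B' * C' \<in> I"
      using D(2)[OF D(3)[OF B(2)] D(3)[OF C(2)]] by simp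
    ultimately show ?thesis unfolding R_def by blast
  qed
  have R_const: "R (const c)" for c
    unfolding R_def using D(1) dvars_single[of 0 c] by (intro exI[of _ 0] exI[of _ "const c"]) auto
  have R_var: "R (var (i, j))" for i j
  proof (induction i)
    case 0
    have "dvars (var (0, j)) \<subseteq> ycols j"
      by (simp add: dvars_var ycols_def)
    then show ?case
      unfolding R_def using D(1) by (intro exI[of _ j] exI[of _ "var (0, j)"]) auto
  next
    case (Suc i)
    then obtain N B where B: "dvars B \<subseteq> ycols N" "var (i, j) - B \<in> I"
      unfolding R_def by blast
    let ?C = "reduced_der f N B - const f * dpoly_\<delta>2 B"
    have "dvars (dpoly_\<delta>2 B) \<subseteq> ycols (Suc N)"
      unfolding dpoly_\<delta>2_gder
    proof (rule dvars_gder[OF B(1)])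
      show "dvars (var (fst v, Suc (snd v))) \<subseteq> ycols (Suc N)" if "v \<in> ycols N" for v
        using that by (auto simp: dvars_var ycols_def)
    qed (auto simp: ycols_def)
    then have "dvars (const f * dpoly_\<delta>2 B) \<subseteq> ycols (Suc N)"
      by (rule dvars_const_mult)
    moreover have "dvars (reduced_der f N B) \<subseteq> ycols (Suc N)"
      using dvars_reduced_der[OF B(1), of f] by (auto simp: ycols_def)
    ultimately have "dvars ?C \<subseteq> ycols (Suc N)"
      using dvars_diff by blast
    moreover have "dpoly_\<delta>1 (var (i, j) - B) + (dpoly_\<delta>1 B + const f * dpoly_\<delta>2 B - reduced_der f N B) \<in> I"
      by (intro D(2) D(4) B(2) reduced_der_congruent B(1))
    then have "var (Suc i, j) - ?C \<in> I"
      by (simp add: dp1.diff algebra_simps)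
    ultimately show ?case unfolding R_def by blast
  qed
  have R_monom: "R (single m 1)" for m
  proof (induction m rule: monom_induct[where V = UNIV])
    case zero
    show ?case by (rule R_const)
  next
    case (add m v)
    then have "R (single m 1 * var v)"
      by (cases v) (simp add: R_mult R_var)
    then show ?case by (simp add: mult_single var_def)
  qed simp
  have "R B"
  proof (induction B rule: poly_mapping_induct)
    case zero
    show ?case using R_const[of 0] by simp
  next
    case (single m c)
    show ?case unfolding single_eq_const_mult[of m c] by (intro R_mult R_const R_monom)
  qed (rule R_add)
  then show ?thesis unfolding R_def .
qed

end

section \<open>The weight filtration\<close>

definition wt :: "monom \<Rightarrow> nat" where
  "wt m = (\<Sum>v\<in>keys m. lookup m v * snd v)"

lemma wt_add: "wt (m + n) = wt m + wt n"
  unfolding wt_def by (rule setsum_keys_plus_distrib) (simp_all add: algebra_simps)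

lemma wt_single [simp]: "wt (single v k) = k * snd v"
  by (simp add: wt_def)

lemma wt_diff_single: "lookup m v > 0 \<Longrightarrow> wt (m - single v 1) + snd v = wt m"
  using wt_add[of "m - single v 1" "single v 1"] monom_split[of m v] by simp

lemma keys_gterm_lower:
  assumes "n \<in> keys (gterm (\<lambda>_. 0) (lower k) m c)"
  shows "wt n + k = wt m"
proof -
  have "n \<in> (\<Union>v\<in>keys m. keys (single (m - single v 1) (of_nat (lookup m v) * c) * lower k v))"
    using assms keys_sum by (fastforce simp: gterm_def)
  then obtain v where v: "v \<in> keys m"
    and n: "n \<in> keys (single (m - single v 1) (of_nat (lookup m v) * c) * lower k v)"
    by blast
  then have "k < snd v"
    by (rule_tac ccontr) (simp add: lower_def binomial_eq_0)
  have "n = (m - single v 1) + single (fst v, snd v - k) 1"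
    using n by (simp add: lower_def mult_single split: if_splits)
  then have "wt n = wt (m - single v 1) + (snd v - k)"
    by (simp add: wt_add)
  then show ?thesis
    using wt_diff_single[of m v] v \<open>k < snd v\<close> by (simp add: in_keys_iff)
qed

lemma lowering_eq_sum: "lowering k A = (\<Sum>m\<in>keys A. gterm (\<lambda>_. 0) (lower k) m (lookup A m))"
  by (simp add: lowering_def gder_def)

lemma keys_lowering:
  assumes "n \<in> keys (lowering k A)"
  shows "\<exists>m\<in>keys A. wt n + k = wt m"
proof -
  have "n \<in> (\<Union>m\<in>keys A. keys (gterm (\<lambda>_. 0) (lower k) m (lookup A m)))"
    using assms unfolding lowering_eq_sum by (rule subsetD[OF keys_sum])
  then show ?thesis using keys_gterm_lower by (elim UN_E) (rule bexI)
qed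

definition part :: "nat \<Rightarrow> dpoly \<Rightarrow> dpoly" where
  "part w A = (\<Sum>m\<in>{m \<in> keys A. wt m = w}. single m (lookup A m))"

lemma lookup_part: "lookup (part w A) m = (if wt m = w then lookup A m else 0)"
  by (simp add: part_def lookup_sum lookup_single when_def in_keys_iff sum.delta')

lemma keys_part: "keys (part w A) = {m \<in> keys A. wt m = w}"
  by (auto simp: in_keys_iff lookup_part split: if_splits)

text \<open>Since \<open>lowering k\<close> lowers the weight by exactly k, a coefficient of the
  image depends on one homogeneous part only.\<close>

lemma lookup_lowering_part: "lookup (lowering k A) m = lookup (lowering k (part (wt m + k) A)) m"
proof -
  let ?P = "part (wt m + k) A"
  have "m \<notin> keys (lowering k (A - ?P))"
  proof
    assume "m \<in> keys (lowering k (A - ?P))"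
    then obtain n where "n \<in> keys (A - ?P)" "wt m + k = wt n"
      using keys_lowering by blast
    then show False
      by (simp add: in_keys_iff lookup_minus lookup_part)
  qed
  then have "lookup (lowering k (A - ?P)) m = 0"
    by (simp add: in_keys_iff)
  then show ?thesis
    by (simp add: lowering.diff lookup_minus)
qed

text \<open>Euler's identity: on symbols, \<open>lowering 0\<close> is multiplication by the
  order.\<close>

lemma lookup_lowering_zero: "lookup (lowering 0 A) m = of_nat (wt m) * lookup A m"
proof -
  have mono: "gterm (\<lambda>_. 0) (lower 0) n c = single n (of_nat (wt n) * c)" for n c
  proof -
    have "single (n - single v 1) (of_nat (lookup n v) * c) * lower 0 v
        = single n (of_nat (lookup n v * snd v) * c)" if "v \<in> keys n" for v
      using monom_split[of n v] add.commute[of "n - single v 1" "single v 1"] that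
      by (simp add: lower_def mult_single in_keys_iff mult_ac)
    then have "gterm (\<lambda>_. 0) (lower 0) n c = (\<Sum>v\<in>keys n. single n (of_nat (lookup n v * snd v) * c))"
      by (simp add: gterm_def)
    also have "\<dots> = single n (of_nat (wt n) * c)"
    proof -
      have "(\<Sum>v\<in>V. single n (g v)) = single n (sum g V)" for g :: "dvar \<Rightarrow> ratfun" and V
        by (induction V rule: infinite_finite_induct) (simp_all add: single_add)
      then show ?thesis
        by (simp only: wt_def of_nat_sum sum_distrib_right)
    qed
    finally show ?thesis .
  qed
  show ?thesis
    unfolding lowering_eq_sum mono
    by (simp add: lookup_sum lookup_single when_def in_keys_iff sum.delta')
qed

text \<open>The binomials C(j, k + 1) vanish for j \<le> k. For this reason fewer equations have to
  be excluded in low order.\<close>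

lemma lowering_trivial:
  assumes "dvars A \<subseteq> ycols k"
  shows "lowering k A = 0"
proof (rule derivation_eqI[where V = "ycols k" and E = "lowering k" and F = "\<lambda>_. 0"])
  show "lowering k (var v) = 0" if "v \<in> ycols k" for v
    using that by (auto simp: lowering_var lower_def ycols_def binomial_eq_0)
qed (use assms lowering.derivation_axioms zero_derivation in simp_all)

section \<open>Commutation relations and common kernel of the lowering operators\<close>

lemma coeff_der_lowering: "coeff_der f (lowering k A) = lowering k (coeff_der f A)"
proof -
  let ?E = "\<lambda>A. coeff_der f (lowering k A) - lowering k (coeff_der f A)"
  have E: "derivation ?E"
    by standard (simp_all add: coeff_der.add lowering.add coeff_der.mult lowering.mult algebra_simps)
  have lower: "coeff_der f (lower k v) = 0" for v
  proof -
    have "lower k v = const (of_nat (snd v choose Suc k)) * var (fst v, snd v - k)"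
      by (simp add: lower_def var_def mult_single del: single_of_nat)
    moreover have "slope_deriv f (of_nat n) = 0" for n
      using derivation.of_nat[OF slope_deriv_derivation] .
    ultimately show ?thesis
      by (simp add: coeff_der.mult del: single_of_nat)
  qed
  have "?E A = (\<lambda>_. 0) A"
    by (rule derivation_eqI[OF E zero_derivation, where V = UNIV]) (simp_all add: lowering_var lower)
  then show ?thesis by simp
qed

text \<open>The bracket of \<open>lowering k\<close> and \<open>lowering 1\<close> evaluated on
  \<open>y\<^sub>j\<close>: both compositions lead to the symbol of order j - k - 1, and their
  coefficients are compared. One product is moved to the right so that everything stays within the
  natural numbers.\<close>

lemma choose_bracket:
  "2 * ((j choose 2) * ((j - 1) choose Suc k)) = (k - 1) * (k + 2) * (j choose (k + 2))
      + 2 * ((j choose Suc k) * ((j - k) choose 2))" if "k \<ge> 1"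
proof (cases "k + 2 \<le> j")
  case True
  obtain i where j: "j = k + 2 + i" using True le_Suc_ex by blast
  have two: "2 * (n choose 2) = n * (n - 1)" for n :: nat
  proof -
    have "even (n * (n - 1))" by (cases n) simp_all
    then show ?thesis by (simp add: choose_two)
  qed
  \<comment> \<open>Absorption turns the nested products into (k + 2) C(j, k + 2) times j - 1 and j
    - k respectively, and j - 1 = (k - 1) + (j - k).\<close>
  have a: "j * ((j - 1) choose Suc k) = (k + 2) * (j choose (k + 2))"
    using binomial_absorption[of "Suc k" j] by simp
  have b: "(j - Suc k) * (j choose Suc k) = (k + 2) * (j choose (k + 2))"
    using binomial_absorb_comp[of j "Suc k"] a by simp
  have "2 * ((j choose 2) * ((j - 1) choose Suc k)) = (j - 1) * (j * ((j - 1) choose Suc k))"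
    using two[of j] by (metis mult.assoc mult.commute)
  also have "\<dots> = (j - 1) * ((k + 2) * (j choose (k + 2)))"
    by (simp only: a)
  finally have 1: "2 * ((j choose 2) * ((j - 1) choose Suc k)) = (j - 1) * ((k + 2) * (j choose (k + 2)))" .
  have "2 * ((j choose Suc k) * ((j - k) choose 2)) = (j choose Suc k) * ((j - k) * (j - k - 1))"
    using two[of "j - k"] by (metis mult.left_commute)
  also have "\<dots> = (j - k) * ((j - Suc k) * (j choose Suc k))"
    by (simp add: mult_ac)
  also have "\<dots> = (j - k) * ((k + 2) * (j choose (k + 2)))"
    by (simp only: b)
  finally have 2: "2 * ((j choose Suc k) * ((j - k) choose 2)) = (j - k) * ((k + 2) * (j choose (k + 2)))" .
  have 3: "j - 1 = (k - 1) + (j - k)"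
    using that True by simp
  show ?thesis
    unfolding 1 2 using 3 by (metis distrib_right mult.assoc)
next
  case False
  then have *: "(j choose (k + 2)) = 0" "((j - 1) choose Suc k) = 0" "((j - k) choose 2) = 0"
    by (intro binomial_eq_0; simp)+
  show ?thesis unfolding * by simp
qed

lemma lowering_lower: "lowering k (lower l v)
    = single (single (fst v, snd v - l - k) 1)
        (of_nat ((snd v choose Suc l) * ((snd v - l) choose Suc k)))"
proof -
  have "lower l v = const (of_nat (snd v choose Suc l)) * var (fst v, snd v - l)"
    by (simp add: lower_def var_def mult_single del: single_of_nat)
  then have "lowering k (lower l v) = const (of_nat (snd v choose Suc l)) * lower k (fst v, snd v - l)"
    by (simp add: lowering.mult lowering_var del: single_of_nat)
  then show ?thesis by (simp add: lower_def mult_single del: single_of_nat)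
qed

text \<open>The operators \<open>lowering k\<close> represent the vector fields \<open>x\<^sup>k\<^sup>+\<^sup>1/(k+1)! \<partial>\<^sub>x\<close>, so that those with
  \<open>k \<ge> 1\<close> are generated by \<open>lowering 1\<close> and \<open>lowering 2\<close>.\<close>

lemma lowering_bracket:
  assumes "k \<ge> 1"
  shows "2 * (lowering k (lowering 1 A) - lowering 1 (lowering k A)) = of_nat ((k - 1) * (k + 2)) * lowering (Suc k) A"
proof -
  let ?E = "\<lambda>A. 2 * (lowering k (lowering 1 A) - lowering 1 (lowering k A)) - of_nat ((k - 1) * (k + 2)) * lowering (Suc k) A"
  have E: "derivation ?E"
    by standard (simp_all add: lowering.add lowering.mult algebra_simps del: of_nat_mult of_nat_add of_nat_diff)
  have var: "?E (var v) = 0" for v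
  proof -
    let ?m = "single (fst v, snd v - Suc k) (1::nat)"
    have num: "of_nat n * single ?m (of_nat a) = (single ?m (of_nat (n * a)) :: dpoly)" for n a
    proof -
      have "(of_nat n :: dpoly) = const (of_nat n)" by simp
      then show ?thesis by (simp only: mult_single add_0 of_nat_mult)
    qed
    note num2 = num[of 2, unfolded of_nat_numeral]
    have 1: "lowering k (lowering 1 (var v)) = single ?m (of_nat ((snd v choose 2) * ((snd v - 1) choose Suc k)))"
      unfolding lowering_var lowering_lower by (simp add: numeral_2_eq_2)
    have 2: "lowering 1 (lowering k (var v)) = single ?m (of_nat ((snd v choose Suc k) * ((snd v - k) choose 2)))"
      unfolding lowering_var lowering_lower by (simp add: numeral_2_eq_2)
    have 3: "lowering (Suc k) (var v) = single ?m (of_nat (snd v choose (k + 2)))"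
      by (simp add: lowering_var lower_def)
    have "2 * lowering k (lowering 1 (var v)) = of_nat ((k - 1) * (k + 2)) * lowering (Suc k) (var v) + 2 * lowering 1 (lowering k (var v))"
      unfolding 1 2 3 num num2 single_add[symmetric] of_nat_add[symmetric]
        choose_bracket[OF assms, of "snd v"] ..
    then show ?thesis by (simp only: right_diff_distrib) simp
  qed
  have "?E A = (\<lambda>_. 0) A"
    by (rule derivation_eqI[OF E zero_derivation, where V = UNIV]) (use var in simp_all)
  then show ?thesis by simp
qed

text \<open>Induction by bracketing with \<open>lowering 1\<close>. The factor (l - 1)(l + 2)
  vanishes for l = 1, so this does not produce \<open>lowering 2\<close>, which is therefore
  assumed; from l = 2 on the factor can be cancelled in characteristic zero.\<close>

lemma lowering_generated:
  assumes "lowering 1 A = 0" "lowering 2 A = 0" "k \<ge> 1"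
  shows "lowering k A = 0"
  using assms(3)
proof (induction k rule: less_induct)
  case (less k)
  consider "k = 1" | "k = 2" | l where "k = Suc l" "l \<ge> 2"
    using less.prems by (metis One_nat_def Suc_1 Suc_leI le_neq_implies_less not0_implies_Suc not_less_eq_eq not_one_le_zero)
  then show ?case
  proof cases
    case 3
    then have "lowering l A = 0" using less.IH by simp
    then have zero: "of_nat ((l - 1) * (l + 2)) * lowering k A = 0"
      using lowering_bracket[of l A] assms(1) 3 by simp
    have "lookup (lowering k A) m = 0" for m
    proof -
      have "lookup (const (of_nat n) * B) m = of_nat n * lookup B m" for n and B :: dpoly
        by (induction n) (simp_all add: distrib_right single_add lookup_add)
      then have "of_nat ((l - 1) * (l + 2)) * lookup (lowering k A) m = (0 :: ratfun)"
        using zero by (metis lookup_zero single_of_nat)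
      moreover have "(of_nat ((l - 1) * (l + 2)) :: ratfun) \<noteq> 0"
        using 3 by (simp only: of_nat_eq_0_iff) simp
      ultimately show ?thesis by (metis mult_eq_0_iff)
    qed
    then show ?thesis by (intro poly_mapping_eqI) simp
  qed (use assms in auto)
qed

text \<open>Let r \<ge> 2 be the highest order that occurs. Then \<open>lowering (r - 1)\<close>
  replaces one \<open>y\<^sub>r\<close> by \<open>y\<^sub>1\<close>, with factor C(r, r) = 1 on the
  symbol, and kills all symbols of lower order. Distinct monomials containing
  \<open>y\<^sub>r\<close> have distinct images, so nothing can cancel.\<close>

lemma lowering_kernel:
  assumes A: "dvars A \<subseteq> {0} \<times> UNIV" and kernel: "\<And>k. k \<ge> 1 \<Longrightarrow> lowering k A = 0"
  shows "dvars A \<subseteq> ycols 1"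
proof (rule ccontr)
  assume "\<not> dvars A \<subseteq> ycols 1"
  then obtain v where v: "v \<in> dvars A" "snd v \<ge> 2"
    using A by (force simp: ycols_def)
  define r where "r = Max (snd ` dvars A)"
  have "r \<in> snd ` dvars A" and max: "\<And>v. v \<in> dvars A \<Longrightarrow> snd v \<le> r"
    unfolding r_def using v finite_dvars by (auto intro!: Max_in)
  then obtain m where m: "m \<in> keys A" "(0, r) \<in> keys m"
    using A by (force simp: dvars_def)
  have r: "r \<ge> 2" using max[OF v(1)] v(2) by simp
  let ?s = "\<lambda>m. m - single (0, r) 1 + single (0, 1) (1::nat)"
  have gterm_eq: "gterm (\<lambda>_. 0) (lower (r - 1)) n (lookup A n) = single (?s n) (of_nat (lookup n (0, r)) * lookup A n)"
    if n: "n \<in> keys A" for n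
  proof -
    have "single (n - single v 1) (of_nat (lookup n v) * lookup A n) * lower (r - 1) v
        = (if v = (0, r) then single (?s n) (of_nat (lookup n (0, r)) * lookup A n) else 0)"
      if "v \<in> keys n" for v
    proof -
      have "fst v = 0" "snd v \<le> r" using that n A max by (auto simp: dvars_def)
      then show ?thesis
        using r by (cases v) (auto simp: lower_def mult_single binomial_eq_0)
    qed
    then show ?thesis
      by (simp add: gterm_def in_keys_iff)
  qed
  have inj: "n = m" if "?s n = ?s m" "lookup n (0, r) > 0" for n
    using that monom_split[of n "(0, r)"] monom_split[of m "(0, r)"] m(2)
    by (metis add_right_imp_eq in_keys_iff neq0_conv)
  have "lookup (lowering (r - 1) A) (?s m)
      = (\<Sum>n\<in>keys A. lookup (single (?s n) (of_nat (lookup n (0, r)) * lookup A n)) (?s m))"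
    unfolding lowering_eq_sum lookup_sum by (intro sum.cong refl) (simp only: gterm_eq)
  also have "\<dots> = (\<Sum>n\<in>keys A. if n = m then of_nat (lookup m (0, r)) * lookup A m else 0)"
  proof (intro sum.cong refl)
    fix n
    show "lookup (single (?s n) (of_nat (lookup n (0, r)) * lookup A n)) (?s m)
        = (if n = m then of_nat (lookup m (0, r)) * lookup A m else 0)"
    proof (cases "n = m")
      case False
      then have "?s n \<noteq> ?s m \<or> lookup n (0, r) = 0" using inj by blast
      then show ?thesis using False by (auto simp: lookup_single when_def)
    qed simp
  qed
  also have "\<dots> = of_nat (lookup m (0, r)) * lookup A m"
    using m(1) by simp
  finally have "of_nat (lookup m (0, r)) * lookup A m = 0"
    using kernel[of "r - 1"] r by simp
  then show False
    using m by (simp add: in_keys_iff)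
qed

section \<open>Elements of minimal top weight\<close>

lemma minimal_top_part:
  fixes V :: "dpoly set"
  assumes "\<exists>A\<in>V. A \<noteq> 0"
  obtains A w where "A \<in> V" "A \<noteq> 0" "\<forall>m\<in>keys A. wt m \<le> w" "\<exists>m\<in>keys A. wt m = w"
    "\<forall>B\<in>V. (\<forall>m\<in>keys B. wt m \<le> w) \<longrightarrow> keys (part w B) \<subset> keys (part w A) \<longrightarrow> B = 0"
proof -
  define top where "top A = Max (wt ` keys A)" for A :: dpoly
  define size where "size A = card (keys (part (top A) A))" for A
  let ?W = "{A \<in> V. A \<noteq> 0}"
  let ?R = "inv_image (less_than <*lex*> less_than) (\<lambda>A. (top A, size A))"
  obtain A0 where A0: "A0 \<in> ?W" using assms by blast
  have "wf ?R"
    by (rule wf_inv_image[OF wf_lex_prod[OF wf_less_than wf_less_than]])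
  then have "\<exists>A\<in>?W. \<forall>B. (B, A) \<in> ?R \<longrightarrow> B \<notin> ?W"
    using A0 by (rule wf_eq_minimal[THEN iffD1, rule_format])
  then obtain A where A: "A \<in> ?W" and min: "\<forall>B. (B, A) \<in> ?R \<longrightarrow> B \<notin> ?W"
    by (elim bexE)
  have le: "wt m \<le> top A" if "m \<in> keys A" for m
    unfolding top_def using that by (intro Max_ge) auto
  have "top A \<in> wt ` keys A"
    unfolding top_def using A by (intro Max_in) auto
  then have ex: "\<exists>m\<in>keys A. wt m = top A" by force
  have "B = 0" if B: "B \<in> V" "\<forall>m\<in>keys B. wt m \<le> top A"
    "keys (part (top A) B) \<subset> keys (part (top A) A)" for B
  proof (rule ccontr)
    assume "B \<noteq> 0"
    then have "top B \<le> top A"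
      unfolding top_def[of B] using B(2) by (intro Max.boundedI) auto
    moreover have "size B < size A" if "top B = top A"
      unfolding size_def that by (rule psubset_card_mono) (use B(3) in auto)
    ultimately have "(B, A) \<in> ?R"
      by auto
    then show False using min \<open>B \<noteq> 0\<close> B(1) by blast
  qed
  then show ?thesis
    using that[of A "top A"] A le ex by blast
qed

lemma lookup_const_mult: "lookup (const c * A) m = c * lookup A m"
proof (induction A rule: poly_mapping_induct)
  case (add B C)
  then show ?case by (simp add: distrib_left lookup_add)
qed (simp_all add: mult_single lookup_single when_def)

text \<open>The disjunctions record from which order on an equation can arise: positive weight
  requires \<open>y\<^sub>1\<close>, \<open>lowering 1\<close> acts nontrivially only from
  \<open>y\<^sub>2\<close> on and \<open>lowering 2\<close> only from \<open>y\<^sub>3\<close>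
  on.\<close>

lemma stable_space_normal_form:
  fixes V :: "dpoly set"
  assumes ex: "\<exists>A\<in>V. A \<noteq> 0"
    and cols: "\<And>A. A \<in> V \<Longrightarrow> dvars A \<subseteq> ycols N"
    and add: "\<And>A B. A \<in> V \<Longrightarrow> B \<in> V \<Longrightarrow> A + B \<in> V"
    and scale: "\<And>c A. A \<in> V \<Longrightarrow> const c * A \<in> V"
    and stable: "\<And>A. A \<in> V \<Longrightarrow> reduced_der f N A \<in> V"
    and sol1: "N = 0 \<or> \<not> slope_sol1 f" and sol2: "N \<le> 1 \<or> \<not> slope_sol2 f"
    and sol3: "N \<le> 2 \<or> \<not> slope_sol3 f"
  obtains B w where "B \<in> V" "B \<noteq> 0" "dvars B \<subseteq> ycols 1"
    "\<And>m. m \<in> keys B \<Longrightarrow> wt m = w" "\<And>m. slope_deriv f (lookup B m) = 0"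
proof -
  obtain A w where A: "A \<in> V" "A \<noteq> 0" and A_le: "\<forall>m\<in>keys A. wt m \<le> w"
    and top: "\<exists>m\<in>keys A. wt m = w"
    and min: "\<forall>B\<in>V. (\<forall>m\<in>keys B. wt m \<le> w) \<longrightarrow> keys (part w B) \<subset> keys (part w A) \<longrightarrow> B = 0"
    by (rule minimal_top_part[OF ex])
  obtain m0 where m0: "m0 \<in> keys A" "wt m0 = w" using top by blast
  \<comment> \<open>The coefficient at \<open>m0\<close> becomes 1 and is killed by D; this will
    remove \<open>m0\<close> from the top part of \<open>C\<close>.\<close>
  define B where "B = const (1 / lookup A m0) * A"
  have B_lookup: "lookup B m = lookup A m / lookup A m0" for m
    by (simp add: B_def lookup_const_mult)
  have B_keys: "keys B = keys A"
    using m0(1) by (auto simp: in_keys_iff B_lookup)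
  have B_V: "B \<in> V" unfolding B_def by (rule scale[OF A(1)])
  have B_le: "wt m \<le> w" if "m \<in> keys B" for m using A_le that B_keys by simp
  have B_high: "part v B = 0" if "v > w" for v
    using B_le that by (fastforce simp: keys_eq_empty[symmetric] keys_part simp del: keys_eq_empty)
  have red: "lookup (reduced_der f N B) m + of_nat w * \<delta>2 f * lookup B m
      = slope_deriv f (lookup B m) + (of_nat w - of_nat (wt m)) * \<delta>2 f * lookup B m
        - (\<Sum>k\<in>{1..N}. (\<delta>2 ^^ Suc k) f * lookup (lowering k B) m)" for m
  proof -
    have "(\<Sum>k\<le>N. (\<delta>2 ^^ Suc k) f * lookup (lowering k B) m)
        = \<delta>2 f * (of_nat (wt m) * lookup B m) + (\<Sum>k\<in>{1..N}. (\<delta>2 ^^ Suc k) f * lookup (lowering k B) m)"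
      by (subst atMost_atLeast0, subst sum.atLeast_Suc_atMost) (simp_all add: lookup_lowering_zero)
    then show ?thesis
      unfolding reduced_der_def lookup_minus lookup_coeff_der lookup_sum lookup_const_mult
      by (simp add: algebra_simps)
  qed
  have L_top: "lookup (lowering k B) m = 0" if "wt m + k > w" for k m
    by (subst lookup_lowering_part) (simp add: B_high[OF that])
  \<comment> \<open>In weight w the term k = 0 of \<open>reduced_der\<close> is - w f' B. It is
    compensated here, so that in top weight only the action of D on the coefficients is
    left.\<close>
  define C where "C = reduced_der f N B + const (of_nat w * \<delta>2 f) * B"
  have C_top: "lookup C m = slope_deriv f (lookup B m)" if "wt m \<ge> w" for m
  proof -
    have "(\<Sum>k\<in>{1..N}. (\<delta>2 ^^ Suc k) f * lookup (lowering k B) m) = 0"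
      using that by (intro sum.neutral) (simp add: L_top)
    moreover have "(of_nat w - of_nat (wt m)) * \<delta>2 f * lookup B m = 0"
    proof (cases "wt m = w")
      case False
      then have "m \<notin> keys B" using that B_le by fastforce
      then show ?thesis by (simp add: in_keys_iff)
    qed simp
    ultimately show ?thesis
      using red[of m] by (simp add: C_def lookup_add lookup_const_mult)
  qed
  have "C = 0"
  proof (rule min[rule_format])
    show "C \<in> V" unfolding C_def by (intro add scale stable B_V)
    show "wt m \<le> w" if "m \<in> keys C" for m
    proof (rule ccontr)
      assume "\<not> wt m \<le> w"
      then have "lookup B m = 0" using B_le[of m] by (auto simp: in_keys_iff)
      then have "lookup C m = 0" using C_top[of m] \<open>\<not> wt m \<le> w\<close> by simp
      then show False using that by (simp add: in_keys_iff)
    qed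
    have "m0 \<in> keys (part w A)" using m0 by (simp add: keys_part)
    moreover have "m0 \<notin> keys (part w C)"
      using m0 C_top[of m0] by (simp add: in_keys_iff lookup_part B_lookup)
    moreover have "keys (part w C) \<subseteq> keys (part w A)"
    proof
      fix m assume "m \<in> keys (part w C)"
      then have m: "wt m = w" "lookup C m \<noteq> 0" by (auto simp: keys_part in_keys_iff)
      then have "lookup B m \<noteq> 0" using C_top[of m] by auto
      then show "m \<in> keys (part w A)" using m by (auto simp: keys_part in_keys_iff B_lookup)
    qed
    ultimately show "keys (part w C) \<subset> keys (part w A)" by blast
  qed
  then have C_lookup: "lookup (reduced_der f N B) m + of_nat w * \<delta>2 f * lookup B m = 0" for m
    using lookup_add[of "reduced_der f N B" _ m] unfolding C_def by (metis lookup_const_mult lookup_zero)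
  have eq: "slope_deriv f (lookup B m) + (of_nat w - of_nat (wt m)) * \<delta>2 f * lookup B m
      = (\<Sum>k\<in>{1..N}. (\<delta>2 ^^ Suc k) f * lookup (lowering k B) m)" for m
    using red[of m] unfolding C_lookup by simp
  define T where "T = part w B"
  have T_der: "slope_deriv f (lookup T m) = 0" for m
    using C_top[of m] \<open>C = 0\<close> by (simp add: T_def lookup_part)
  have LT_der: "slope_deriv f (lookup (lowering k T) m) = 0" for k m
  proof -
    have "coeff_der f T = 0"
      by (rule poly_mapping_eqI) (simp add: lookup_coeff_der T_der)
    then show ?thesis
      using coeff_der_lowering[of f k T] by (metis lowering.zero lookup_coeff_der lookup_zero)
  qed
  have T_cols: "dvars T \<subseteq> ycols N"
    using cols[OF B_V] by (auto simp: T_def dvars_def keys_part)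
  \<comment> \<open>If B has no terms of weight strictly between w - k and w, then only
    \<open>lowering k\<close> of the top part \<open>T\<close> reaches weight w - k.\<close>
  have eq_low: "slope_deriv f (lookup B m) = - (of_nat k * \<delta>2 f * lookup B m)
      + (\<delta>2 ^^ Suc k) f * lookup (lowering k T) m"
    if k: "k \<ge> 1" "wt m + k = w" and low: "\<And>m'. wt m < wt m' \<Longrightarrow> wt m' < w \<Longrightarrow> lookup B m' = 0" for k m
  proof -
    have Lj: "lookup (lowering j B) m = (if j = k then lookup (lowering k T) m else 0)" if "j \<ge> 1" for j
    proof (cases j k rule: linorder_cases)
      case less
      have "part (wt m + j) B = 0"
        by (rule poly_mapping_eqI) (use less k low \<open>j \<ge> 1\<close> in \<open>auto simp: lookup_part\<close>)
      then show ?thesis using less by (subst lookup_lowering_part) simp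
    next
      case equal
      then show ?thesis using k by (subst lookup_lowering_part) (simp add: T_def)
    next
      case greater
      then show ?thesis using k by (simp add: L_top)
    qed
    have "(\<Sum>j\<in>{1..N}. (\<delta>2 ^^ Suc j) f * lookup (lowering j B) m)
        = (\<Sum>j\<in>{1..N}. if j = k then (\<delta>2 ^^ Suc k) f * lookup (lowering k T) m else 0)"
      by (intro sum.cong refl) (simp add: Lj del: funpow.simps)
    also have "\<dots> = (\<delta>2 ^^ Suc k) f * lookup (lowering k T) m"
    proof (cases "k \<le> N")
      case False
      then have "dvars T \<subseteq> ycols k" using T_cols by (auto simp: ycols_def)
      then show ?thesis using False by (simp add: lowering_trivial)
    qed (use k in simp)
    finally show ?thesis
      using eq[of m] k(2)[symmetric] by (simp add: algebra_simps)
  qed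
  \<comment> \<open>A nonzero coefficient would solve the homogeneous equation with exponent k,
    contrary to the exclusion of \<open>slope_sol1\<close>; for N = 0 there is no positive weight at
    all.\<close>
  have no_sol1: "lookup B m = 0"
    if "k \<ge> 1" "wt m + k = w" "slope_deriv f (lookup B m) = - (of_nat k * \<delta>2 f * lookup B m)" for k m
  proof (cases "N = 0")
    case False
    then show ?thesis using that sol1 unfolding slope_sol1_def by (metis less_eq_Suc_le One_nat_def)
  next
    case True
    have "wt n = 0" if "n \<in> keys B" for n
      using cols[OF B_V] that True by (force simp: wt_def dvars_def ycols_def)
    then have "w = 0" using m0 B_keys by auto
    then show ?thesis using that by simp
  qed
  have low_vanish: "lookup B m = 0" if "\<And>j. 1 \<le> j \<Longrightarrow> j \<le> k \<Longrightarrow> lowering j T = 0" "wt m < w" "w \<le> wt m + k" for k m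
    using that(2,3)
  proof (induction "w - wt m" arbitrary: m rule: less_induct)
    case less
    let ?j = "w - wt m"
    have j: "?j \<ge> 1" "wt m + ?j = w" "?j \<le> k" using less.prems by auto
    have "slope_deriv f (lookup B m) = - (of_nat ?j * \<delta>2 f * lookup B m) + (\<delta>2 ^^ Suc ?j) f * lookup (lowering ?j T) m"
      using less.prems by (intro eq_low j less.hyps) auto
    then show ?case
      using that(1)[OF j(1,3)] by (intro no_sol1[OF j(1,2)]) simp
  qed
  \<comment> \<open>Some coefficient g of \<open>lowering k T\<close> is nonzero, and D kills it
    since the coefficients of \<open>T\<close> are killed. Dividing the matching coefficient of B by
    - g gives a solution of the inhomogeneous equation.\<close>
  have normalize: "\<exists>a. slope_deriv f a = - (of_nat k * \<delta>2 f * a) - (\<delta>2 ^^ Suc k) f"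
    if k: "k \<ge> 1" "lowering k T \<noteq> 0" and "\<And>j. 1 \<le> j \<Longrightarrow> j < k \<Longrightarrow> lowering j T = 0" for k
  proof -
    obtain m where m: "lookup (lowering k T) m \<noteq> 0"
      using k(2) by (metis lookup_zero poly_mapping_eqI)
    then obtain n where "n \<in> keys T" "wt m + k = wt n"
      using keys_lowering by (metis in_keys_iff)
    then have wm: "wt m + k = w" by (simp add: T_def keys_part)
    have low: "lookup B m' = 0" if "wt m < wt m'" "wt m' < w" for m'
      by (rule low_vanish[of "k - 1"]) (use that wm \<open>\<And>j. 1 \<le> j \<Longrightarrow> j < k \<Longrightarrow> lowering j T = 0\<close> in auto)
    let ?g = "lookup (lowering k T) m"
    have "slope_deriv f (lookup B m) = - (of_nat k * \<delta>2 f * lookup B m) + (\<delta>2 ^^ Suc k) f * ?g"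
      by (rule eq_low[OF k(1) wm low])
    then have "slope_deriv f (- lookup B m / ?g) = - (of_nat k * \<delta>2 f * (- lookup B m / ?g)) - (\<delta>2 ^^ Suc k) f"
      using m LT_der[of k m]
      by (simp add: derivation_divide[OF slope_deriv_derivation] derivation.minus[OF slope_deriv_derivation]
          field_simps del: funpow.simps)
    then show ?thesis by blast
  qed
  have L1: "lowering 1 T = 0"
  proof (cases "N \<le> 1")
    case True
    then show ?thesis using T_cols by (intro lowering_trivial) (auto simp: ycols_def)
  next
    case False
    show ?thesis
    proof (rule ccontr)
      assume "lowering 1 T \<noteq> 0"
      then have "slope_sol2 f"
        using normalize[of 1] by (simp add: slope_sol2_def)
      then show False using sol2 False by simp
    qed
  qed
  have L2: "lowering 2 T = 0"
  proof (cases "N \<le> 2")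
    case True
    then show ?thesis using T_cols by (intro lowering_trivial) (auto simp: ycols_def)
  next
    case False
    show ?thesis
    proof (rule ccontr)
      assume "lowering 2 T \<noteq> 0"
      then have "slope_sol3 f"
        using normalize[of 2] L1 by (auto simp: slope_sol3_def numeral_2_eq_2 le_Suc_eq less_Suc_eq)
      then show False using sol3 False by simp
    qed
  qed
  have L_all: "lowering k T = 0" if "k \<ge> 1" for k
    by (rule lowering_generated[OF L1 L2 that])
  have "lookup B m = 0" if "wt m < w" for m
    by (rule low_vanish[of w]) (use that L_all in auto)
  then have wt_B: "wt m = w" if "m \<in> keys B" for m
    using B_le[OF that] that by (metis in_keys_iff le_neq_implies_less)
  then have "B = T"
    unfolding T_def by (intro poly_mapping_eqI) (auto simp: lookup_part in_keys_iff)
  show ?thesis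
  proof (rule that[OF B_V])
    show "B \<noteq> 0" using B_keys A(2) by (metis keys_eq_empty)
    show "dvars B \<subseteq> ycols 1"
      unfolding \<open>B = T\<close>
      by (rule lowering_kernel[OF _ L_all]) (use T_cols in \<open>auto simp: ycols_def\<close>)
    show "slope_deriv f (lookup B m) = 0" for m
      using T_der \<open>B = T\<close> by simp
  qed (rule wt_B)
qed

section \<open>Rank and order\<close>

lemma dvar_less_linear: "v = w \<or> dvar_less v w \<or> dvar_less w v"
  by (cases v; cases w) (auto simp: dvar_less_def)

lemma dvar_less_trans: "dvar_less u v \<Longrightarrow> dvar_less v w \<Longrightarrow> dvar_less u w"
  by (auto simp: dvar_less_def)

lemma dvar_less_asym: "dvar_less v w \<Longrightarrow> \<not> dvar_less w v"
  by (auto simp: dvar_less_def)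

lemma leader_greatest:
  assumes "dvars A \<noteq> {}"
  shows "leader A \<in> dvars A" "w \<in> dvars A \<Longrightarrow> w = leader A \<or> dvar_less w (leader A)"
proof -
  have "\<exists>v\<in>V. \<forall>w\<in>V. w = v \<or> dvar_less w v" if "finite V" "V \<noteq> {}" for V
    using that
  proof (induction V rule: finite_ne_induct)
    case (insert x F)
    then obtain v where v: "v \<in> F" "\<forall>w\<in>F. w = v \<or> dvar_less w v" by blast
    show ?case
    proof (cases "dvar_less v x")
      case True
      have "w = x \<or> dvar_less w x" if "w \<in> insert x F" for w
        using that v(2) True dvar_less_trans[of w v x] by auto
      then show ?thesis by (intro bexI[of _ x]) auto
    next
      case False
      have "w = v \<or> dvar_less w v" if "w \<in> insert x F" for w
        using that v(2) False dvar_less_linear[of v x] by auto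
      then show ?thesis using v(1) by (intro bexI[of _ v]) auto
    qed
  qed simp
  from this[OF finite_dvars assms]
  obtain v where v: "v \<in> dvars A" "\<forall>w\<in>dvars A. w = v \<or> dvar_less w v" by (elim bexE)
  have "leader A = v"
    unfolding leader_def
  proof (rule the_equality)
    fix u assume "u \<in> dvars A \<and> (\<forall>w\<in>dvars A. w = u \<or> dvar_less w u)"
    then show "u = v" using v dvar_less_asym[of u v] by metis
  qed (use v in simp)
  then show "leader A \<in> dvars A" "w \<in> dvars A \<Longrightarrow> w = leader A \<or> dvar_less w (leader A)"
    using v by auto
qed

text \<open>Rank is compared through lexicographically ordered quadruples of natural numbers; the
  leading entry 0 or 1 places the elements of K below all others.\<close>

lemma lowest_rank_exists:
  assumes "A \<in> \<Lambda>" "A \<noteq> 0"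
  shows "\<exists>B. lowest_rank_in \<Lambda> B"
proof -
  let ?r = "\<lambda>A. (if dvars A = {} then 0 else 1 :: nat, fst (leader A), snd (leader A), degree_in (leader A) A)"
  let ?R = "inv_image (less_than <*lex*> less_than <*lex*> less_than <*lex*> less_than) ?r"
  have wf: "wf ?R"
    by (intro wf_inv_image wf_lex_prod wf_less_than)
  have "A \<in> {B \<in> \<Lambda>. B \<noteq> 0}" using assms by simp
  with wf have "\<exists>B\<in>{B \<in> \<Lambda>. B \<noteq> 0}. \<forall>C. (C, B) \<in> ?R \<longrightarrow> C \<notin> {B \<in> \<Lambda>. B \<noteq> 0}"
    by (rule wf_eq_minimal[THEN iffD1, rule_format])
  moreover have "(C, B) \<in> ?R" if "rank_less C B" for B C
    using that by (auto simp: rank_less_def dvar_less_def)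
  ultimately show ?thesis
    unfolding lowest_rank_in_def by blast
qed

lemma lowest_rank_some:
  assumes "A \<in> \<Lambda>" "A \<noteq> 0"
  shows "lowest_rank_in \<Lambda> (SOME A. lowest_rank_in \<Lambda> A)"
  using lowest_rank_exists[OF assms] by (rule someI_ex)

lemma dvars_empty_const:
  assumes "dvars A = {}"
  obtains c where "A = const c"
proof -
  have "A = const (lookup A 0)"
  proof (rule poly_mapping_eqI)
    fix m
    show "lookup A m = lookup (const (lookup A 0)) m"
    proof (cases "m \<in> keys A")
      case True
      then have "keys m = {}" using assms by (auto simp: dvars_def)
      then show ?thesis by simp
    next
      case False
      then show ?thesis by (auto simp: in_keys_iff lookup_single when_def)
    qed
  qed
  then show ?thesis using that by blast
qed

lemma dvars_one: "dvars 1 = {}"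
  by (simp add: dvars_def)

lemma vf_dpoly_const_mult:
  "vf_dpoly X1 X2 = const (of_bipoly X1) * var (Suc 0, 0) + const (of_bipoly X2) * var (0, Suc 0)"
  by (simp add: vf_dpoly_def var_def mult_single)

section \<open>The order of an expansion\<close>

context
  fixes X1 X2 :: bipoly and \<Lambda> :: "dpoly set"
  assumes X1: "X1 \<noteq> 0" and \<Lambda>: "differential_ideal \<Lambda>" and hull: "differential_ideal_hull {vf_dpoly X1 X2} \<subset> \<Lambda>"
begin

lemma vf_dpoly_in_expansion: "vf_dpoly X1 X2 \<in> \<Lambda>"
  using hull unfolding differential_ideal_hull_def by blast

lemma slope_in_ideal:
  assumes "differential_ideal I" "vf_dpoly X1 X2 \<in> I"
  shows "var (Suc 0, 0) + const (slope X1 X2) * var (0, Suc 0) \<in> I"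
proof -
  have "const (1 / of_bipoly X1) * vf_dpoly X1 X2 \<in> I"
    by (rule differential_idealD(3)[OF assms])
  moreover have "const (1 / of_bipoly X1) * vf_dpoly X1 X2 = var (Suc 0, 0) + const (slope X1 X2) * var (0, Suc 0)"
    using of_bipoly_nonzero[OF X1]
    by (simp add: vf_dpoly_const_mult distrib_left mult_single slope_def flip: mult.assoc)
  ultimately show ?thesis by simp
qed

lemma differential_ideal_hull: "differential_ideal (differential_ideal_hull S)"
  unfolding differential_ideal_hull_def differential_ideal_def by simp

text \<open>Properness of the inclusion enters here: an element outside the ideal generated by the
  operator cannot reduce to 0 modulo that ideal.\<close>

lemma expansion_reduced_element: "\<exists>N. \<exists>B\<in>\<Lambda>. B \<noteq> 0 \<and> dvars B \<subseteq> ycols N"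
proof -
  let ?H = "differential_ideal_hull {vf_dpoly X1 X2}"
  obtain A where A: "A \<in> \<Lambda>" "A \<notin> ?H" using hull by blast
  have "vf_dpoly X1 X2 \<in> ?H" unfolding differential_ideal_hull_def by blast
  from reduce_mod_ideal[OF differential_ideal_hull slope_in_ideal[OF differential_ideal_hull this], of A]
  obtain N B where B: "dvars B \<subseteq> ycols N" "A - B \<in> ?H" by auto
  have "B \<in> \<Lambda>"
    using differential_idealD(7)[OF \<Lambda> A(1), of "A - B"] B(2) hull by auto
  moreover have "B \<noteq> 0" using A(2) B(2) by auto
  ultimately show ?thesis using B(1) by blast
qed

text \<open>The leader of a lowest-rank element cannot lie above that of a reduced element, so it is
  free of \<delta>1. As \<delta>1 dominates the ranking, no symbol below such a leader involves
  \<delta>1. The unit ideal is excluded because 1 has lower rank.\<close>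

lemma expansion_ord_finite:
  assumes r: "expansion_ord \<Lambda> = enat r"
  shows "\<Lambda> \<noteq> UNIV" "\<exists>A\<in>\<Lambda>. A \<noteq> 0 \<and> dvars A \<subseteq> ycols r"
proof -
  obtain N B where B: "B \<in> \<Lambda>" "B \<noteq> 0" "dvars B \<subseteq> ycols N"
    using expansion_reduced_element by blast
  define A where "A = (SOME A. lowest_rank_in \<Lambda> A)"
  have A: "lowest_rank_in \<Lambda> A"
    unfolding A_def by (rule lowest_rank_some[OF B(1,2)])
  have ne: "dvars A \<noteq> {}" and r: "snd (leader A) = r"
    using r by (auto simp: expansion_ord_def A_def[symmetric] Let_def split: if_splits)
  have not_less: "\<not> rank_less C A" if "C \<in> \<Lambda>" "C \<noteq> 0" for C
    using A that by (simp add: lowest_rank_in_def)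
  show "\<Lambda> \<noteq> UNIV"
    using not_less[of 1] ne by (auto simp: rank_less_def dvars_one)
  have "dvars B \<noteq> {}" and le: "\<not> dvar_less (leader B) (leader A)"
    using not_less[OF B(1,2)] ne by (auto simp: rank_less_def)
  then have "fst (leader B) = 0"
    using leader_greatest(1)[of B] B(3) by (auto simp: ycols_def)
  then have "fst (leader A) = 0"
    using le by (simp add: dvar_less_def)
  have "dvars A \<subseteq> ycols r"
  proof (intro subsetI)
    fix w assume "w \<in> dvars A"
    with leader_greatest(2)[OF ne this] \<open>fst (leader A) = 0\<close> r show "w \<in> ycols r"
      by (auto simp: ycols_def dvar_less_def mem_Times_iff)
  qed
  then show "\<exists>A\<in>\<Lambda>. A \<noteq> 0 \<and> dvars A \<subseteq> ycols r"
    using A by (auto simp: lowest_rank_in_def)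
qed

text \<open>The elements of \<Lambda> of order at most N without \<delta>1 form a K-subspace, stable
  under \<open>reduced_der\<close> because \<Lambda> is a differential ideal containing the
  operator.\<close>

lemma expansion_normal_form:
  assumes A: "A \<in> \<Lambda>" "A \<noteq> 0" "dvars A \<subseteq> ycols N"
    and sols: "N = 0 \<or> \<not> slope_sol1 (slope X1 X2)" "N \<le> 1 \<or> \<not> slope_sol2 (slope X1 X2)"
      "N \<le> 2 \<or> \<not> slope_sol3 (slope X1 X2)"
  obtains B w where "B \<in> \<Lambda>" "B \<noteq> 0" "dvars B \<subseteq> ycols 1" "\<And>m. m \<in> keys B \<Longrightarrow> wt m = w"
    "\<And>m. slope_deriv (slope X1 X2) (lookup B m) = 0"
proof -
  let ?V = "{A \<in> \<Lambda>. dvars A \<subseteq> ycols N}"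
  note D = differential_idealD[OF \<Lambda>]
  have base: "var (Suc 0, 0) + const (slope X1 X2) * var (0, Suc 0) \<in> \<Lambda>"
    by (rule slope_in_ideal[OF \<Lambda> vf_dpoly_in_expansion])
  show ?thesis
  proof (rule stable_space_normal_form[of ?V N "slope X1 X2"])
    show "\<exists>A\<in>?V. A \<noteq> 0" using A by blast
    show "B + C \<in> ?V" if "B \<in> ?V" "C \<in> ?V" for B C
      using that D(2) dvars_add[of B C] by blast
    show "const c * B \<in> ?V" if "B \<in> ?V" for c B
      using that D(3) dvars_const_mult by simp
    show "reduced_der (slope X1 X2) N B \<in> ?V" if "B \<in> ?V" for B
      using that reduced_der_in_ideal[OF \<Lambda> base] dvars_reduced_der by simp
  qed (use sols that in blast)+
qed

end

lemma differential_ideal_UNIV: "differential_ideal UNIV"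
  by (simp add: differential_ideal_def)

lemma lookup_mult_zero:
  fixes A B :: dpoly
  assumes "lookup B 0 = 0"
  shows "lookup (A * B) 0 = 0"
proof (rule ccontr)
  assume "lookup (A * B) 0 \<noteq> 0"
  then have "0 \<in> keys (A * B)" by (simp add: in_keys_iff)
  from subsetD[OF keys_mult this] obtain a b where b: "b \<in> keys B" "0 = a + b" by blast
  have "keys b \<subseteq> keys (a + b)" by (simp add: keys_monom_add)
  then have "keys b = {}" using b(2) by simp
  then have "b = 0" by simp
  then show False using assms b(1) by (simp add: in_keys_iff)
qed

lemma lookup_gder_zero:
  assumes "d 0 = 0" "\<And>v. lookup (t v) 0 = 0"
  shows "lookup (gder d t A) 0 = d (lookup A 0)"
proof -
  have "lookup (gterm d t m c) 0 = (if m = 0 then d c else 0)" for m c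
    by (simp add: gterm_def lookup_add lookup_sum lookup_mult_zero assms(2) lookup_single when_def)
  then show ?thesis
    using assms(1) by (simp add: gder_def lookup_sum in_keys_iff)
qed

text \<open>The differential polynomials without constant term form a proper differential ideal
  containing the operator. Hence the unit ideal is an expansion and the minimum defining
  \<open>vf_ord\<close> is attained.\<close>

lemma hull_not_UNIV: "differential_ideal_hull {vf_dpoly X1 X2} \<noteq> UNIV"
proof -
  let ?I = "{A :: dpoly. lookup A 0 = 0}"
  have var: "lookup (var v) 0 = 0" for v
  proof -
    have "single v (1 :: nat) \<noteq> 0" by (metis lookup_single_eq lookup_zero one_neq_zero)
    then show ?thesis by (simp add: var_def lookup_single when_def)
  qed
  have "differential_ideal ?I"
    unfolding differential_ideal_def
    by (auto simp: lookup_add lookup_mult_zero dpoly_\<delta>1_gder dpoly_\<delta>2_gder lookup_gder_zero var)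
  moreover have "vf_dpoly X1 X2 \<in> ?I"
    by (simp add: vf_dpoly_const_mult lookup_add lookup_mult_zero var)
  ultimately have "differential_ideal_hull {vf_dpoly X1 X2} \<subseteq> ?I"
    unfolding differential_ideal_hull_def by blast
  moreover have "1 \<notin> ?I" by simp
  ultimately show ?thesis by blast
qed

lemma nontrivial_expansion_UNIV: "nontrivial_expansion X1 X2 UNIV"
  using hull_not_UNIV by (auto simp: nontrivial_expansion_def expansion_def differential_ideal_UNIV)

text \<open>One explicit element in \<delta>2-derivatives bounds the leader of every lowest-rank
  element; the absence of nonzero constants excludes the value \<infinity>.\<close>

lemma expansion_ord_le:
  assumes G: "G \<in> \<Lambda>" "G \<noteq> 0" "dvars G \<subseteq> ycols r" and const: "\<And>c. c \<noteq> 0 \<Longrightarrow> const c \<notin> \<Lambda>"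
  shows "expansion_ord \<Lambda> \<le> enat r"
proof -
  define A where "A = (SOME A. lowest_rank_in \<Lambda> A)"
  have A: "lowest_rank_in \<Lambda> A"
    unfolding A_def by (rule lowest_rank_some[OF G(1,2)])
  have ne: "dvars B \<noteq> {}" if "B \<in> \<Lambda>" "B \<noteq> 0" for B
    using const that by (metis dvars_empty_const single_zero)
  have "\<not> rank_less G A" "dvars A \<noteq> {}"
    using A G ne by (auto simp: lowest_rank_in_def)
  then have "\<not> dvar_less (leader G) (leader A)"
    by (auto simp: rank_less_def)
  moreover have "leader G \<in> ycols r"
    using leader_greatest(1)[OF ne[OF G(1,2)]] G(3) by blast
  ultimately have "snd (leader A) \<le> r"
    by (auto simp: dvar_less_def ycols_def)
  then show ?thesis
    using \<open>dvars A \<noteq> {}\<close> by (simp add: expansion_ord_def A_def[symmetric] Let_def)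
qed

lemma vf_ord_attained: "\<exists>\<Lambda>. nontrivial_expansion X1 X2 \<Lambda> \<and> expansion_ord \<Lambda> = vf_ord X1 X2"
  unfolding vf_ord_def by (rule LeastI) (use nontrivial_expansion_UNIV in blast)

lemma vf_ord_le: "nontrivial_expansion X1 X2 \<Lambda> \<Longrightarrow> vf_ord X1 X2 \<le> expansion_ord \<Lambda>"
  unfolding vf_ord_def by (rule Least_le) blast

section \<open>Evaluation at holomorphic functions\<close>

lemma bipoly_eval_0 [simp]: "bipoly_eval 0 z = 0"
  and bipoly_eval_1 [simp]: "bipoly_eval 1 z = 1"
  and bipoly_eval_add: "bipoly_eval (p + q) z = bipoly_eval p z + bipoly_eval q z"
  and bipoly_eval_diff: "bipoly_eval (p - q) z = bipoly_eval p z - bipoly_eval q z"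
  and bipoly_eval_minus: "bipoly_eval (- p) z = - bipoly_eval p z"
  and bipoly_eval_mult: "bipoly_eval (p * q) z = bipoly_eval p z * bipoly_eval q z"
  and bipoly_eval_const: "bipoly_eval [:[:c:]:] z = c"
  by (simp_all add: bipoly_eval_def)

lemma bipoly_eval_pCons: "bipoly_eval (pCons c p) z = poly c (fst z) + snd z * bipoly_eval p z"
  by (simp add: bipoly_eval_def)

lemma bipoly_eval_hol2:
  "hol2 (bipoly_eval p) UNIV \<and> (\<forall>z. pd1 (bipoly_eval p) z = bipoly_eval (map_poly pderiv p) z \<and>
     pd2 (bipoly_eval p) z = bipoly_eval (pderiv p) z)"
proof (induction p)
  case 0
  have "bipoly_eval 0 = (\<lambda>z. 0)" by (simp add: fun_eq_iff)
  then show ?case by (simp add: pd1_def pd2_def)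
next
  case (pCons c p)
  have eq: "bipoly_eval (pCons c p) = (\<lambda>z. poly c (fst z) + snd z * bipoly_eval p z)"
    by (simp add: fun_eq_iff bipoly_eval_pCons)
  have c: "hol2 (\<lambda>z. poly c (fst z)) UNIV"
    by (rule hol2_compose[OF hol2_fst, of "poly c" UNIV]) (auto intro: holomorphic_intros)
  have p: "hol2 (bipoly_eval p) UNIV" using pCons by blast
  have c1: "pd1 (\<lambda>z. poly c (fst z)) z = poly (pderiv c) (fst z)" for z
    by (rule pd_eqI) (simp add: poly_DERIV)
  have c2: "pd2 (\<lambda>z. poly c (fst z)) z = 0" for z
    by (rule pd_eqI) simp
  have s: "pd1 snd z = 0" "pd2 snd z = 1" for z
    by (rule pd_eqI; simp)+
  show ?case
    unfolding eq
    using pCons.IH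
    by (auto intro!: hol2_add hol2_mult c p
      simp: pd_add[OF c hol2_mult[OF hol2_snd p]] pd_mult[OF hol2_snd p] c1 c2 s map_poly_pCons
        bipoly_eval_pCons pderiv_pCons bipoly_eval_add)
qed

lemma hol2_bipoly_eval: "hol2 (bipoly_eval p) S"
  using bipoly_eval_hol2 hol2_subset by blast

lemma continuous_on_bipoly_eval: "continuous_on S (bipoly_eval p)"
  by (rule hol2_D(1)[OF hol2_bipoly_eval])

lemma open_bipoly_nonzero: "open {z. bipoly_eval p z \<noteq> 0}"
  by (intro open_Collect_neq continuous_on_bipoly_eval continuous_on_const)

text \<open>In a box inside S, choose x1 off the finitely many roots of one nonzero coefficient, and
  x2 off the roots of the resulting polynomial.\<close>

lemma bipoly_nonzero_dense:
  assumes "p \<noteq> 0" "open S" "S \<noteq> {}"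
  obtains z where "z \<in> S" "bipoly_eval p z \<noteq> 0"
proof -
  obtain s where "s \<in> S" using assms by blast
  then obtain r where r: "r > 0" "cball (fst s) r \<times> cball (snd s) r \<subseteq> S"
    using open_contains_cball_box[OF assms(2)] by metis
  have inf: "infinite (ball c r)" for c :: complex
    using r(1) uncountable_ball countable_finite by blast
  obtain k where k: "coeff p k \<noteq> 0" using assms(1) by (metis leading_coeff_0_iff)
  obtain x where x: "x \<in> ball (fst s) r" "poly (coeff p k) x \<noteq> 0"
    using inf finite_subset[OF _ poly_roots_finite[OF k]] by blast
  define q where "q = map_poly (\<lambda>c. poly c x) p"
  have "coeff q k = poly (coeff p k) x"
    by (simp add: q_def coeff_map_poly)
  then have "q \<noteq> 0" using x(2) by auto
  then obtain y where y: "y \<in> ball (snd s) r" "poly q y \<noteq> 0"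
    using inf finite_subset[OF _ poly_roots_finite] by blast
  have "poly (map_poly (\<lambda>c. poly c x) p) y = bipoly_eval p (x, y)"
    by (induction p) (simp_all add: map_poly_pCons bipoly_eval_pCons)
  then have "bipoly_eval p (x, y) \<noteq> 0" using y(2) by (simp add: q_def)
  moreover have "(x, y) \<in> S" using x(1) y(1) by (intro subsetD[OF r(2)]) auto
  ultimately show ?thesis using that by blast
qed

lemma ratfun_eval_Fract:
  assumes "bipoly_eval d z \<noteq> 0"
  shows "regular_at (Fract n d) z" "ratfun_eval (Fract n d) z = bipoly_eval n z / bipoly_eval d z"
proof -
  show "regular_at (Fract n d) z" unfolding regular_at_def using assms by blast
  have d: "d \<noteq> 0" using assms by auto
  show "ratfun_eval (Fract n d) z = bipoly_eval n z / bipoly_eval d z"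
    unfolding ratfun_eval_def
  proof (rule the_equality)
    fix c assume "\<exists>n' d'. Fract n d = Fract n' d' \<and> bipoly_eval d' z \<noteq> 0 \<and> c = bipoly_eval n' z / bipoly_eval d' z"
    then obtain n' d' where *: "Fract n d = Fract n' d'" "bipoly_eval d' z \<noteq> 0" "c = bipoly_eval n' z / bipoly_eval d' z"
      by blast
    then have "d' \<noteq> 0" by auto
    then have "n * d' = n' * d" using * d by (simp add: eq_fract)
    then have "bipoly_eval n z * bipoly_eval d' z = bipoly_eval n' z * bipoly_eval d z"
      by (metis bipoly_eval_mult)
    then show "c = bipoly_eval n z / bipoly_eval d z"
      using * assms by (simp add: frac_eq_eq)
  qed (use assms in blast)
qed

lemma regular_atE:
  assumes "regular_at a z"
  obtains n d where "a = Fract n d" "bipoly_eval d z \<noteq> 0" "d \<noteq> 0"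
proof -
  obtain n d where *: "a = Fract n d" "bipoly_eval d z \<noteq> 0"
    using assms unfolding regular_at_def by blast
  moreover from this have "d \<noteq> 0" by auto
  ultimately show ?thesis using that by blast
qed

lemma ratfun_eval_of_bipoly [simp]:
  "regular_at (of_bipoly p) z" "ratfun_eval (of_bipoly p) z = bipoly_eval p z"
  using ratfun_eval_Fract[of 1 z p] by (simp_all add: of_bipoly_def)

lemma ratfun_eval_0 [simp]: "regular_at 0 z" "ratfun_eval 0 z = 0"
  using ratfun_eval_of_bipoly[of 0 z] by (simp_all add: of_bipoly_def Zero_fract_def)

lemma ratfun_eval_1 [simp]: "regular_at 1 z" "ratfun_eval 1 z = 1"
  using ratfun_eval_of_bipoly[of 1 z] by (simp_all add: of_bipoly_def One_fract_def)

lemma ratfun_eval_add: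
  assumes "regular_at a z" "regular_at b z"
  shows "regular_at (a + b) z" "ratfun_eval (a + b) z = ratfun_eval a z + ratfun_eval b z"
proof -
  obtain n d n' d' where *: "a = Fract n d" "bipoly_eval d z \<noteq> 0" "d \<noteq> 0"
    "b = Fract n' d'" "bipoly_eval d' z \<noteq> 0" "d' \<noteq> 0"
    using assms by (metis regular_atE)
  then show "regular_at (a + b) z" "ratfun_eval (a + b) z = ratfun_eval a z + ratfun_eval b z"
    by (simp_all add: ratfun_eval_Fract bipoly_eval_mult bipoly_eval_add field_simps)
qed

lemma ratfun_eval_mult:
  assumes "regular_at a z" "regular_at b z"
  shows "regular_at (a * b) z" "ratfun_eval (a * b) z = ratfun_eval a z * ratfun_eval b z"
proof -
  obtain n d n' d' where *: "a = Fract n d" "bipoly_eval d z \<noteq> 0" "d \<noteq> 0"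
    "b = Fract n' d'" "bipoly_eval d' z \<noteq> 0" "d' \<noteq> 0"
    using assms by (metis regular_atE)
  then show "regular_at (a * b) z" "ratfun_eval (a * b) z = ratfun_eval a z * ratfun_eval b z"
    by (simp_all add: ratfun_eval_Fract bipoly_eval_mult)
qed

lemma ratfun_eval_minus:
  assumes "regular_at a z"
  shows "regular_at (- a) z" "ratfun_eval (- a) z = - ratfun_eval a z"
proof -
  obtain n d where *: "a = Fract n d" "bipoly_eval d z \<noteq> 0" "d \<noteq> 0"
    using assms by (metis regular_atE)
  then show "regular_at (- a) z" "ratfun_eval (- a) z = - ratfun_eval a z"
    by (simp_all add: ratfun_eval_Fract bipoly_eval_minus)
qed

lemma ratfun_eval_diff:
  assumes "regular_at a z" "regular_at b z"
  shows "regular_at (a - b) z" "ratfun_eval (a - b) z = ratfun_eval a z - ratfun_eval b z"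
  using ratfun_eval_add[OF assms(1) ratfun_eval_minus(1)[OF assms(2)]] ratfun_eval_minus[OF assms(2)]
  by simp_all

lemma ratfun_eval_divide_bipoly:
  assumes "regular_at a z" "bipoly_eval p z \<noteq> 0"
  shows "regular_at (a / of_bipoly p) z"
    "ratfun_eval (a / of_bipoly p) z = ratfun_eval a z / bipoly_eval p z"
proof -
  obtain n d where *: "a = Fract n d" "bipoly_eval d z \<noteq> 0" "d \<noteq> 0"
    using assms by (metis regular_atE)
  moreover have "p \<noteq> 0" using assms by auto
  ultimately show "regular_at (a / of_bipoly p) z"
    "ratfun_eval (a / of_bipoly p) z = ratfun_eval a z / bipoly_eval p z"
    using assms(2) by (simp_all add: of_bipoly_def ratfun_eval_Fract bipoly_eval_mult)
qed

lemma ratfun_eval_of_nat [simp]: "regular_at (of_nat n) z" "ratfun_eval (of_nat n) z = of_nat n"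
  by (induction n) (auto simp: ratfun_eval_add)

lemma ratfun_eval_numeral [simp]: "regular_at (numeral n) z" "ratfun_eval (numeral n) z = numeral n"
  using ratfun_eval_of_nat[of "numeral n" z] by simp_all

lemma ratfun_eval_of_int [simp]: "regular_at (of_int n) z" "ratfun_eval (of_int n) z = of_int n"
  by (cases n; simp add: ratfun_eval_minus ratfun_eval_diff)+

lemma regular_at_open:
  assumes "regular_at a z"
  obtains U n d where "open U" "z \<in> U" "a = Fract n d" "\<forall>w\<in>U. bipoly_eval d w \<noteq> 0"
proof -
  obtain n d where "a = Fract n d" "bipoly_eval d z \<noteq> 0" "d \<noteq> 0"
    using regular_atE[OF assms] .
  then show ?thesis using that[of "{w. bipoly_eval d w \<noteq> 0}"] open_bipoly_nonzero by simp
qed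

text \<open>One representative n/d serves on a whole neighbourhood of a regular point, so the formal
  derivations become partial derivatives by the quotient rule.\<close>

lemma ratfun_eval_nbhd:
  assumes "regular_at a z"
  shows "\<exists>U. open U \<and> z \<in> U \<and> hol2 (ratfun_eval a) U"
    and "regular_at (\<delta>1 a) z" "pd1 (ratfun_eval a) z = ratfun_eval (\<delta>1 a) z"
    and "regular_at (\<delta>2 a) z" "pd2 (ratfun_eval a) z = ratfun_eval (\<delta>2 a) z"
proof -
  obtain U n d where U: "open U" "z \<in> U" and a: "a = Fract n d" and "\<forall>w\<in>U. bipoly_eval d w \<noteq> 0"
    using regular_at_open[OF assms] .
  then have nz: "bipoly_eval d w \<noteq> 0" if "w \<in> U" for w using that by blast
  have d: "d \<noteq> 0" using nz[OF U(2)] by auto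
  have ev: "bipoly_eval n w / bipoly_eval d w = ratfun_eval a w" if "w \<in> U" for w
    using ratfun_eval_Fract[OF nz[OF that]] a by simp
  have hol: "hol2 (\<lambda>w. bipoly_eval n w / bipoly_eval d w) U"
    by (intro hol2_divide hol2_bipoly_eval nz)
  have "hol2 (ratfun_eval a) U"
    by (rule hol2_cong[OF U(1) ev hol])
  then show "\<exists>U. open U \<and> z \<in> U \<and> hol2 (ratfun_eval a) U" using U by blast
  note h = hol2_D(2,3)[OF hol2_bipoly_eval UNIV_I]
  have dd: "bipoly_eval (d * d) z \<noteq> 0" using nz[OF U(2)] by (simp add: bipoly_eval_mult)
  show "regular_at (\<delta>1 a) z" "regular_at (\<delta>2 a) z"
    using ratfun_eval_Fract(1)[OF dd] d by (simp_all add: a \<delta>1_Fract \<delta>2_Fract)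
  have "pd1 (ratfun_eval a) z = pd1 (\<lambda>w. bipoly_eval n w / bipoly_eval d w) z"
    by (rule pd_cong_open(1)[OF U, symmetric]) (rule ev)
  also have "\<dots> = (bipoly_eval (map_poly pderiv n) z * bipoly_eval d z
      - bipoly_eval n z * bipoly_eval (map_poly pderiv d) z) / (bipoly_eval d z * bipoly_eval d z)"
  proof (rule pd_eqI)
    show "((\<lambda>w. bipoly_eval n (w, snd z) / bipoly_eval d (w, snd z)) has_field_derivative
        (bipoly_eval (map_poly pderiv n) z * bipoly_eval d z
          - bipoly_eval n z * bipoly_eval (map_poly pderiv d) z) / (bipoly_eval d z * bipoly_eval d z)) (at (fst z))"
      using DERIV_divide[OF h(1)[of n z] h(1)[of d z]] nz[OF U(2)] bipoly_eval_hol2 by simp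
  qed
  also have "\<dots> = ratfun_eval (\<delta>1 a) z"
    using ratfun_eval_Fract(2)[OF dd] d by (simp add: a \<delta>1_Fract bipoly_eval_mult bipoly_eval_diff)
  finally show "pd1 (ratfun_eval a) z = ratfun_eval (\<delta>1 a) z" .
  have "pd2 (ratfun_eval a) z = pd2 (\<lambda>w. bipoly_eval n w / bipoly_eval d w) z"
    by (rule pd_cong_open(2)[OF U, symmetric]) (rule ev)
  also have "\<dots> = (bipoly_eval (pderiv n) z * bipoly_eval d z
      - bipoly_eval n z * bipoly_eval (pderiv d) z) / (bipoly_eval d z * bipoly_eval d z)"
  proof (rule pd_eqI)
    show "((\<lambda>w. bipoly_eval n (fst z, w) / bipoly_eval d (fst z, w)) has_field_derivative
        (bipoly_eval (pderiv n) z * bipoly_eval d z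
          - bipoly_eval n z * bipoly_eval (pderiv d) z) / (bipoly_eval d z * bipoly_eval d z)) (at (snd z))"
      using DERIV_divide[OF h(2)[of n z] h(2)[of d z]] nz[OF U(2)] bipoly_eval_hol2 by simp
  qed
  also have "\<dots> = ratfun_eval (\<delta>2 a) z"
    using ratfun_eval_Fract(2)[OF dd] d by (simp add: a \<delta>2_Fract bipoly_eval_mult bipoly_eval_diff)
  finally show "pd2 (ratfun_eval a) z = ratfun_eval (\<delta>2 a) z" .
qed

lemma hol2_local:
  assumes "\<And>z. z \<in> S \<Longrightarrow> \<exists>U. open U \<and> z \<in> U \<and> hol2 f U"
  shows "hol2 f S"
  unfolding hol2_def
proof (intro conjI ballI continuous_at_imp_continuous_on)
  fix z assume "z \<in> S"
  then obtain U where "open U" "z \<in> U" and U: "hol2 f U" using assms by blast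
  then show "isCont f z"
    using hol2_D(1)[OF U] continuous_on_eq_continuous_at by blast
  show "(\<lambda>w. f (w, snd z)) field_differentiable at (fst z)"
    "(\<lambda>w. f (fst z, w)) field_differentiable at (snd z)"
    using U \<open>z \<in> U\<close> by (auto simp: hol2_def)
qed

lemma hol2_ratfun_eval: "(\<And>z. z \<in> S \<Longrightarrow> regular_at a z) \<Longrightarrow> hol2 (ratfun_eval a) S"
  by (rule hol2_local) (rule ratfun_eval_nbhd(1))

lemma open_regular: "open {z. regular_at a z}"
proof (subst open_subopen, intro ballI)
  fix z assume "z \<in> {z. regular_at a z}"
  then have "regular_at a z" by simp
  from regular_at_open[OF this]
  obtain U n d where "open U" "z \<in> U" "a = Fract n d" "\<forall>w\<in>U. bipoly_eval d w \<noteq> 0" .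
  then show "\<exists>T. open T \<and> z \<in> T \<and> T \<subseteq> {z. regular_at a z}"
    using ratfun_eval_Fract(1) by blast
qed

text \<open>A common denominator of the given rational functions serves as q.\<close>

lemma regular_generic:
  assumes "finite C"
  shows "\<exists>q. q \<noteq> 0 \<and> (\<forall>z. bipoly_eval q z \<noteq> 0 \<longrightarrow> (\<forall>a\<in>C. regular_at a z))"
  using assms
proof (induction C rule: finite_induct)
  case empty
  show ?case by (intro exI[of _ 1]) simp
next
  case (insert a C)
  then obtain q where q: "q \<noteq> 0" "\<And>z. bipoly_eval q z \<noteq> 0 \<Longrightarrow> \<forall>a\<in>C. regular_at a z" by blast
  obtain n d where a: "a = Fract n d" "d \<noteq> 0" by (metis Fract_cases)
  show ?case
    using q a ratfun_eval_Fract(1) by (intro exI[of _ "q * d"]) (simp add: bipoly_eval_mult)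
qed

lemma ratfun_nonzero_point:
  assumes "a \<noteq> 0" "open S" "S \<noteq> {}"
  obtains z where "z \<in> S" "regular_at a z" "ratfun_eval a z \<noteq> 0"
proof -
  obtain n d where a: "a = Fract n d" "d \<noteq> 0" by (metis Fract_cases)
  then have "n * d \<noteq> 0" using assms(1) by (auto simp: Zero_fract_def eq_fract)
  then obtain z where "z \<in> S" "bipoly_eval (n * d) z \<noteq> 0"
    using bipoly_nonzero_dense[OF _ assms(2,3)] by metis
  then show ?thesis
    using that a ratfun_eval_Fract[of d z n] by (simp add: bipoly_eval_mult)
qed

section \<open>Substitution of functions into differential polynomials\<close>

definition jet :: "(complex \<times> complex \<Rightarrow> complex) \<Rightarrow> dvar \<Rightarrow> complex \<times> complex \<Rightarrow> complex" where
  "jet u v = (pd1 ^^ fst v) ((pd2 ^^ snd v) u)"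

definition mon_eval :: "(complex \<times> complex \<Rightarrow> complex) \<Rightarrow> complex \<times> complex \<Rightarrow> monom \<Rightarrow> complex" where
  "mon_eval u z m = (\<Prod>v\<in>keys m. jet u v z ^ lookup m v)"

lemma dpoly_apply_eq: "dpoly_apply A u z = (\<Sum>m\<in>keys A. ratfun_eval (lookup A m) z * mon_eval u z m)"
  by (simp add: dpoly_apply_def mon_eval_def jet_def)

lemma not_singular_iff: "z \<notin> dpoly_singular A \<longleftrightarrow> (\<forall>m. regular_at (lookup A m) z)"
  unfolding dpoly_singular_def by (auto simp: in_keys_iff)

lemma mon_eval_superset:
  "finite V \<Longrightarrow> keys m \<subseteq> V \<Longrightarrow> mon_eval u z m = (\<Prod>v\<in>V. jet u v z ^ lookup m v)"
  unfolding mon_eval_def by (intro prod.mono_neutral_left) (auto simp: in_keys_iff)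

lemma mon_eval_add: "mon_eval u z (m + n) = mon_eval u z m * mon_eval u z n"
proof -
  have V: "finite (keys m \<union> keys n)" by simp
  show ?thesis
    by (subst (1 2 3) mon_eval_superset[OF V])
      (auto simp: keys_monom_add lookup_add power_add prod.distrib)
qed

lemma dpoly_apply_superset:
  "finite M \<Longrightarrow> keys A \<subseteq> M \<Longrightarrow> dpoly_apply A u z = (\<Sum>m\<in>M. ratfun_eval (lookup A m) z * mon_eval u z m)"
  unfolding dpoly_apply_eq by (intro sum.mono_neutral_left) (auto simp: in_keys_iff)

lemma dpoly_apply_add:
  assumes "z \<notin> dpoly_singular A" "z \<notin> dpoly_singular B"
  shows "z \<notin> dpoly_singular (A + B)" "dpoly_apply (A + B) u z = dpoly_apply A u z + dpoly_apply B u z"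
proof -
  have reg: "regular_at (lookup A m) z" "regular_at (lookup B m) z" for m
    using assms by (auto simp: not_singular_iff)
  show "z \<notin> dpoly_singular (A + B)"
    using reg by (simp add: not_singular_iff lookup_add ratfun_eval_add)
  have M: "finite (keys A \<union> keys B)" by simp
  show "dpoly_apply (A + B) u z = dpoly_apply A u z + dpoly_apply B u z"
    by (subst (1 2 3) dpoly_apply_superset[OF M])
      (use keys_add[of A B] reg in \<open>auto simp: lookup_add ratfun_eval_add sum.distrib distrib_right\<close>)
qed

lemma dpoly_apply_single:
  assumes "regular_at c z"
  shows "z \<notin> dpoly_singular (single m c)" "dpoly_apply (single m c) u z = ratfun_eval c z * mon_eval u z m"
  using assms by (auto simp: not_singular_iff lookup_single when_def dpoly_apply_eq)

text \<open>In contrast to \<open>poly_mapping_induct\<close>, the single terms carry the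
  coefficients of A itself, so that properties of these, such as regularity at a point, remain
  available.\<close>

lemma poly_mapping_induct_lookup [case_names zero single add]:
  fixes A :: "'a \<Rightarrow>\<^sub>0 'b::comm_monoid_add"
  assumes "P 0" "\<And>m. P (single m (lookup A m))" "\<And>B C. P B \<Longrightarrow> P C \<Longrightarrow> P (B + C)"
  shows "P A"
proof -
  have "P (\<Sum>m\<in>M. single m (lookup A m))" if "finite M" for M
    using that by (induction M rule: finite_induct) (auto intro: assms)
  from this[of "keys A"] show ?thesis
    using poly_mapping_sum_single[of A] by simp
qed

lemma dpoly_apply_0 [simp]: "z \<notin> dpoly_singular 0" "dpoly_apply 0 u z = 0"
  by (simp_all add: dpoly_apply_eq dpoly_singular_def)

lemma dpoly_apply_mult:
  assumes A: "z \<notin> dpoly_singular A" and B: "z \<notin> dpoly_singular B"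
  shows "z \<notin> dpoly_singular (A * B) \<and> dpoly_apply (A * B) u z = dpoly_apply A u z * dpoly_apply B u z"
proof -
  have right: "z \<notin> dpoly_singular (A * single n c) \<and>
      dpoly_apply (A * single n c) u z = dpoly_apply A u z * dpoly_apply (single n c) u z"
    if c: "regular_at c z" for n c
  proof -
    \<comment> \<open>Regularity is part of the induction because the additive step needs it for
      both summands.\<close>
    have "z \<notin> dpoly_singular A \<and> z \<notin> dpoly_singular (A * single n c) \<and>
        dpoly_apply (A * single n c) u z = dpoly_apply A u z * dpoly_apply (single n c) u z"
    proof (induction A rule: poly_mapping_induct_lookup)
      case (single m)
      have "regular_at (lookup A m) z" using A by (simp add: not_singular_iff)
      then show ?case using c
        by (simp add: mult_single dpoly_apply_single ratfun_eval_mult mon_eval_add)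
    qed (auto simp: distrib_right dpoly_apply_add)
    then show ?thesis by blast
  qed
  have "z \<notin> dpoly_singular B \<and> z \<notin> dpoly_singular (A * B) \<and>
      dpoly_apply (A * B) u z = dpoly_apply A u z * dpoly_apply B u z"
  proof (induction B rule: poly_mapping_induct_lookup)
    case (single m)
    have reg: "regular_at (lookup B m) z" using B by (simp add: not_singular_iff)
    show ?case using right[OF reg] dpoly_apply_single(1)[OF reg] by blast
  qed (auto simp: distrib_left dpoly_apply_add)
  then show ?thesis by blast
qed

lemma dpoly_apply_const:
  assumes "regular_at c z"
  shows "z \<notin> dpoly_singular (const c)" "dpoly_apply (const c) u z = ratfun_eval c z"
  using dpoly_apply_single[OF assms] by (auto simp: mon_eval_def)

lemma dpoly_apply_var: "z \<notin> dpoly_singular (var v)" "dpoly_apply (var v) u z = jet u v z"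
  unfolding var_def using dpoly_apply_single[of 1 z "single v 1"] by (auto simp: mon_eval_def)

lemma pd2_pd1_funpow:
  assumes "hol2 g S" "open S" "z \<in> S"
  shows "pd2 ((pd1 ^^ i) g) z = (pd1 ^^ i) (pd2 g) z"
  using assms(3)
proof (induction i arbitrary: z)
  case (Suc i)
  have "pd2 ((pd1 ^^ Suc i) g) z = pd1 (pd2 ((pd1 ^^ i) g)) z"
    using pd2_pd1[OF hol2_pd_funpow[OF assms(1,2), of i 0] assms(2) Suc.prems] by simp
  also have "\<dots> = pd1 ((pd1 ^^ i) (pd2 g)) z"
    by (rule pd_cong_open[OF assms(2) Suc.prems]) (rule Suc.IH)
  finally show ?case by simp
qed simp

text \<open>The claims are bundled into a property \<open>Q\<close> closed under sums and products,
  which leaves coefficients and symbols. For symbols, symmetry of mixed derivatives is needed, as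
  \<open>jet\<close> applies the \<delta>2-derivatives before the \<delta>1-derivatives.\<close>

lemma dpoly_apply_differential:
  assumes S: "open S" and u: "hol2 u S" and reg: "\<And>z. z \<in> S \<Longrightarrow> z \<notin> dpoly_singular A"
  shows "hol2 (dpoly_apply A u) S"
    and "z \<in> S \<Longrightarrow> z \<notin> dpoly_singular (dpoly_\<delta>1 A) \<and> pd1 (dpoly_apply A u) z = dpoly_apply (dpoly_\<delta>1 A) u z"
    and "z \<in> S \<Longrightarrow> z \<notin> dpoly_singular (dpoly_\<delta>2 A) \<and> pd2 (dpoly_apply A u) z = dpoly_apply (dpoly_\<delta>2 A) u z"
proof -
  define Q where "Q A \<longleftrightarrow> (\<forall>z\<in>S. z \<notin> dpoly_singular A) \<and> hol2 (dpoly_apply A u) S \<and>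
    (\<forall>z\<in>S. z \<notin> dpoly_singular (dpoly_\<delta>1 A) \<and> pd1 (dpoly_apply A u) z = dpoly_apply (dpoly_\<delta>1 A) u z \<and>
           z \<notin> dpoly_singular (dpoly_\<delta>2 A) \<and> pd2 (dpoly_apply A u) z = dpoly_apply (dpoly_\<delta>2 A) u z)" for A
  have Q_add: "Q (B + C)" if B: "Q B" and C: "Q C" for B C
  proof -
    have ev: "dpoly_apply B u z + dpoly_apply C u z = dpoly_apply (B + C) u z" if "z \<in> S" for z
      using dpoly_apply_add(2)[of z B C] B C that by (simp add: Q_def)
    have hol: "hol2 (\<lambda>z. dpoly_apply B u z + dpoly_apply C u z) S"
      using B C by (intro hol2_add) (auto simp: Q_def)
    have "pd1 (dpoly_apply (B + C) u) z = pd1 (dpoly_apply B u) z + pd1 (dpoly_apply C u) z"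
      "pd2 (dpoly_apply (B + C) u) z = pd2 (dpoly_apply B u) z + pd2 (dpoly_apply C u) z" if "z \<in> S" for z
      using pd_add[of "dpoly_apply B u" S "dpoly_apply C u" z] B C pd_cong_open[OF S that ev] that
      by (simp_all add: Q_def)
    then show ?thesis
      using B C hol2_cong[OF S ev hol]
      by (auto simp: Q_def dpoly_apply_add dp1.add dp2.add)
  qed
  have Q_mult: "Q (B * C)" if B: "Q B" and C: "Q C" for B C
  proof -
    have ev: "dpoly_apply B u z * dpoly_apply C u z = dpoly_apply (B * C) u z" if "z \<in> S" for z
      using dpoly_apply_mult[of z B C] B C that by (simp add: Q_def)
    have hol: "hol2 (\<lambda>z. dpoly_apply B u z * dpoly_apply C u z) S"
      using B C by (intro hol2_mult) (auto simp: Q_def)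
    have "pd1 (dpoly_apply (B * C) u) z = pd1 (dpoly_apply B u) z * dpoly_apply C u z + dpoly_apply B u z * pd1 (dpoly_apply C u) z"
      "pd2 (dpoly_apply (B * C) u) z = pd2 (dpoly_apply B u) z * dpoly_apply C u z + dpoly_apply B u z * pd2 (dpoly_apply C u) z"
      if "z \<in> S" for z
      using pd_mult[of "dpoly_apply B u" S "dpoly_apply C u" z] B C pd_cong_open[OF S that ev] that
      by (simp_all add: Q_def)
    then show ?thesis
      using B C hol2_cong[OF S ev hol]
      by (auto simp: Q_def dpoly_apply_add dpoly_apply_mult dp1.mult dp2.mult)
  qed
  have Q_const: "Q (const c)" if c: "\<And>z. z \<in> S \<Longrightarrow> regular_at c z" for c
  proof -
    have ev: "ratfun_eval c z = dpoly_apply (const c) u z" if "z \<in> S" for z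
      using dpoly_apply_const[OF c[OF that]] by simp
    have "hol2 (dpoly_apply (const c) u) S"
      by (rule hol2_cong[OF S ev hol2_ratfun_eval[OF c]])
    then show ?thesis
      using pd_cong_open[OF S _ ev] ratfun_eval_nbhd(2-5)[OF c] c
      by (auto simp: Q_def dpoly_apply_const)
  qed
  have Q_var: "Q (var v)" for v
  proof -
    obtain i j where v: "v = (i, j)" by (cases v)
    have fn: "dpoly_apply (var w) u = jet u w" for w
      by (simp add: fun_eq_iff dpoly_apply_var)
    have "hol2 ((pd2 ^^ j) u) S"
      using hol2_pd_funpow[OF u S, of 0 j] by simp
    from pd2_pd1_funpow[OF this S]
    have "pd2 (jet u (i, j)) z = jet u (i, Suc j) z" if "z \<in> S" for z
      using that by (simp add: jet_def)
    then show ?thesis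
      using hol2_pd_funpow[OF u S, of i j]
      by (simp add: Q_def fn v dpoly_apply_var) (simp add: jet_def)
  qed
  have Q_monom: "Q (single m 1)" for m
  proof (induction m rule: monom_induct[where V = UNIV])
    case zero
    show ?case by (rule Q_const) simp
  next
    case (add m v)
    then have "Q (single m 1 * var v)" by (intro Q_mult Q_var)
    then show ?case by (simp add: mult_single var_def)
  qed simp
  have "Q A"
  proof (induction A rule: poly_mapping_induct_lookup)
    case zero
    show ?case using Q_const[of 0] by simp
  next
    case (single m)
    have "Q (const (lookup A m))"
      using reg by (intro Q_const) (auto simp: not_singular_iff)
    then show ?case
      unfolding single_eq_const_mult[of m "lookup A m"] by (intro Q_mult Q_monom)
  qed (rule Q_add)
  then show "hol2 (dpoly_apply A u) S"
    and "z \<in> S \<Longrightarrow> z \<notin> dpoly_singular (dpoly_\<delta>1 A) \<and> pd1 (dpoly_apply A u) z = dpoly_apply (dpoly_\<delta>1 A) u z"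
    and "z \<in> S \<Longrightarrow> z \<notin> dpoly_singular (dpoly_\<delta>2 A) \<and> pd2 (dpoly_apply A u) z = dpoly_apply (dpoly_\<delta>2 A) u z"
    by (auto simp: Q_def)
qed

section \<open>The ideal of equations satisfied by a function\<close>

definition vanishing_ideal :: "(complex \<times> complex) set \<Rightarrow> (complex \<times> complex \<Rightarrow> complex) \<Rightarrow> dpoly set" where
  "vanishing_ideal S u = {A. \<forall>z\<in>S - dpoly_singular A. dpoly_apply A u z = 0}"

lemma dpoly_regular_generic: "\<exists>q. q \<noteq> 0 \<and> (\<forall>z. bipoly_eval q z \<noteq> 0 \<longrightarrow> z \<notin> dpoly_singular A)"
  using regular_generic[of "lookup A ` keys A"] by (auto simp: dpoly_singular_def)

lemma open_not_singular: "open {z. z \<notin> dpoly_singular A}"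
proof -
  have "{z. z \<notin> dpoly_singular A} = (\<Inter>m\<in>keys A. {z. regular_at (lookup A m) z})"
    by (auto simp: dpoly_singular_def)
  then show ?thesis by (simp add: open_INT open_regular)
qed

text \<open>A sum or product may be regular at poles of its constituents, where nothing can be
  computed termwise. Vanishing off the zero set of one polynomial suffices, by continuity and
  because the complement of that set is dense.\<close>

lemma vanishing_ideal_generic:
  assumes S: "open S" and u: "hol2 u S" and q: "q \<noteq> 0"
    and zero: "\<And>z. z \<in> S \<Longrightarrow> bipoly_eval q z \<noteq> 0 \<Longrightarrow> dpoly_apply A u z = 0"
  shows "A \<in> vanishing_ideal S u"
  unfolding vanishing_ideal_def
proof (intro CollectI ballI, rule ccontr)
  fix z assume z: "z \<in> S - dpoly_singular A" and nz: "dpoly_apply A u z \<noteq> 0"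
  let ?T = "S \<inter> {z. z \<notin> dpoly_singular A}"
  have T: "open ?T" by (intro open_Int S open_not_singular)
  have "hol2 (dpoly_apply A u) ?T"
    by (rule dpoly_apply_differential(1)[OF T]) (use u hol2_subset in auto)
  then have "open (?T \<inter> dpoly_apply A u -` (- {0}))"
    by (intro continuous_open_preimage hol2_D(1) T) auto
  moreover have "z \<in> ?T \<inter> dpoly_apply A u -` (- {0})" using z nz by simp
  ultimately obtain w where "w \<in> ?T \<inter> dpoly_apply A u -` (- {0})" "bipoly_eval q w \<noteq> 0"
    using bipoly_nonzero_dense[OF q] by (metis empty_iff)
  then show False using zero[of w] by auto
qed

lemma differential_ideal_vanishing:
  assumes S: "open S" and u: "hol2 u S"
  shows "differential_ideal (vanishing_ideal S u)"
proof -
  have gen: "\<exists>q. q \<noteq> 0 \<and> (\<forall>z. bipoly_eval q z \<noteq> 0 \<longrightarrow> z \<notin> dpoly_singular A \<and> z \<notin> dpoly_singular B)" for A B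
  proof -
    obtain p where "p \<noteq> 0" "\<And>z. bipoly_eval p z \<noteq> 0 \<Longrightarrow> z \<notin> dpoly_singular A"
      using dpoly_regular_generic by blast
    moreover obtain q where "q \<noteq> 0" "\<And>z. bipoly_eval q z \<noteq> 0 \<Longrightarrow> z \<notin> dpoly_singular B"
      using dpoly_regular_generic by blast
    ultimately show ?thesis
      by (intro exI[of _ "p * q"]) (simp add: bipoly_eval_mult)
  qed
  have "A + B \<in> vanishing_ideal S u" if "A \<in> vanishing_ideal S u" "B \<in> vanishing_ideal S u" for A B
  proof -
    obtain q where q: "q \<noteq> 0" "\<And>z. bipoly_eval q z \<noteq> 0 \<Longrightarrow> z \<notin> dpoly_singular A \<and> z \<notin> dpoly_singular B"
      using gen by blast
    show ?thesis
      by (rule vanishing_ideal_generic[OF S u q(1)])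
        (use that q(2) in \<open>simp add: vanishing_ideal_def dpoly_apply_add\<close>)
  qed
  moreover have "A * B \<in> vanishing_ideal S u" if "B \<in> vanishing_ideal S u" for A B
  proof -
    obtain q where q: "q \<noteq> 0" "\<And>z. bipoly_eval q z \<noteq> 0 \<Longrightarrow> z \<notin> dpoly_singular A \<and> z \<notin> dpoly_singular B"
      using gen by blast
    show ?thesis
      by (rule vanishing_ideal_generic[OF S u q(1)])
        (use that q(2) in \<open>simp add: vanishing_ideal_def dpoly_apply_mult\<close>)
  qed
  moreover have "dpoly_\<delta>1 A \<in> vanishing_ideal S u \<and> dpoly_\<delta>2 A \<in> vanishing_ideal S u"
    if A: "A \<in> vanishing_ideal S u" for A
  proof -
    obtain q where q: "q \<noteq> 0" "\<And>z. bipoly_eval q z \<noteq> 0 \<Longrightarrow> z \<notin> dpoly_singular A"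
      using gen by blast
    let ?T = "S \<inter> {z. bipoly_eval q z \<noteq> 0}"
    have T: "open ?T" by (intro open_Int S open_bipoly_nonzero)
    have zero: "dpoly_apply A u z = (\<lambda>_. 0) z" if "z \<in> ?T" for z
      using A q(2) that by (simp add: vanishing_ideal_def)
    have "dpoly_apply (dpoly_\<delta>1 A) u z = 0" "dpoly_apply (dpoly_\<delta>2 A) u z = 0" if z: "z \<in> ?T" for z
    proof -
      have "pd1 (dpoly_apply A u) z = 0" "pd2 (dpoly_apply A u) z = 0"
        using pd_cong_open[OF T z zero] by (simp_all add: pd1_def pd2_def)
      moreover have "hol2 u ?T" using u hol2_subset by blast
      ultimately show "dpoly_apply (dpoly_\<delta>1 A) u z = 0" "dpoly_apply (dpoly_\<delta>2 A) u z = 0"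
        using dpoly_apply_differential(2,3)[OF T, of u A z] q(2) z by auto
    qed
    then show ?thesis
      by (intro conjI vanishing_ideal_generic[OF S u q(1)]) auto
  qed
  ultimately show ?thesis
    unfolding differential_ideal_def by (simp add: vanishing_ideal_def)
qed

lemma const_notin_vanishing_ideal:
  assumes "open S" "S \<noteq> {}" "c \<noteq> 0"
  shows "const c \<notin> vanishing_ideal S u"
proof -
  obtain z where z: "z \<in> S" "regular_at c z" "ratfun_eval c z \<noteq> 0"
    using ratfun_nonzero_point[OF assms(3,1,2)] .
  then have "z \<in> S - dpoly_singular (const c)" "dpoly_apply (const c) u z \<noteq> 0"
    using dpoly_apply_const[OF z(2)] by auto
  then show ?thesis
    unfolding vanishing_ideal_def by blast
qed

lemma dpoly_apply_vf_dpoly: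
  "z \<notin> dpoly_singular (vf_dpoly X1 X2) \<and>
    dpoly_apply (vf_dpoly X1 X2) u z = bipoly_eval X1 z * pd1 u z + bipoly_eval X2 z * pd2 u z"
  by (simp add: vf_dpoly_const_mult dpoly_apply_add dpoly_apply_mult dpoly_apply_const dpoly_apply_var jet_def)

section \<open>From expansions to solutions in the coefficient field\<close>

lemma connected_box_ball: "connected (ball a r \<times> ball (b :: complex) s)" for a :: complex
  by (intro convex_connected convex_Times convex_ball)

lemma open_contains_ball_box:
  fixes S :: "(complex \<times> complex) set"
  assumes "open S" "z \<in> S"
  obtains r where "r > 0" "ball (fst z) r \<times> ball (snd z) r \<subseteq> S" "z \<in> ball (fst z) r \<times> ball (snd z) r"
proof -
  obtain r where r: "r > 0" "cball (fst z) r \<times> cball (snd z) r \<subseteq> S"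
    using open_contains_cball_box[OF assms] .
  then have "ball (fst z) r \<times> ball (snd z) r \<subseteq> S" by (meson Sigma_mono ball_subset_cball subset_trans)
  then show ?thesis using that r(1) by (simp add: mem_Times_iff)
qed

definition constant_ratfun :: "complex \<Rightarrow> ratfun" where
  "constant_ratfun c = Fract [:[:c:]:] 1"

lemma ratfun_eval_constant [simp]:
  "regular_at (constant_ratfun c) z" "ratfun_eval (constant_ratfun c) z = c"
  by (simp_all add: constant_ratfun_def ratfun_eval_Fract bipoly_eval_const)

lemma ratfun_eqI:
  assumes S: "open S" "S \<noteq> {}"
    and eq: "\<And>z. z \<in> S \<Longrightarrow> regular_at a z \<Longrightarrow> regular_at b z \<Longrightarrow> ratfun_eval a z = ratfun_eval b z"
  shows "a = b"
proof (rule ccontr)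
  assume "a \<noteq> b"
  let ?T = "S \<inter> {z. regular_at a z} \<inter> {z. regular_at b z}"
  obtain q where q: "q \<noteq> 0" "\<And>z. bipoly_eval q z \<noteq> 0 \<Longrightarrow> regular_at a z \<and> regular_at b z"
    using regular_generic[of "{a, b}"] by auto
  obtain z where "z \<in> S" "bipoly_eval q z \<noteq> 0"
    using bipoly_nonzero_dense[OF q(1) S] .
  then have "?T \<noteq> {}" using q(2) by blast
  moreover have "open ?T" by (intro open_Int S open_regular)
  moreover have "a - b \<noteq> 0" using \<open>a \<noteq> b\<close> by simp
  ultimately obtain z where "z \<in> ?T" "ratfun_eval (a - b) z \<noteq> 0"
    using ratfun_nonzero_point by metis
  then show False using eq by (simp add: ratfun_eval_diff)
qed

definition annihilates :: "bipoly \<Rightarrow> bipoly \<Rightarrow> (complex \<times> complex) set \<Rightarrow> (complex \<times> complex \<Rightarrow> complex) \<Rightarrow> bool" where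
  "annihilates X1 X2 S u \<longleftrightarrow> (\<forall>z\<in>S. bipoly_eval X1 z * pd1 u z + bipoly_eval X2 z * pd2 u z = 0)"

lemma first_integral_iff:
  "first_integral X1 X2 S u \<longleftrightarrow>
    open S \<and> connected S \<and> S \<noteq> {} \<and> hol2 u S \<and> \<not> u constant_on S \<and> annihilates X1 X2 S u"
  using analytic2_iff_hol2 by (auto simp: first_integral_def annihilates_def)

lemma annihilates_iff_vanishing: "annihilates X1 X2 S u \<longleftrightarrow> vf_dpoly X1 X2 \<in> vanishing_ideal S u"
  using dpoly_apply_vf_dpoly by (auto simp: annihilates_def vanishing_ideal_def)

context
  fixes X1 X2 :: bipoly
  assumes X1: "X1 \<noteq> 0"
begin

lemma ratfun_eval_slope_deriv:
  assumes "regular_at a z"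
  shows "bipoly_eval X1 z * ratfun_eval (\<delta>1 a) z + bipoly_eval X2 z * ratfun_eval (\<delta>2 a) z
    = ratfun_eval (of_bipoly X1 * slope_deriv (slope X1 X2) a) z"
  using ratfun_eval_nbhd[OF assms]
  by (simp add: vf_eq[OF X1, symmetric] vf_def ratfun_eval_add ratfun_eval_mult)

text \<open>On a box off its poles, an element of K killed by D is a first integral unless it is
  constant.\<close>

lemma slope_deriv_zero_constant:
  assumes zero: "slope_deriv (slope X1 X2) a = 0" and no: "\<not> has_rational_first_integral X1 X2"
  shows "\<exists>c. a = constant_ratfun c"
proof -
  obtain n d where a: "a = Fract n d" "d \<noteq> 0" by (metis Fract_cases)
  obtain z0 where z0: "bipoly_eval d z0 \<noteq> 0"
    using bipoly_nonzero_dense[OF a(2), of UNIV] by auto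
  then obtain r where r: "r > 0" "ball (fst z0) r \<times> ball (snd z0) r \<subseteq> {z. bipoly_eval d z \<noteq> 0}"
    "z0 \<in> ball (fst z0) r \<times> ball (snd z0) r"
    using open_contains_ball_box[OF open_bipoly_nonzero, of z0 d] by auto
  let ?S = "ball (fst z0) r \<times> ball (snd z0) r"
  have S: "open ?S" "connected ?S" "?S \<noteq> {}"
    using r by (auto intro: open_Times connected_box_ball)
  have reg: "regular_at a z" if "z \<in> ?S" for z
    using r(2) that a ratfun_eval_Fract(1) by blast
  have "annihilates X1 X2 ?S (ratfun_eval a)"
    unfolding annihilates_def
    using ratfun_eval_slope_deriv[OF reg] ratfun_eval_nbhd(3,5)[OF reg] zero by simp
  then have "ratfun_eval a constant_on ?S"
    using no S hol2_ratfun_eval[of ?S a] reg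
    unfolding has_rational_first_integral_def first_integral_iff by blast
  then obtain c where c: "\<And>z. z \<in> ?S \<Longrightarrow> ratfun_eval a z = c"
    unfolding constant_on_def by blast
  have "a = constant_ratfun c"
    by (rule ratfun_eqI[OF S(1,3)]) (simp add: c)
  then show ?thesis by blast
qed

text \<open>The commutator rule makes \<delta>2 a a solution with exponent 1. It is nonzero, since
  otherwise D a = 0 would force \<delta>1 a = 0 as well and a would be constant.\<close>

lemma first_integral_imp_sol1:
  assumes "has_rational_first_integral X1 X2"
  shows "slope_sol1 (slope X1 X2)"
proof -
  obtain a S where reg: "\<And>z. z \<in> S \<Longrightarrow> regular_at a z" and fi: "first_integral X1 X2 S (ratfun_eval a)"
    using assms unfolding has_rational_first_integral_def by blast
  then have S: "open S" "connected S" "S \<noteq> {}" "hol2 (ratfun_eval a) S"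
    and nc: "\<not> ratfun_eval a constant_on S" and ann: "annihilates X1 X2 S (ratfun_eval a)"
    by (auto simp: first_integral_iff)
  have "of_bipoly X1 * slope_deriv (slope X1 X2) a = 0"
    by (rule ratfun_eqI[OF S(1,3)])
      (use ann ratfun_eval_slope_deriv[OF reg] ratfun_eval_nbhd(3,5)[OF reg] in \<open>auto simp: annihilates_def\<close>)
  then have zero: "slope_deriv (slope X1 X2) a = 0"
    using of_bipoly_nonzero[OF X1] by simp
  have "\<delta>2 a \<noteq> 0"
  proof
    assume "\<delta>2 a = 0"
    moreover from this have "\<delta>1 a = 0" using zero by (simp add: slope_deriv_def)
    ultimately have "ratfun_eval a constant_on S"
      using ratfun_eval_nbhd(3,5)[OF reg] by (intro hol2_zero_partials_constant S) auto
    then show False using nc by simp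
  qed
  moreover have "slope_deriv (slope X1 X2) (\<delta>2 a) = - (of_nat 1 * \<delta>2 (slope X1 X2) * \<delta>2 a)"
    by (simp add: slope_deriv_\<delta>2 zero)
  ultimately show ?thesis
    unfolding slope_sol1_def by (metis zero_less_one)
qed

text \<open>If \<open>pd2 u\<close> vanished identically, the equation would give X1
  \<open>pd1 u\<close> = 0; as X1 is nonzero on a dense set, \<open>pd1 u\<close> would vanish
  too.\<close>

lemma nonconstant_pd2_nonzero:
  assumes S: "open S" "connected S" and u: "hol2 u S" "\<not> u constant_on S" and ann: "annihilates X1 X2 S u"
  shows "\<exists>z\<in>S. pd2 u z \<noteq> 0"
proof (rule ccontr)
  assume "\<not> ?thesis"
  then have pd2: "pd2 u z = 0" if "z \<in> S" for z using that by blast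
  have pd1: "pd1 u z = 0" if z: "z \<in> S" for z
  proof (rule ccontr)
    assume nz: "pd1 u z \<noteq> 0"
    have "open (S \<inter> pd1 u -` (- {0}))"
      by (intro continuous_open_preimage continuous_on_pd1 S u) auto
    moreover have "z \<in> S \<inter> pd1 u -` (- {0})" using z nz by simp
    ultimately obtain w where "w \<in> S \<inter> pd1 u -` (- {0})" "bipoly_eval X1 w \<noteq> 0"
      using bipoly_nonzero_dense[OF X1] by (metis empty_iff)
    then show False using ann pd2[of w] by (auto simp: annihilates_def)
  qed
  have "u constant_on S"
    by (rule hol2_zero_partials_constant[OF u(1) S pd1 pd2])
  then show False using u(2) by simp
qed

text \<open>B is \<open>p(y) y\<^sub>1\<^sup>w\<close> with constant coefficients. Where
  \<open>pd2 u\<close> is nonzero, p(u) = 0, so u takes only finitely many values there and is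
  constant along slices in x2, contrary to \<open>pd2 u\<close> being nonzero.\<close>

lemma normal_form_contradiction:
  assumes S: "open S" "connected S" and u: "hol2 u S" "\<not> u constant_on S" and ann: "annihilates X1 X2 S u"
    and B: "B \<in> vanishing_ideal S u" "B \<noteq> 0" "dvars B \<subseteq> ycols 1" "\<And>m. m \<in> keys B \<Longrightarrow> wt m = w"
    and coeffs: "\<And>m. \<exists>c. lookup B m = constant_ratfun c"
  shows False
proof -
  obtain z0 where z0: "z0 \<in> S" "pd2 u z0 \<noteq> 0"
    using nonconstant_pd2_nonzero[OF S u ann] by blast
  let ?T0 = "S \<inter> pd2 u -` (- {0})"
  have "open ?T0"
    by (intro continuous_open_preimage continuous_on_pd2 S u) auto
  moreover have "z0 \<in> ?T0" using z0 by simp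
  ultimately obtain r where r: "r > 0" "ball (fst z0) r \<times> ball (snd z0) r \<subseteq> ?T0"
    using open_contains_ball_box by metis
  define c where "c m = (SOME c. lookup B m = constant_ratfun c)" for m
  have c: "lookup B m = constant_ratfun (c m)" for m
    unfolding c_def using coeffs by (rule someI_ex)
  let ?e = "\<lambda>m. lookup m (0, 0)"
  define P where "P = (\<Sum>m\<in>keys B. monom (c m) (?e m))"
  have keys_m: "keys m \<subseteq> {(0, 0), (0, 1)}" if "m \<in> keys B" for m
    using B(3) that by (auto simp: dvars_def ycols_def le_Suc_eq)
  have m1: "lookup m (0, 1) = w" if "m \<in> keys B" for m
  proof -
    have "wt m = (\<Sum>v\<in>{(0, 0), (0, 1)}. lookup m v * snd v)"
      unfolding wt_def using keys_m[OF that] by (intro sum.mono_neutral_left) (auto simp: in_keys_iff)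
    then show ?thesis using B(4)[OF that] by simp
  qed
  \<comment> \<open>All monomials contain \<open>y\<^sub>1\<close> to the power w, so the exponent
    of y separates them and no coefficients merge in \<open>P\<close>.\<close>
  have inj: "m = n" if "m \<in> keys B" "n \<in> keys B" "?e m = ?e n" for m n
  proof (rule poly_mapping_eqI)
    fix v
    show "lookup m v = lookup n v"
    proof (cases "v \<in> {(0, 0), (0, 1)}")
      case True
      then show ?thesis using that(3) m1[OF that(1)] m1[OF that(2)] by auto
    next
      case False
      then have "v \<notin> keys m" "v \<notin> keys n" using keys_m that by blast+
      then show ?thesis by (simp add: in_keys_iff)
    qed
  qed
  have "P \<noteq> 0"
  proof -
    obtain m where m: "m \<in> keys B" using B(2) by (metis ex_in_conv keys_eq_empty)
    have "coeff P (?e m) = (\<Sum>n\<in>keys B. if n = m then c m else 0)"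
      unfolding P_def coeff_sum by (intro sum.cong refl) (use inj m in auto)
    also have "\<dots> = c m" using m by simp
    finally have "coeff P (?e m) = c m" .
    moreover have "c m \<noteq> 0"
    proof
      assume "c m = 0"
      then have "lookup B m = 0" by (simp add: c constant_ratfun_def Zero_fract_def)
      then show False using m by (simp add: in_keys_iff)
    qed
    ultimately show ?thesis by auto
  qed
  have root: "poly P (u z) = 0" if z: "z \<in> ?T0" for z
  proof -
    have "mon_eval u z m = u z ^ ?e m * pd2 u z ^ w" if "m \<in> keys B" for m
      using mon_eval_superset[OF _ keys_m[OF that], of u z] m1[OF that] by (simp add: jet_def)
    then have "dpoly_apply B u z = (\<Sum>m\<in>keys B. c m * (u z ^ ?e m * pd2 u z ^ w))"
      unfolding dpoly_apply_eq by (intro sum.cong refl) (simp add: c)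
    also have "\<dots> = poly P (u z) * pd2 u z ^ w"
      by (simp add: P_def poly_sum poly_monom sum_distrib_right mult.assoc)
    finally have "dpoly_apply B u z = poly P (u z) * pd2 u z ^ w" .
    moreover have "dpoly_apply B u z = 0"
      using B(1) z c by (auto simp: vanishing_ideal_def not_singular_iff)
    ultimately show ?thesis using z by simp
  qed
  let ?g = "\<lambda>w. u (fst z0, w)"
  have g_in: "(fst z0, w) \<in> ?T0" if "w \<in> ball (snd z0) r" for w
    using that r by (intro subsetD[OF r(2)]) auto
  have "continuous_on (ball (snd z0) r) ?g"
    by (rule continuous_on_compose2[OF hol2_D(1)[OF u(1)]]) (use g_in in \<open>auto intro!: continuous_intros\<close>)
  moreover have "finite (?g ` ball (snd z0) r)"
    by (rule finite_subset[OF _ poly_roots_finite[OF \<open>P \<noteq> 0\<close>]]) (use root g_in in blast)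
  ultimately have "?g constant_on ball (snd z0) r"
    by (intro continuous_finite_range_constant) auto
  then obtain k where k: "\<And>w. w \<in> ball (snd z0) r \<Longrightarrow> ?g w = k"
    unfolding constant_on_def by blast
  have "(?g has_field_derivative 0) (at (snd z0))"
    by (rule has_field_derivative_transform_within_open[of "\<lambda>_. k" _ _ "ball (snd z0) r"]) (use r k in auto)
  then have "pd2 u z0 = 0" by (rule pd_eqI)
  then show False using z0 by simp
qed

text \<open>A finite-order nontrivial expansion vanishes on a nonconstant solution u. If every
  equation relevant to order r failed, it would contain a normal form, which cannot vanish on
  u.\<close>

lemma expansion_solvable:
  assumes nt: "nontrivial_expansion X1 X2 \<Lambda>" and r: "expansion_ord \<Lambda> = enat r"
    and no: "\<not> has_rational_first_integral X1 X2"
    and sols: "r = 0 \<or> \<not> slope_sol1 (slope X1 X2)" "r \<le> 1 \<or> \<not> slope_sol2 (slope X1 X2)"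
      "r \<le> 2 \<or> \<not> slope_sol3 (slope X1 X2)"
  shows False
proof -
  have exp: "differential_ideal \<Lambda>" "differential_ideal_hull {vf_dpoly X1 X2} \<subset> \<Lambda>"
    using nt by (auto simp: nontrivial_expansion_def expansion_def)
  note fin = expansion_ord_finite[OF X1 exp r]
  obtain S u where S: "open S" "connected S" "analytic2_on u S" "\<not> u constant_on S"
    and van: "\<forall>A\<in>\<Lambda>. \<forall>z\<in>S - dpoly_singular A. dpoly_apply A u z = 0"
    using nt fin(1) unfolding nontrivial_expansion_def by blast
  have sub: "\<Lambda> \<subseteq> vanishing_ideal S u"
    using van by (auto simp: vanishing_ideal_def)
  have u: "hol2 u S" using S analytic2_iff_hol2 by blast
  have ann: "annihilates X1 X2 S u"
    using vf_dpoly_in_expansion[OF X1 exp] sub by (auto simp: annihilates_iff_vanishing)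
  obtain A where A: "A \<in> \<Lambda>" "A \<noteq> 0" "dvars A \<subseteq> ycols r" using fin(2) by blast
  obtain B w where B: "B \<in> \<Lambda>" "B \<noteq> 0" "dvars B \<subseteq> ycols 1" "\<forall>m\<in>keys B. wt m = w"
    "\<forall>m. slope_deriv (slope X1 X2) (lookup B m) = 0"
    by (rule expansion_normal_form[OF X1 exp A sols]) blast
  show False
    by (rule normal_form_contradiction[OF S(1,2) u S(4) ann _ B(2,3)])
      (use B sub slope_deriv_zero_constant[OF _ no] in auto)
qed

end

section \<open>From solutions in the coefficient field to expansions\<close>

lemma annihilates_zero: "annihilates X1 X2 S (\<lambda>_. 0)"
  by (simp add: annihilates_def pd1_def pd2_def)

text \<open>\<omega>^2 will serve as a second solution that violates the equation found for
  \<omega>, in the cases where that equation is homogeneous and 0 satisfies it.\<close>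

lemma annihilates_square:
  assumes "hol2 u S" "annihilates X1 X2 S u"
  shows "annihilates X1 X2 S (\<lambda>z. u z * u z)"
proof -
  have "bipoly_eval X1 z * pd1 (\<lambda>z. u z * u z) z + bipoly_eval X2 z * pd2 (\<lambda>z. u z * u z) z = 0"
    if z: "z \<in> S" for z
  proof -
    have "bipoly_eval X1 z * pd1 (\<lambda>z. u z * u z) z + bipoly_eval X2 z * pd2 (\<lambda>z. u z * u z) z
        = 2 * u z * (bipoly_eval X1 z * pd1 u z + bipoly_eval X2 z * pd2 u z)"
      unfolding pd_mult[OF assms(1,1) z] by (simp add: algebra_simps)
    then show ?thesis using assms(2) z by (simp add: annihilates_def)
  qed
  then show ?thesis unfolding annihilates_def by blast
qed

lemma hull_subset_vanishing:
  assumes "open S" "hol2 u S" "annihilates X1 X2 S u"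
  shows "differential_ideal_hull {vf_dpoly X1 X2} \<subseteq> vanishing_ideal S u"
  using differential_ideal_vanishing[OF assms(1,2)] assms(3)
  unfolding differential_ideal_hull_def annihilates_iff_vanishing by blast

text \<open>A further solution \<open>v\<close> of the equation witnesses that the vanishing ideal of \<open>u\<close> is larger
  than the ideal generated by the equation.\<close>

lemma vf_ord_le_vanishing:
  assumes S: "open S" "connected S" "S \<noteq> {}"
    and u: "hol2 u S" "\<not> u constant_on S" "annihilates X1 X2 S u"
    and v: "hol2 v S" "annihilates X1 X2 S v"
    and G: "G \<in> vanishing_ideal S u" "G \<notin> vanishing_ideal S v" "dvars G \<subseteq> ycols r"
  shows "vf_ord X1 X2 \<le> enat r"
proof -
  let ?L = "vanishing_ideal S u"
  have "expansion X1 X2 ?L"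
    unfolding expansion_def
    using differential_ideal_vanishing[OF S(1) u(1)] hull_subset_vanishing[OF S(1) u(1,3)]
      hull_subset_vanishing[OF S(1) v] G by blast
  then have "nontrivial_expansion X1 X2 ?L"
    unfolding nontrivial_expansion_def
    using S u hol2_imp_analytic2[OF u(1) S(1)] by (auto simp: vanishing_ideal_def)
  moreover have "0 \<in> vanishing_ideal S v"
    by (simp add: vanishing_ideal_def)
  then have "expansion_ord ?L \<le> enat r"
    using G const_notin_vanishing_ideal[OF S(1,3)] by (intro expansion_ord_le) auto
  ultimately show ?thesis
    using vf_ord_le order_trans by blast
qed

lemma pd_constant_on:
  assumes "open S" "u constant_on S" "z \<in> S"
  shows "pd2 u z = 0"
proof -
  obtain k where k: "\<And>w. w \<in> S \<Longrightarrow> u w = k" using assms(2) by (auto simp: constant_on_def)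
  have "pd2 u z = pd2 (\<lambda>_. k) z"
    by (rule pd_cong_open[OF assms(1,3)]) (rule k)
  then show ?thesis by (simp add: pd2_def)
qed

lemma jet_Suc: "jet u (0, Suc j) = pd2 (jet u (0, j))"
  by (simp add: jet_def)

lemma jet_0: "jet u (0, 0) = u"
  by (simp add: jet_def)

lemma jet_Suc_cong:
  assumes "open S" "z \<in> S" "\<And>w. w \<in> S \<Longrightarrow> jet u (0, j) w = g w"
  shows "jet u (0, Suc j) z = pd2 g z"
  unfolding jet_Suc by (rule pd_cong_open[OF assms])

lemma exists_nbhd_box:
  fixes p :: "complex \<times> complex"
  assumes "open T" "p \<in> T"
  obtains S where "open S" "convex S" "p \<in> S" "S \<subseteq> T"
proof -
  obtain r where "r > 0" "ball (fst p) r \<times> ball (snd p) r \<subseteq> T" "p \<in> ball (fst p) r \<times> ball (snd p) r"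
    using open_contains_ball_box[OF assms] .
  then show ?thesis
    by (intro that[of "ball (fst p) r \<times> ball (snd p) r"]) (auto intro: open_Times convex_Times)
qed

section \<open>Multipliers and potentials\<close>

context
  fixes X1 X2 :: bipoly
  assumes X1: "X1 \<noteq> 0"
begin

abbreviation "sl \<equiv> slope X1 X2"
abbreviation "slv \<equiv> ratfun_eval (slope X1 X2)"

definition good :: "ratfun \<Rightarrow> (complex \<times> complex) set" where
  "good a = {z. bipoly_eval X1 z \<noteq> 0 \<and> regular_at a z}"

lemma open_good: "open (good a)"
  unfolding good_def using open_Int[OF open_bipoly_nonzero open_regular] by (simp add: Int_def)

lemma good_nonempty: "\<exists>p \<in> good a. a \<noteq> 0 \<longrightarrow> ratfun_eval a p \<noteq> 0"
proof -
  obtain n d where a: "a = Fract n d" "d \<noteq> 0" by (metis Fract_cases)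
  define q where "q = X1 * d * (if n = 0 then 1 else n)"
  have "q \<noteq> 0" using X1 a by (auto simp: q_def)
  then obtain z where z: "bipoly_eval q z \<noteq> 0"
    using bipoly_nonzero_dense[of q UNIV] by auto
  then have "bipoly_eval X1 z \<noteq> 0" "bipoly_eval d z \<noteq> 0" "n \<noteq> 0 \<longrightarrow> bipoly_eval n z \<noteq> 0"
    by (auto simp: q_def bipoly_eval_mult)
  moreover have "n = 0 \<Longrightarrow> a = 0" using a by (simp add: fract_collapse)
  ultimately show ?thesis
    using ratfun_eval_Fract[of d z n] a by (intro bexI[of _ z]) (auto simp: good_def)
qed

lemma slope_eval:
  assumes "bipoly_eval X1 z \<noteq> 0"
  shows "regular_at sl z" "slv z = bipoly_eval X2 z / bipoly_eval X1 z"
  using ratfun_eval_divide_bipoly[of "of_bipoly X2" z X1] assms by (simp_all add: slope_def)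

lemma slope_deriv_eval:
  assumes "bipoly_eval X1 z \<noteq> 0" "regular_at a z"
  shows "regular_at (slope_deriv sl a) z"
    "ratfun_eval (slope_deriv sl a) z = ratfun_eval (\<delta>1 a) z + slv z * ratfun_eval (\<delta>2 a) z"
  using ratfun_eval_nbhd[OF assms(2)] slope_eval(1)[OF assms(1)]
  by (simp_all add: slope_deriv_def ratfun_eval_add ratfun_eval_mult)

lemma good_subsetD:
  assumes "S \<subseteq> good a" "z \<in> S"
  shows "bipoly_eval X1 z \<noteq> 0" "regular_at a z" "regular_at sl z" "regular_at (\<delta>2 sl) z"
    "regular_at (\<delta>2 (\<delta>2 sl)) z" "regular_at (\<delta>2 (\<delta>2 (\<delta>2 sl))) z" "regular_at (\<delta>1 sl) z"
    "regular_at (\<delta>1 a) z" "regular_at (\<delta>2 a) z"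
proof -
  show A: "bipoly_eval X1 z \<noteq> 0" and B: "regular_at a z"
    using assms by (auto simp: good_def)
  show C: "regular_at sl z" by (rule slope_eval(1)[OF A])
  show D: "regular_at (\<delta>2 sl) z" by (rule ratfun_eval_nbhd(4)[OF C])
  show E: "regular_at (\<delta>2 (\<delta>2 sl)) z" by (rule ratfun_eval_nbhd(4)[OF D])
  show "regular_at (\<delta>2 (\<delta>2 (\<delta>2 sl))) z" by (rule ratfun_eval_nbhd(4)[OF E])
  show "regular_at (\<delta>1 sl) z" by (rule ratfun_eval_nbhd(2)[OF C])
  show "regular_at (\<delta>1 a) z" by (rule ratfun_eval_nbhd(2)[OF B])
  show "regular_at (\<delta>2 a) z" by (rule ratfun_eval_nbhd(4)[OF B])
qed

lemma hol2_good:
  assumes "S \<subseteq> good a"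
  shows "hol2 (ratfun_eval a) S" "hol2 slv S" "hol2 (ratfun_eval (\<delta>2 sl)) S"
    "hol2 (ratfun_eval (\<delta>2 (\<delta>2 sl))) S"
  using good_subsetD[OF assms] by (auto intro!: hol2_ratfun_eval)

lemma pd2_slope_mult:
  assumes "S \<subseteq> good a" "hol2 \<alpha> S" "z \<in> S"
  shows "pd2 (\<lambda>z. - (slv z * \<alpha> z)) z = - (ratfun_eval (\<delta>2 sl) z * \<alpha> z + slv z * pd2 \<alpha> z)"
proof -
  note slv = hol2_good(2)[OF assms(1)]
  show ?thesis
    unfolding pd_minus(2)[OF hol2_mult[OF slv assms(2)] assms(3)] pd_mult(2)[OF slv assms(2,3)]
      ratfun_eval_nbhd(5)[OF good_subsetD(3)[OF assms(1,3)]] ..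
qed

text \<open>With \<eta> = \<alpha> / X1 the form is \<alpha> dx2 - f \<alpha> dx1, and its
  closedness is the equation D \<alpha> = - f' \<alpha>.\<close>

lemma integrating_factorI:
  assumes S: "open S" "S \<noteq> {}" "S \<subseteq> good a" and \<alpha>: "hol2 \<alpha> S" "\<exists>z\<in>S. \<alpha> z \<noteq> 0"
    and eq: "\<And>z. z \<in> S \<Longrightarrow> pd1 \<alpha> z + slv z * pd2 \<alpha> z = - (ratfun_eval (\<delta>2 sl) z * \<alpha> z)"
  shows "integrating_factor X1 X2 S (\<lambda>z. \<alpha> z / bipoly_eval X1 z)"
  unfolding integrating_factor_def
proof (intro conjI)
  note nz = good_subsetD(1)[OF S(3)]
  have hol: "hol2 (\<lambda>z. \<alpha> z / bipoly_eval X1 z) S"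
    by (intro hol2_divide \<alpha>(1) hol2_bipoly_eval nz)
  show "open S" "S \<noteq> {}" by fact+
  show "analytic2_on (\<lambda>z. \<alpha> z / bipoly_eval X1 z) S"
    using hol hol2_imp_analytic2 S(1) by blast
  show "\<exists>z\<in>S. \<alpha> z / bipoly_eval X1 z \<noteq> 0"
    using \<alpha>(2) nz by auto
  show "closed_form_on S (\<lambda>z. - (\<alpha> z / bipoly_eval X1 z * bipoly_eval X2 z))
      (\<lambda>z. \<alpha> z / bipoly_eval X1 z * bipoly_eval X1 z)"
    unfolding closed_form_on_def
  proof
    fix z assume z: "z \<in> S"
    have "pd1 (\<lambda>z. \<alpha> z / bipoly_eval X1 z * bipoly_eval X1 z) z = pd1 \<alpha> z"
      by (rule pd_cong_open[OF S(1) z]) (use nz in auto)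
    also have "\<dots> = - (slv z * pd2 \<alpha> z + ratfun_eval (\<delta>2 sl) z * \<alpha> z)"
      using eq[OF z] by (simp add: algebra_simps eq_neg_iff_add_eq_0)
    also have "\<dots> = pd2 (\<lambda>z. - (slv z * \<alpha> z)) z"
      by (simp only: pd2_slope_mult[OF S(3) \<alpha>(1) z] add.commute)
    also have "\<dots> = pd2 (\<lambda>z. - (\<alpha> z / bipoly_eval X1 z * bipoly_eval X2 z)) z"
      by (rule pd_cong_open[OF S(1) z]) (use slope_eval(2) nz in auto)
    finally show "pd1 (\<lambda>z. \<alpha> z / bipoly_eval X1 z * bipoly_eval X1 z) z
        = pd2 (\<lambda>z. - (\<alpha> z / bipoly_eval X1 z * bipoly_eval X2 z)) z" .
  qed
qed

text \<open>The first integral is a potential of the closed form \<alpha> dx2 - f \<alpha> dx1. It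
  is nonconstant because its x2-derivative at p is \<alpha> p.\<close>

lemma first_integral_of_multiplier:
  assumes S: "open S" "convex S" "p \<in> S" "S \<subseteq> good a" and \<alpha>: "hol2 \<alpha> S" "\<alpha> p \<noteq> 0"
    and eq: "\<And>z. z \<in> S \<Longrightarrow> pd1 \<alpha> z + slv z * pd2 \<alpha> z = - (ratfun_eval (\<delta>2 sl) z * \<alpha> z)"
  obtains \<omega> where "hol2 \<omega> S" "\<not> \<omega> constant_on S" "annihilates X1 X2 S \<omega>" "\<forall>z\<in>S. pd2 \<omega> z = \<alpha> z"
proof -
  note slv = hol2_good(2)[OF S(4)]
  have closed: "pd1 \<alpha> z = pd2 (\<lambda>z. - (slv z * \<alpha> z)) z" if z: "z \<in> S" for z
    unfolding pd2_slope_mult[OF S(4) \<alpha>(1) z]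
    using eq[OF z] by (simp add: algebra_simps eq_neg_iff_add_eq_0)
  obtain \<omega> where \<omega>: "hol2 \<omega> S" "\<omega> p = 0" and pd1: "\<And>z. z \<in> S \<Longrightarrow> pd1 \<omega> z = - (slv z * \<alpha> z)"
    and pd2: "\<And>z. z \<in> S \<Longrightarrow> pd2 \<omega> z = \<alpha> z"
    using Poincare_hol2[OF S(1,2) hol2_minus[OF hol2_mult[OF slv \<alpha>(1)]] \<alpha>(1) closed S(3)] by blast
  show ?thesis
  proof (rule that[OF \<omega>(1)])
    show "\<not> \<omega> constant_on S"
      using pd_constant_on[OF S(1) _ S(3), of \<omega>] pd2[OF S(3)] \<alpha>(2) by auto
    show "annihilates X1 X2 S \<omega>"
      using pd1 pd2 slope_eval(2)[OF good_subsetD(1)[OF S(4)]] good_subsetD(1)[OF S(4)]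
      by (simp add: annihilates_def)
    show "\<forall>z\<in>S. pd2 \<omega> z = \<alpha> z" using pd2 by blast
  qed
qed

text \<open>Apply D to \<alpha>^n = a and cancel n \<alpha>^(n-1), which has no zeros.\<close>

lemma root_branch_multiplier:
  assumes S: "open S" "S \<subseteq> good a" and root: "root_branch a n S \<alpha>"
    and n: "n \<noteq> 0" and a: "slope_deriv sl a = - (of_int n * \<delta>2 sl * a)"
  shows "hol2 \<alpha> S" "\<forall>z\<in>S. \<alpha> z \<noteq> 0"
    "z \<in> S \<Longrightarrow> pd1 \<alpha> z + slv z * pd2 \<alpha> z = - (ratfun_eval (\<delta>2 sl) z * \<alpha> z)"
proof -
  show \<alpha>: "hol2 \<alpha> S"
    using root analytic2_imp_hol2 S(1) by (auto simp: root_branch_def)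
  have eq: "\<alpha> z powi n = ratfun_eval a z" and nz: "ratfun_eval a z \<noteq> 0" if "z \<in> S" for z
    using root that by (auto simp: root_branch_def)
  show nz\<alpha>: "\<forall>z\<in>S. \<alpha> z \<noteq> 0"
    using eq nz n by (metis power_int_0_left)
  fix z assume z: "z \<in> S"
  note g = good_subsetD[OF S(2) z]
  have "((\<lambda>x. x powi n) has_field_derivative of_int n * \<alpha> z powi (n - 1)) (at (\<alpha> z))"
    using nz\<alpha> z by (auto intro!: derivative_eq_intros)
  note c = pd_compose[OF \<alpha> z this]
  have A: "pd1 (\<lambda>z. \<alpha> z powi n) z = ratfun_eval (\<delta>1 a) z" "pd2 (\<lambda>z. \<alpha> z powi n) z = ratfun_eval (\<delta>2 a) z"
    using pd_cong_open[OF S(1) z eq] ratfun_eval_nbhd(3,5)[OF g(2)] by simp_all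
  have "of_int n * \<alpha> z powi (n - 1) * (pd1 \<alpha> z + slv z * pd2 \<alpha> z) = ratfun_eval (slope_deriv sl a) z"
    unfolding slope_deriv_eval(2)[OF g(1,2)] A[symmetric] c by (simp add: algebra_simps)
  also have "\<dots> = - (of_int n * ratfun_eval (\<delta>2 sl) z * (\<alpha> z powi n))"
    using g by (simp add: a eq[OF z] ratfun_eval_minus ratfun_eval_mult)
  also have "\<alpha> z powi n = \<alpha> z powi (n - 1) * \<alpha> z"
    using nz\<alpha> z power_int_add_1[of "\<alpha> z" "n - 1"] by simp
  also have "- (of_int n * ratfun_eval (\<delta>2 sl) z * (\<alpha> z powi (n - 1) * \<alpha> z))
      = of_int n * \<alpha> z powi (n - 1) * (- (ratfun_eval (\<delta>2 sl) z * \<alpha> z))"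
    by simp
  finally have "of_int n * \<alpha> z powi (n - 1) * (pd1 \<alpha> z + slv z * pd2 \<alpha> z)
      = of_int n * \<alpha> z powi (n - 1) * (- (ratfun_eval (\<delta>2 sl) z * \<alpha> z))" .
  moreover have "of_int n * \<alpha> z powi (n - 1) \<noteq> 0"
    using n nz\<alpha> z by simp
  ultimately show "pd1 \<alpha> z + slv z * pd2 \<alpha> z = - (ratfun_eval (\<delta>2 sl) z * \<alpha> z)"
    by (metis mult_left_cancel)
qed

text \<open>Near p the quotient a / a(p) stays in the right half-plane, where the principal
  logarithm is holomorphic. Normalising by a(p) avoids the branch cut wherever a(p) lies.\<close>

lemma root_branch_exists:
  assumes p: "p \<in> good a" "ratfun_eval a p \<noteq> 0" and n: "n \<noteq> 0"
  obtains S \<alpha> where "open S" "convex S" "p \<in> S" "S \<subseteq> good a" "root_branch a n S \<alpha>"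
proof -
  let ?A = "ratfun_eval a"
  let ?T = "good a \<inter> (\<lambda>z. Re (?A z / ?A p)) -` {0<..}"
  have cont: "continuous_on (good a) (\<lambda>z. Re (?A z / ?A p))"
    using p(2) by (intro continuous_intros hol2_D(1) hol2_good(1)) auto
  have "open ?T"
    by (rule continuous_open_preimage[OF cont open_good open_greaterThan])
  moreover have "p \<in> ?T" using p by simp
  ultimately obtain S where S: "open S" "convex S" "p \<in> S" "S \<subseteq> ?T"
    using exists_nbhd_box by metis
  then have sub: "S \<subseteq> good a" and re: "\<And>z. z \<in> S \<Longrightarrow> Re (?A z / ?A p) > 0" by auto
  have nz: "?A z \<noteq> 0" if "z \<in> S" for z using re[OF that] by auto
  define \<alpha> where "\<alpha> z = exp ((Ln (?A p) + Ln (?A z / ?A p)) / of_int n)" for z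
  have "hol2 (\<lambda>z. ?A z / ?A p) S"
    using p(2) by (intro hol2_divide hol2_good(1)[OF sub]) auto
  then have Ln: "hol2 (\<lambda>z. Ln (?A z / ?A p)) S"
    by (rule hol2_compose[where T = "{z. Re z > 0}"])
      (use re in \<open>auto intro!: holomorphic_on_Ln open_halfspace_Re_gt simp: complex_nonpos_Reals_iff\<close>)
  have "hol2 \<alpha> S"
    unfolding \<alpha>_def using n Ln by (intro hol2_exp hol2_divide hol2_add) auto
  moreover have "\<alpha> z powi n = ?A z" if "z \<in> S" for z
  proof -
    have "\<alpha> z powi n = exp (Ln (?A p)) * exp (Ln (?A z / ?A p))"
      using n by (simp add: \<alpha>_def exp_power_int exp_add)
    also have "\<dots> = ?A z" using p(2) nz[OF that] by simp
    finally show ?thesis .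
  qed
  ultimately have "root_branch a n S \<alpha>"
    using sub nz hol2_imp_analytic2[OF _ S(1)] by (auto simp: root_branch_def good_def)
  then show ?thesis using that S sub by blast
qed

text \<open>The equation for a is exactly the closedness of (- f a - f') dx1 + a dx2. The potential
  is the logarithm of the multiplier.\<close>

lemma potential_sol2:
  assumes S: "open S" "convex S" "p \<in> S" "S \<subseteq> good a"
    and a: "slope_deriv sl a = - (\<delta>2 sl * a) - \<delta>2 (\<delta>2 sl)"
  obtains \<phi> where "hol2 \<phi> S" "\<phi> p = 0"
    "\<forall>z\<in>S. pd1 \<phi> z = - (slv z * ratfun_eval a z) - ratfun_eval (\<delta>2 sl) z" "\<forall>z\<in>S. pd2 \<phi> z = ratfun_eval a z"
proof -
  let ?P = "- (sl * a) - \<delta>2 sl"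
  have reg: "regular_at ?P z" if "z \<in> S" for z
    using good_subsetD[OF S(4) that] by (simp add: ratfun_eval_diff ratfun_eval_minus ratfun_eval_mult)
  have "\<delta>1 a = \<delta>2 ?P"
    using a by (simp add: slope_deriv_def \<delta>2.diff \<delta>2.minus \<delta>2.mult algebra_simps)
  then have closed: "pd1 (ratfun_eval a) z = pd2 (ratfun_eval ?P) z" if "z \<in> S" for z
    using ratfun_eval_nbhd(3)[OF good_subsetD(2)[OF S(4) that]] ratfun_eval_nbhd(5)[OF reg[OF that]] by simp
  have hP: "hol2 (ratfun_eval ?P) S" by (rule hol2_ratfun_eval[OF reg])
  obtain \<phi> where "hol2 \<phi> S" "\<phi> p = 0" "\<And>z. z \<in> S \<Longrightarrow> pd1 \<phi> z = ratfun_eval ?P z"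
    "\<And>z. z \<in> S \<Longrightarrow> pd2 \<phi> z = ratfun_eval a z"
    using Poincare_hol2[OF S(1,2) hP hol2_good(1)[OF S(4)] closed S(3)] by blast
  moreover have "ratfun_eval ?P z = - (slv z * ratfun_eval a z) - ratfun_eval (\<delta>2 sl) z" if "z \<in> S" for z
    using good_subsetD[OF S(4) that] by (simp add: ratfun_eval_diff ratfun_eval_minus ratfun_eval_mult)
  ultimately show ?thesis using that by simp
qed

lemma u_system_iff:
  assumes "open S"
  shows "u_system X1 X2 a S u \<longleftrightarrow> hol2 u S \<and> (\<forall>z\<in>S.
      pd1 u z = - ratfun_eval (\<delta>2 (\<delta>2 sl)) z - slv z * ratfun_eval a z
        - ratfun_eval (\<delta>2 sl) z * u z - 1 / 2 * slv z * (u z)\<^sup>2 \<and>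
      pd2 u z = ratfun_eval a z + 1 / 2 * (u z)\<^sup>2)"
  using analytic2_iff_hol2[OF assms] by (simp add: u_system_def slope_def Let_def)

text \<open>Substituting the second equation of the system into \<delta>2 (- f' - f u) gives the
  right-hand side of the first, so (- f' - f u) dx1 + u dx2 is closed.\<close>

lemma potential_u_system:
  assumes S: "open S" "convex S" "p \<in> S" "S \<subseteq> good a" and u: "u_system X1 X2 a S u"
  obtains \<phi> where "hol2 \<phi> S" "\<phi> p = 0"
    "\<forall>z\<in>S. pd1 \<phi> z = - ratfun_eval (\<delta>2 sl) z - slv z * u z" "\<forall>z\<in>S. pd2 \<phi> z = u z"
proof -
  have hu: "hol2 u S" and pd: "\<And>z. z \<in> S \<Longrightarrow> pd1 u z = - ratfun_eval (\<delta>2 (\<delta>2 sl)) z - slv z * ratfun_eval a z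
        - ratfun_eval (\<delta>2 sl) z * u z - 1 / 2 * slv z * (u z)\<^sup>2"
    "\<And>z. z \<in> S \<Longrightarrow> pd2 u z = ratfun_eval a z + 1 / 2 * (u z)\<^sup>2"
    using u u_system_iff[OF S(1)] by auto
  note h = hol2_good[OF S(4)]
  let ?P = "\<lambda>z. - ratfun_eval (\<delta>2 sl) z - slv z * u z"
  have hP: "hol2 ?P S" by (intro hol2_intros h hu)
  have closed: "pd1 u z = pd2 ?P z" if z: "z \<in> S" for z
  proof -
    note g = good_subsetD[OF S(4) z]
    have "pd2 ?P z = - ratfun_eval (\<delta>2 (\<delta>2 sl)) z - (ratfun_eval (\<delta>2 sl) z * u z + slv z * pd2 u z)"
      using ratfun_eval_nbhd(5)[OF g(3)] ratfun_eval_nbhd(5)[OF g(4)]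
      by (simp add: pd_diff[OF hol2_minus[OF h(3)] hol2_mult[OF h(2) hu] z] pd_minus[OF h(3) z]
          pd_mult[OF h(2) hu z])
    then show ?thesis
      unfolding pd(1)[OF z] pd(2)[OF z] by (simp add: algebra_simps)
  qed
  obtain \<phi> where "hol2 \<phi> S" "\<phi> p = 0" "\<And>z. z \<in> S \<Longrightarrow> pd1 \<phi> z = ?P z"
    "\<And>z. z \<in> S \<Longrightarrow> pd2 \<phi> z = u z"
    using Poincare_hol2[OF S(1,2) hP hu closed S(3)] by blast
  then show ?thesis using that by simp
qed

lemma exp_multiplier:
  assumes "hol2 \<phi> S" "z \<in> S" "pd1 \<phi> z + slv z * pd2 \<phi> z = - ratfun_eval (\<delta>2 sl) z"
  shows "pd1 (\<lambda>z. exp (\<phi> z)) z + slv z * pd2 (\<lambda>z. exp (\<phi> z)) z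
    = - (ratfun_eval (\<delta>2 sl) z * exp (\<phi> z))"
proof -
  have "pd1 (\<lambda>z. exp (\<phi> z)) z + slv z * pd2 (\<lambda>z. exp (\<phi> z)) z = exp (\<phi> z) * (pd1 \<phi> z + slv z * pd2 \<phi> z)"
    unfolding pd_exp[OF assms(1,2)] by (simp add: algebra_simps)
  then show ?thesis using assms(3) by simp
qed

text \<open>With a primitive G of g, the product e exp(- G) has derivative 0 and vanishes at
  b.\<close>

lemma linear_ode_zero:
  fixes e g :: "complex \<Rightarrow> complex"
  assumes g: "g holomorphic_on ball b r"
    and e: "\<And>w. w \<in> ball b r \<Longrightarrow> (e has_field_derivative g w * e w) (at w)" "e b = 0"
    and w: "w \<in> ball b r"
  shows "e w = 0"
proof -
  obtain G where G: "\<And>w. w \<in> ball b r \<Longrightarrow> (G has_field_derivative g w) (at w within ball b r)"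
    using holomorphic_convex_primitive'[OF convex_ball open_ball g] by blast
  have "((\<lambda>w. e w * exp (- G w)) has_field_derivative 0) (at w within ball b r)" if w: "w \<in> ball b r" for w
    by (rule derivative_eq_intros has_field_derivative_at_within[OF e(1)[OF w]] G[OF w] refl)+ simp
  then have "\<exists>c. \<forall>w\<in>ball b r. e w * exp (- G w) = c"
    by (intro has_field_derivative_zero_constant) auto
  then obtain c where c: "\<And>w. w \<in> ball b r \<Longrightarrow> e w * exp (- G w) = c" by blast
  have "b \<in> ball b r" using w le_less_trans[OF zero_le_dist[of b w]] by simp
  from c[OF this] e(2) have "c = 0" by simp
  with c[OF w] show ?thesis by simp
qed

text \<open>First solve along \<open>x\<^sub>2 = p\<^sub>2\<close>, then in the direction of \<open>x\<^sub>2\<close>. The defect \<open>E\<close> of the first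
  equation satisfies \<open>\<delta>2 E = u E\<close> by the integrability condition on \<open>a\<close>, hence vanishes.\<close>

lemma u_system_exists:
  assumes p: "p \<in> good a" and a: "slope_deriv sl a = - (2 * \<delta>2 sl * a) - \<delta>2 (\<delta>2 (\<delta>2 sl))"
  obtains S u where "open S" "convex S" "p \<in> S" "S \<subseteq> good a" "u_system X1 X2 a S u"
proof -
  let ?A = "ratfun_eval a" and ?F1 = "ratfun_eval (\<delta>2 sl)" and ?F2 = "ratfun_eval (\<delta>2 (\<delta>2 sl))"
  \<comment> \<open>The ordinary equation along x2 = p2 enters the two-variable existence lemma with
    a dummy first coordinate: \<open>?i\<close> takes the actual variable x1 from the second
    coordinate.\<close>
  let ?i = "\<lambda>z :: complex \<times> complex. (snd z, snd p)"
  let ?T = "?i -` good a"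
  have T: "open ?T" by (intro open_vimage open_good continuous_intros)
  have slice: "hol2 (\<lambda>z. g (?i z)) ?T" if "hol2 g (good a)" for g
    unfolding hol2_def
  proof (intro conjI ballI)
    show "continuous_on ?T (\<lambda>z. g (?i z))"
      by (rule continuous_on_compose2[OF hol2_D(1)[OF that]]) (auto intro!: continuous_intros)
    fix z assume "z \<in> ?T"
    then show "(\<lambda>w. g (?i (fst z, w))) field_differentiable at (snd z)"
      using hol2_D(2)[OF that, of "?i z"] by (auto simp: field_differentiable_def)
  qed simp
  note h = hol2_good[OF order_refl, of a]
  have c: "hol2 (\<lambda>z. - ?F2 (?i z) - slv (?i z) * ?A (?i z)) ?T" "hol2 (\<lambda>z. - ?F1 (?i z)) ?T"
    "hol2 (\<lambda>z. - 1 / 2 * slv (?i z)) ?T"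
    by (intro hol2_intros slice h)+
  have "(0, fst p) \<in> ?T" using p by simp
  from Riccati_hol2[OF T this c holomorphic_on_const zero_less_one, of 0]
  obtain r0 v0 where v0: "r0 > 0" "ball 0 r0 \<times> ball (fst p) r0 \<subseteq> ?T" "hol2 v0 (ball 0 r0 \<times> ball (fst p) r0)"
    "\<forall>z1\<in>ball 0 r0. v0 (z1, fst p) = 0"
    "\<forall>z\<in>ball 0 r0 \<times> ball (fst p) r0. pd2 v0 z
      = (- ?F2 (?i z) - slv (?i z) * ?A (?i z)) + - ?F1 (?i z) * v0 z + (- 1 / 2 * slv (?i z)) * (v0 z)\<^sup>2"
    by (elim exE conjE)
  define v where "v = (\<lambda>w. v0 (0, w))"
  have v_deriv: "(v has_field_derivative - ?F2 (w, snd p) - slv (w, snd p) * ?A (w, snd p)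
      - ?F1 (w, snd p) * v w - 1 / 2 * slv (w, snd p) * (v w)\<^sup>2) (at w)" if "w \<in> ball (fst p) r0" for w
    using hol2_D(3)[OF v0(3), of "(0, w)"] v0(5)[rule_format, of "(0, w)"] v0(1) that by (simp add: v_def)
  then have v_hol: "v holomorphic_on ball (fst p) r0"
    unfolding holomorphic_on_open[OF open_ball] by blast
  have "(fst p, snd p) \<in> good a" using p by simp
  from Riccati_hol2[OF open_good this h(1) hol2_const hol2_const v_hol v0(1), of 0 "1 / 2"]
  obtain r1 u1 where r1: "r1 > 0" "ball (fst p) r1 \<times> ball (snd p) r1 \<subseteq> good a"
    "hol2 u1 (ball (fst p) r1 \<times> ball (snd p) r1)"
    "\<forall>z1\<in>ball (fst p) r1. u1 (z1, snd p) = v z1"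
    "\<forall>z\<in>ball (fst p) r1 \<times> ball (snd p) r1. pd2 u1 z = ?A z + 0 * u1 z + 1 / 2 * (u1 z)\<^sup>2"
    by (elim exE conjE)
  define r where "r = min r0 r1"
  let ?S = "ball (fst p) r \<times> ball (snd p) r"
  have sub1: "?S \<subseteq> ball (fst p) r1 \<times> ball (snd p) r1" by (auto simp: r_def)
  have r: "r > 0" using v0 r1 by (simp add: r_def)
  have S: "open ?S" "convex ?S" "p \<in> ?S" "?S \<subseteq> good a"
    using r r1(2) sub1 by (auto intro: open_Times convex_Times simp: mem_Times_iff)
  have u: "hol2 u1 ?S" using hol2_subset[OF r1(3) sub1] .
  have pd2u: "pd2 u1 z = ?A z + 1 / 2 * (u1 z)\<^sup>2" if "z \<in> ?S" for z
    using r1(5)[rule_format, OF subsetD[OF sub1 that]] by simp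
  note hS = hol2_good[OF S(4)]
  define E where "E = (\<lambda>z. pd1 u1 z + (?F2 z + (slv z * ?A z + (?F1 z * u1 z + 1 / 2 * (slv z * (u1 z * u1 z))))))"
  have hp: "hol2 (pd1 u1) ?S" by (rule hol2_pd1[OF u S(1)])
  have hE: "hol2 E ?S"
    unfolding E_def by (intro hol2_intros hp hS u)
  have pd2E: "pd2 E z = u1 z * E z" if z: "z \<in> ?S" for z
  proof -
    note g = good_subsetD[OF S(4) z]
    note d = ratfun_eval_nbhd(5)[OF g(2)] ratfun_eval_nbhd(5)[OF g(3)] ratfun_eval_nbhd(5)[OF g(4)]
      ratfun_eval_nbhd(5)[OF g(5)] ratfun_eval_nbhd(3)[OF g(2)]
    have mixed: "pd2 (pd1 u1) z = ratfun_eval (\<delta>1 a) z + u1 z * pd1 u1 z"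
    proof -
      have "pd2 (pd1 u1) z = pd1 (pd2 u1) z" by (rule pd2_pd1[OF u S(1) z])
      also have "\<dots> = pd1 (\<lambda>z. ?A z + 1 / 2 * (u1 z)\<^sup>2) z"
        by (rule pd_cong_open[OF S(1) z pd2u])
      also have "\<dots> = ratfun_eval (\<delta>1 a) z + u1 z * pd1 u1 z"
      proof -
        have "pd1 (\<lambda>z. 1 / 2 * (u1 z)\<^sup>2) z = u1 z * pd1 u1 z"
          unfolding pd_mult(1)[OF hol2_const hol2_power[OF u] z] pd_power(1)[OF u z]
          by (simp add: pd1_def)
        moreover have "hol2 (\<lambda>z. 1 / 2 * (u1 z)\<^sup>2) ?S"
          by (intro hol2_mult hol2_const hol2_power u)
        ultimately show ?thesis
          using pd_add(1)[OF hS(1) _ z] d(5) by metis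
      qed
      finally show ?thesis .
    qed
    have K: "ratfun_eval (\<delta>1 a) z + slv z * ratfun_eval (\<delta>2 a) z
        = - (2 * ?F1 z * ?A z) - ratfun_eval (\<delta>2 (\<delta>2 (\<delta>2 sl))) z"
      using slope_deriv_eval(2)[OF g(1,2)] g unfolding a
      by (simp add: ratfun_eval_diff ratfun_eval_minus ratfun_eval_mult)
    have uu: "hol2 (\<lambda>z. u1 z * u1 z) ?S" "hol2 (\<lambda>z. slv z * (u1 z * u1 z)) ?S" "hol2 (\<lambda>z. ?F1 z * u1 z) ?S"
      "hol2 (\<lambda>z. slv z * ?A z) ?S" "hol2 (\<lambda>z. 1 / 2 * (slv z * (u1 z * u1 z))) ?S"
      by (intro hol2_intros hS u)+
    have half: "pd2 (\<lambda>z. 1 / 2 * (slv z * (u1 z * u1 z))) z = 1 / 2 * pd2 (\<lambda>z. slv z * (u1 z * u1 z)) z"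
      unfolding pd_mult(2)[OF hol2_const uu(2) z] by (simp add: pd2_def[of "\<lambda>_. _"])
    have E2: "pd2 E z = pd2 (pd1 u1) z + (ratfun_eval (\<delta>2 (\<delta>2 (\<delta>2 sl))) z
        + ((?F1 z * ?A z + slv z * ratfun_eval (\<delta>2 a) z) + ((?F2 z * u1 z + ?F1 z * pd2 u1 z)
        + 1 / 2 * (?F1 z * (u1 z * u1 z) + slv z * (pd2 u1 z * u1 z + u1 z * pd2 u1 z)))))"
      unfolding E_def
      by (simp only: half d pd_add[OF hp hol2_add[OF hS(4) hol2_add[OF uu(4) hol2_add[OF uu(3,5)]]] z]
          pd_add[OF hS(4) hol2_add[OF uu(4) hol2_add[OF uu(3,5)]] z]
          pd_add[OF uu(4) hol2_add[OF uu(3,5)] z] pd_add[OF uu(3,5) z]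
          pd_mult[OF hS(2,1) z] pd_mult[OF hS(3) u z] pd_mult[OF hS(2) uu(1) z] pd_mult[OF u u z])
    have a1: "ratfun_eval (\<delta>1 a) z = - (2 * ?F1 z * ?A z) - ratfun_eval (\<delta>2 (\<delta>2 (\<delta>2 sl))) z - slv z * ratfun_eval (\<delta>2 a) z"
      using K by (simp add: algebra_simps)
    have Ez: "E z = pd1 u1 z + (?F2 z + (slv z * ?A z + (?F1 z * u1 z + 1 / 2 * (slv z * (u1 z * u1 z)))))"
      by (simp only: E_def)
    show ?thesis
      unfolding E2 mixed a1 Ez pd2u[OF z] by (simp add: power2_eq_square field_simps)
  qed
  have E0: "E z = 0" if z: "z \<in> ?S" for z
  proof -
    have sl: "(fst z, w) \<in> ?S" if "w \<in> ball (snd p) r" for w using z that by auto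
    have "E (fst z, snd z) = 0"
    proof (rule linear_ode_zero[of "\<lambda>w. u1 (fst z, w)" "snd p" r "\<lambda>w. E (fst z, w)"])
      show "(\<lambda>w. u1 (fst z, w)) holomorphic_on ball (snd p) r"
        using sl by (intro hol2_slice2[OF u]) auto
      show "((\<lambda>w. E (fst z, w)) has_field_derivative u1 (fst z, w) * E (fst z, w)) (at w)"
        if "w \<in> ball (snd p) r" for w
        using hol2_D(3)[OF hE sl[OF that]] pd2E[OF sl[OF that]] by simp
      have z1: "fst z \<in> ball (fst p) r" using z by auto
      \<comment> \<open>On the line x2 = p2 the defect vanishes because v was chosen to satisfy the
        first equation there.\<close>
      have "pd1 u1 (fst z, snd p) = deriv v (fst z)"
        unfolding pd1_def fst_conv snd_conv
      proof (rule deriv_cong_ev[OF _ refl])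
        have "\<forall>\<^sub>F w in nhds (fst z). w \<in> ball (fst p) r1"
          using z1 by (intro eventually_nhds_in_open) (auto simp: r_def)
        then show "\<forall>\<^sub>F w in nhds (fst z). u1 (w, snd p) = v w"
          by eventually_elim (rule r1(4)[rule_format])
      qed
      also have "\<dots> = - ?F2 (fst z, snd p) - slv (fst z, snd p) * ?A (fst z, snd p)
          - ?F1 (fst z, snd p) * v (fst z) - 1 / 2 * slv (fst z, snd p) * (v (fst z))\<^sup>2"
        by (rule DERIV_imp_deriv[OF v_deriv]) (use z1 in \<open>auto simp: r_def\<close>)
      finally show "E (fst z, snd p) = 0"
        using r1(4)[rule_format, of "fst z"] z1 by (simp add: E_def power2_eq_square r_def)
    qed (use z in auto)
    then show ?thesis by simp
  qed
  have "pd1 u1 z = - ?F2 z - slv z * ?A z - ?F1 z * u1 z - 1 / 2 * slv z * (u1 z)\<^sup>2" if "z \<in> ?S" for z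
    using E0[OF that] by (simp add: E_def power2_eq_square algebra_simps eq_neg_iff_add_eq_0)
  then have "u_system X1 X2 a ?S u1"
    using u pd2u by (simp add: u_system_iff[OF S(1)])
  then show ?thesis using that S by blast
qed

end

section \<open>Equations of orders 0 to 3 satisfied by first integrals\<close>

lemma jets:
  assumes S: "open S" and \<omega>: "hol2 \<omega> S" and \<alpha>: "hol2 \<alpha> S" and u: "hol2 u S"
    and d: "\<forall>z\<in>S. pd2 \<omega> z = \<alpha> z" "\<forall>z\<in>S. pd2 \<alpha> z = u z * \<alpha> z" and z: "z \<in> S"
  shows "jet \<omega> (0, 1) z = \<alpha> z" "jet \<omega> (0, 2) z = u z * \<alpha> z"
    "jet \<omega> (0, 3) z = (pd2 u z + (u z)\<^sup>2) * \<alpha> z"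
    and "jet (\<lambda>z. \<omega> z * \<omega> z) (0, 1) z = 2 * \<omega> z * \<alpha> z"
    "jet (\<lambda>z. \<omega> z * \<omega> z) (0, 2) z = 2 * (\<alpha> z)\<^sup>2 + 2 * \<omega> z * u z * \<alpha> z"
    "jet (\<lambda>z. \<omega> z * \<omega> z) (0, 3) z = 6 * u z * (\<alpha> z)\<^sup>2 + 2 * \<omega> z * (pd2 u z + (u z)\<^sup>2) * \<alpha> z"
proof -
  have D: "((\<lambda>w. \<omega> (fst z, w)) has_field_derivative \<alpha> z) (at (snd z))"
    "((\<lambda>w. \<alpha> (fst z, w)) has_field_derivative u z * \<alpha> z) (at (snd z))"
    "((\<lambda>w. u (fst z, w)) has_field_derivative pd2 u z) (at (snd z))" if "z \<in> S" for z
    using hol2_D(3)[OF \<omega> that] hol2_D(3)[OF \<alpha> that] hol2_D(3)[OF u that] d that by simp_all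
  have 1: "jet \<omega> (0, Suc 0) z = \<alpha> z" if "z \<in> S" for z
    using d(1) that by (simp add: jet_Suc jet_0)
  have 2: "jet \<omega> (0, Suc (Suc 0)) z = u z * \<alpha> z" if "z \<in> S" for z
    using jet_Suc_cong[OF S that 1] d(2) that by simp
  have 3: "jet \<omega> (0, Suc (Suc (Suc 0))) z = (pd2 u z + (u z)\<^sup>2) * \<alpha> z" if "z \<in> S" for z
  proof -
    have "pd2 (\<lambda>z. u z * \<alpha> z) z = (pd2 u z + (u z)\<^sup>2) * \<alpha> z"
      by (rule pd_eqI(2), rule DERIV_cong[OF DERIV_mult[OF D(3)[OF that] D(2)[OF that]]])
        (simp add: power2_eq_square algebra_simps)
    then show ?thesis using jet_Suc_cong[OF S that 2] by simp
  qed
  show "jet \<omega> (0, 1) z = \<alpha> z" "jet \<omega> (0, 2) z = u z * \<alpha> z"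
    "jet \<omega> (0, 3) z = (pd2 u z + (u z)\<^sup>2) * \<alpha> z"
    using 1[OF z] 2[OF z] 3[OF z] by (simp_all add: numeral_2_eq_2 numeral_3_eq_3)
  let ?q = "\<lambda>z. \<omega> z * \<omega> z"
  have 1: "jet ?q (0, Suc 0) z = 2 * \<omega> z * \<alpha> z" if "z \<in> S" for z
    unfolding jet_Suc jet_0
    by (rule pd_eqI(2), rule DERIV_cong[OF DERIV_mult[OF D(1)[OF that] D(1)[OF that]]]) simp
  have 2: "jet ?q (0, Suc (Suc 0)) z = 2 * (\<alpha> z)\<^sup>2 + 2 * \<omega> z * u z * \<alpha> z" if "z \<in> S" for z
  proof -
    have "pd2 (\<lambda>z. 2 * \<omega> z * \<alpha> z) z = 2 * (\<alpha> z)\<^sup>2 + 2 * \<omega> z * u z * \<alpha> z"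
      by (rule pd_eqI(2)) (rule derivative_eq_intros D[OF that] refl | simp add: power2_eq_square algebra_simps)+
    then show ?thesis using jet_Suc_cong[OF S that 1] by simp
  qed
  have 3: "jet ?q (0, Suc (Suc (Suc 0))) z = 6 * u z * (\<alpha> z)\<^sup>2 + 2 * \<omega> z * (pd2 u z + (u z)\<^sup>2) * \<alpha> z"
    if "z \<in> S" for z
  proof -
    have "pd2 (\<lambda>z. 2 * (\<alpha> z)\<^sup>2 + 2 * \<omega> z * u z * \<alpha> z) z
        = 6 * u z * (\<alpha> z)\<^sup>2 + 2 * \<omega> z * (pd2 u z + (u z)\<^sup>2) * \<alpha> z"
      by (rule pd_eqI(2)) (rule derivative_eq_intros D[OF that] refl | simp add: power2_eq_square algebra_simps)+
    then show ?thesis using jet_Suc_cong[OF S that 2] by simp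
  qed
  show "jet ?q (0, 1) z = 2 * \<omega> z * \<alpha> z"
    "jet ?q (0, 2) z = 2 * (\<alpha> z)\<^sup>2 + 2 * \<omega> z * u z * \<alpha> z"
    "jet ?q (0, 3) z = 6 * u z * (\<alpha> z)\<^sup>2 + 2 * \<omega> z * (pd2 u z + (u z)\<^sup>2) * \<alpha> z"
    using 1[OF z] 2[OF z] 3[OF z] by (simp_all add: numeral_2_eq_2 numeral_3_eq_3)
qed

lemma jet_zero: "jet (\<lambda>_. 0) v z = 0"
proof -
  have "(pd2 ^^ j) (\<lambda>_. 0) = (\<lambda>_. 0)" for j
    by (induction j) (simp_all add: pd2_def fun_eq_iff)
  moreover have "(pd1 ^^ i) (\<lambda>_. 0) = (\<lambda>_. 0)" for i
    by (induction i) (simp_all add: pd1_def fun_eq_iff)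
  ultimately show ?thesis by (simp add: jet_def)
qed

lemma dpoly_apply_simps:
  "z \<notin> dpoly_singular A \<Longrightarrow> z \<notin> dpoly_singular B \<Longrightarrow> z \<notin> dpoly_singular (A * B)"
  "z \<notin> dpoly_singular A \<Longrightarrow> z \<notin> dpoly_singular B \<Longrightarrow>
    dpoly_apply (A * B) u z = dpoly_apply A u z * dpoly_apply B u z"
  using dpoly_apply_mult by blast+

lemma not_in_vanishing_ideal:
  "z \<in> S \<Longrightarrow> z \<notin> dpoly_singular A \<Longrightarrow> dpoly_apply A u z \<noteq> 0 \<Longrightarrow> A \<notin> vanishing_ideal S u"
  unfolding vanishing_ideal_def by blast

context
  fixes X1 X2 :: bipoly
  assumes X1: "X1 \<noteq> 0"
begin

text \<open>The equation is y - a = 0. The zero function satisfies the operator but violates this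
  equation where a is nonzero, and such a point exists because a is nonconstant.\<close>

lemma vf_ord_first_integral:
  assumes "has_rational_first_integral X1 X2"
  shows "vf_ord X1 X2 \<le> enat 0"
proof -
  obtain a S where reg: "\<And>z. z \<in> S \<Longrightarrow> regular_at a z" and fi: "first_integral X1 X2 S (ratfun_eval a)"
    using assms unfolding has_rational_first_integral_def by blast
  then have S: "open S" "connected S" "S \<noteq> {}" and u: "hol2 (ratfun_eval a) S"
    "\<not> ratfun_eval a constant_on S" "annihilates X1 X2 S (ratfun_eval a)"
    by (auto simp: first_integral_iff)
  let ?G = "var (0, 0) + const (- a)"
  have G: "z \<notin> dpoly_singular ?G" "dpoly_apply ?G v z = v z - ratfun_eval a z" if "z \<in> S" for v z
    using reg[OF that] by (simp_all add: dpoly_apply_add dpoly_apply_const dpoly_apply_var ratfun_eval_minus jet_0)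
  obtain z where z: "z \<in> S" "ratfun_eval a z \<noteq> 0"
    using u(2) unfolding constant_on_def by blast
  show ?thesis
  proof (rule vf_ord_le_vanishing[OF S u hol2_const annihilates_zero])
    show "?G \<in> vanishing_ideal S (ratfun_eval a)"
      using G by (simp add: vanishing_ideal_def)
    show "?G \<notin> vanishing_ideal S (\<lambda>_. 0)"
      using z(2) G(2)[OF z(1)] by (intro not_in_vanishing_ideal[OF z(1) G(1)[OF z(1)]]) simp
    show "dvars ?G \<subseteq> ycols 0"
      using dvars_add[of "var (0, 0)" "const (- a)"] dvars_single[of 0 "- a"]
      by (auto simp: dvars_var ycols_def)
  qed
qed

text \<open>The first integral is built so that \<delta>2 \<omega> is a branch of the n-th root of
  a; hence the equation \<open>y\<^sub>1\<^sup>n - a = 0\<close>, again violated by the zero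
  function.\<close>

lemma vf_ord_sol1:
  assumes "slope_sol1 (slope X1 X2)"
  shows "vf_ord X1 X2 \<le> enat 1"
proof -
  obtain a n where a: "a \<noteq> 0" "n > 0" and eq: "slope_deriv (slope X1 X2) a = - (of_nat n * \<delta>2 (slope X1 X2) * a)"
    using assms unfolding slope_sol1_def by blast
  have eq': "slope_deriv (slope X1 X2) a = - (of_int (int n) * \<delta>2 (slope X1 X2) * a)"
    using eq by simp
  have n: "int n \<noteq> 0" using a(2) by simp
  obtain p where p: "p \<in> good X1 a" "ratfun_eval a p \<noteq> 0"
    using good_nonempty[OF X1, of a] a(1) by blast
  obtain S \<alpha> where S: "open S" "convex S" "p \<in> S" "S \<subseteq> good X1 a" and root: "root_branch a (int n) S \<alpha>"
    using root_branch_exists[OF X1 p n] by metis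
  note m = root_branch_multiplier[OF X1 S(1,4) root n eq']
  obtain \<omega> where \<omega>: "hol2 \<omega> S" "\<not> \<omega> constant_on S" "annihilates X1 X2 S \<omega>" "\<forall>z\<in>S. pd2 \<omega> z = \<alpha> z"
    using first_integral_of_multiplier[OF X1 S m(1) _ m(3)] m(2) S(3) by blast
  let ?G = "single (single (0, 1) n) 1 + const (- a)"
  have reg: "regular_at a z" if "z \<in> S" for z using good_subsetD(2)[OF X1 S(4) that] .
  have G: "z \<notin> dpoly_singular ?G" "dpoly_apply ?G v z = jet v (0, 1) z ^ n - ratfun_eval a z" if "z \<in> S" for v z
    using reg[OF that] a(2) by (simp_all add: dpoly_apply_add dpoly_apply_const dpoly_apply_single ratfun_eval_minus mon_eval_def)
  show ?thesis
  proof (rule vf_ord_le_vanishing[OF S(1) convex_connected[OF S(2)] _ \<omega>(1-3) hol2_const annihilates_zero])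
    show "S \<noteq> {}" using S(3) by blast
    have "jet \<omega> (0, 1) z ^ n = ratfun_eval a z" if "z \<in> S" for z
      using \<omega>(4) root that by (simp add: root_branch_def jet_def)
    then show "?G \<in> vanishing_ideal S \<omega>"
      using G(2) by (simp add: vanishing_ideal_def)
    show "?G \<notin> vanishing_ideal S (\<lambda>_. 0)"
      using G(2)[OF S(3)] p(2) a(2)
      by (intro not_in_vanishing_ideal[OF S(3) G(1)[OF S(3)]]) (simp add: jet_zero zero_power)
    show "dvars ?G \<subseteq> ycols 1"
      using dvars_add[of "single (single (0, 1) n) 1" "const (- a)"] dvars_single[of 0 "- a"]
        dvars_single[of "single (0, 1) n" 1] a(2)
      by (auto simp: ycols_def)
  qed
qed

text \<open>Here a is the logarithmic derivative of \<alpha> = \<delta>2 \<omega> in x2, hence the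
  equation \<open>y\<^sub>2 - a y\<^sub>1 = 0\<close>. It is linear, so the second solution is
  \<omega>^2, at which its left-hand side is 2 \<alpha>^2.\<close>

lemma vf_ord_sol2:
  assumes "slope_sol2 (slope X1 X2)"
  shows "vf_ord X1 X2 \<le> enat 2"
proof -
  obtain a where eq: "slope_deriv (slope X1 X2) a = - (\<delta>2 (slope X1 X2) * a) - \<delta>2 (\<delta>2 (slope X1 X2))"
    using assms unfolding slope_sol2_def by blast
  obtain p where p: "p \<in> good X1 a"
    using good_nonempty[OF X1, of a] by blast
  obtain S where S: "open S" "convex S" "p \<in> S" "S \<subseteq> good X1 a"
    using exists_nbhd_box[OF open_good[OF X1] p] .
  obtain \<phi> where \<phi>: "hol2 \<phi> S" "\<phi> p = 0"
    "\<forall>z\<in>S. pd1 \<phi> z = - (ratfun_eval (slope X1 X2) z * ratfun_eval a z) - ratfun_eval (\<delta>2 (slope X1 X2)) z"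
    "\<forall>z\<in>S. pd2 \<phi> z = ratfun_eval a z"
    using potential_sol2[OF X1 S eq] .
  let ?\<alpha> = "\<lambda>z. exp (\<phi> z)"
  have m: "pd1 ?\<alpha> z + ratfun_eval (slope X1 X2) z * pd2 ?\<alpha> z = - (ratfun_eval (\<delta>2 (slope X1 X2)) z * ?\<alpha> z)"
    if "z \<in> S" for z
    by (rule exp_multiplier[OF X1 \<phi>(1) that]) (use \<phi>(3,4) that in simp)
  obtain \<omega> where \<omega>: "hol2 \<omega> S" "\<not> \<omega> constant_on S" "annihilates X1 X2 S \<omega>" "\<forall>z\<in>S. pd2 \<omega> z = ?\<alpha> z"
    using first_integral_of_multiplier[OF X1 S hol2_exp[OF \<phi>(1)] _ m] by auto
  have d\<alpha>: "\<forall>z\<in>S. pd2 ?\<alpha> z = ratfun_eval a z * ?\<alpha> z"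
    using pd_exp(2)[OF \<phi>(1)] \<phi>(4) by simp
  note J = jets[OF S(1) \<omega>(1) hol2_exp[OF \<phi>(1)] hol2_good(1)[OF X1 S(4)] \<omega>(4) d\<alpha>]
  let ?G = "var (0, 2) + const (- a) * var (0, 1)"
  have reg: "regular_at a z" if "z \<in> S" for z using good_subsetD(2)[OF X1 S(4) that] .
  have G: "z \<notin> dpoly_singular ?G" "dpoly_apply ?G v z = jet v (0, 2) z - ratfun_eval a z * jet v (0, 1) z"
    if "z \<in> S" for v z
    using reg[OF that] by (simp_all add: dpoly_apply_add dpoly_apply_simps dpoly_apply_const dpoly_apply_var ratfun_eval_minus)
  show ?thesis
  proof (rule vf_ord_le_vanishing[OF S(1) convex_connected[OF S(2)] _ \<omega>(1-3)
        hol2_mult[OF \<omega>(1,1)] annihilates_square[OF \<omega>(1,3)]])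
    show "S \<noteq> {}" using S(3) by blast
    show "?G \<in> vanishing_ideal S \<omega>"
      using G(2) J(1,2) by (simp add: vanishing_ideal_def)
    have "dpoly_apply ?G (\<lambda>z. \<omega> z * \<omega> z) p = 2 * (?\<alpha> p)\<^sup>2"
      unfolding G(2)[OF S(3)] J(4)[OF S(3)] J(5)[OF S(3)] by (simp add: algebra_simps)
    then have "dpoly_apply ?G (\<lambda>z. \<omega> z * \<omega> z) p \<noteq> 0" by simp
    then show "?G \<notin> vanishing_ideal S (\<lambda>z. \<omega> z * \<omega> z)"
      using G(1) S(3) by (intro not_in_vanishing_ideal)
    show "dvars ?G \<subseteq> ycols 2"
      using dvars_add[of "var (0, 2)" "const (- a) * var (0, 1)"] dvars_const_mult[of "var (0, 1)" "ycols 2" "- a"]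
      by (auto simp: dvars_var ycols_def)
  qed
qed

text \<open>The relation \<delta>2 u = a + u^2/2 says that a is the Schwarzian derivative of
  \<omega>. With denominators cleared it reads \<open>2 y\<^sub>1 y\<^sub>3 - 3 y\<^sub>2\<^sup>2 -
  2 a y\<^sub>1\<^sup>2 = 0\<close>. Squaring is not a Moebius map and does not preserve the
  Schwarzian: at \<omega>^2 the left-hand side is - 12 \<alpha>^4.\<close>

lemma vf_ord_sol3:
  assumes "slope_sol3 (slope X1 X2)"
  shows "vf_ord X1 X2 \<le> enat 3"
proof -
  obtain a where eq: "slope_deriv (slope X1 X2) a = - (2 * \<delta>2 (slope X1 X2) * a) - \<delta>2 (\<delta>2 (\<delta>2 (slope X1 X2)))"
    using assms unfolding slope_sol3_def by blast
  obtain p where p: "p \<in> good X1 a"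
    using good_nonempty[OF X1, of a] by blast
  obtain S u where S: "open S" "convex S" "p \<in> S" "S \<subseteq> good X1 a" and sys: "u_system X1 X2 a S u"
    using u_system_exists[OF X1 p eq] .
  have u: "hol2 u S" and pdu: "\<And>z. z \<in> S \<Longrightarrow> pd2 u z = ratfun_eval a z + 1 / 2 * (u z)\<^sup>2"
    using sys u_system_iff[OF X1 S(1)] by auto
  obtain \<phi> where \<phi>: "hol2 \<phi> S" "\<phi> p = 0"
    "\<forall>z\<in>S. pd1 \<phi> z = - ratfun_eval (\<delta>2 (slope X1 X2)) z - ratfun_eval (slope X1 X2) z * u z"
    "\<forall>z\<in>S. pd2 \<phi> z = u z"
    using potential_u_system[OF X1 S sys] .
  let ?\<alpha> = "\<lambda>z. exp (\<phi> z)"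
  have m: "pd1 ?\<alpha> z + ratfun_eval (slope X1 X2) z * pd2 ?\<alpha> z = - (ratfun_eval (\<delta>2 (slope X1 X2)) z * ?\<alpha> z)"
    if "z \<in> S" for z
    by (rule exp_multiplier[OF X1 \<phi>(1) that]) (use \<phi>(3,4) that in simp)
  obtain \<omega> where \<omega>: "hol2 \<omega> S" "\<not> \<omega> constant_on S" "annihilates X1 X2 S \<omega>" "\<forall>z\<in>S. pd2 \<omega> z = ?\<alpha> z"
    using first_integral_of_multiplier[OF X1 S hol2_exp[OF \<phi>(1)] _ m] by auto
  have d\<alpha>: "\<forall>z\<in>S. pd2 ?\<alpha> z = u z * ?\<alpha> z"
    using pd_exp(2)[OF \<phi>(1)] \<phi>(4) by simp
  note J = jets[OF S(1) \<omega>(1) hol2_exp[OF \<phi>(1)] u \<omega>(4) d\<alpha>]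
  let ?G = "const 2 * (var (0, 1) * var (0, 3)) + (const (- 3) * (var (0, 2) * var (0, 2))
    + const (- (2 * a)) * (var (0, 1) * var (0, 1)))"
  have reg: "regular_at a z" if "z \<in> S" for z using good_subsetD(2)[OF X1 S(4) that] .
  have G: "z \<notin> dpoly_singular ?G"
    "dpoly_apply ?G v z = 2 * (jet v (0, 1) z * jet v (0, 3) z) - 3 * (jet v (0, 2) z * jet v (0, 2) z)
      - 2 * ratfun_eval a z * (jet v (0, 1) z * jet v (0, 1) z)"
    if "z \<in> S" for v z
  proof -
    have "regular_at (- (2 * a)) z" "ratfun_eval (- (2 * a)) z = - (2 * ratfun_eval a z)"
      "regular_at (- 3) z" "ratfun_eval (- 3) z = - 3"
      using reg[OF that] by (simp_all add: ratfun_eval_minus ratfun_eval_mult)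
    then show "z \<notin> dpoly_singular ?G"
      "dpoly_apply ?G v z = 2 * (jet v (0, 1) z * jet v (0, 3) z) - 3 * (jet v (0, 2) z * jet v (0, 2) z)
        - 2 * ratfun_eval a z * (jet v (0, 1) z * jet v (0, 1) z)"
      by (simp_all add: dpoly_apply_add dpoly_apply_simps dpoly_apply_const dpoly_apply_var
          del: single_numeral)
  qed
  show ?thesis
  proof (rule vf_ord_le_vanishing[OF S(1) convex_connected[OF S(2)] _ \<omega>(1-3)
        hol2_mult[OF \<omega>(1,1)] annihilates_square[OF \<omega>(1,3)]])
    show "S \<noteq> {}" using S(3) by blast
    have "dpoly_apply ?G \<omega> z = 0" if z: "z \<in> S" for z
      unfolding G(2)[OF z] J(1)[OF z] J(2)[OF z] J(3)[OF z] pdu[OF z]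
      by (simp add: power2_eq_square field_simps)
    then show "?G \<in> vanishing_ideal S \<omega>"
      by (simp add: vanishing_ideal_def)
    have "dpoly_apply ?G (\<lambda>z. \<omega> z * \<omega> z) p = - 12 * (?\<alpha> p) ^ 4"
      unfolding G(2)[OF S(3)] J(4)[OF S(3)] J(5)[OF S(3)] J(6)[OF S(3)] pdu[OF S(3)]
      by (simp add: power2_eq_square power4_eq_xxxx field_simps)
    then have "dpoly_apply ?G (\<lambda>z. \<omega> z * \<omega> z) p \<noteq> 0" by simp
    then show "?G \<notin> vanishing_ideal S (\<lambda>z. \<omega> z * \<omega> z)"
      using G(1) S(3) by (intro not_in_vanishing_ideal)
    have vars: "dvars (var (0, i) * var (0, j)) \<subseteq> ycols 3" if "i \<le> 3" "j \<le> 3" for i j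
      using dvars_mult[of "var (0, i)" "var (0, j)"] that by (auto simp: dvars_var ycols_def)
    have sum: "dvars (A + B) \<subseteq> ycols 3" if "dvars A \<subseteq> ycols 3" "dvars B \<subseteq> ycols 3" for A B
      using dvars_add[of A B] that by blast
    show "dvars ?G \<subseteq> ycols 3"
      by (intro sum dvars_const_mult vars) auto
  qed
qed

text \<open>Thresholds in place of exact values: the solvability conditions are nested, so each
  threshold is equivalent to a single one of them, and exact orders follow from consecutive
  thresholds.\<close>

lemma vf_ord_le_iff:
  "vf_ord X1 X2 \<le> enat 0 \<longleftrightarrow> has_rational_first_integral X1 X2"
  "vf_ord X1 X2 \<le> enat 1 \<longleftrightarrow> slope_sol1 (slope X1 X2)"
  "vf_ord X1 X2 \<le> enat 2 \<longleftrightarrow> slope_sol2 (slope X1 X2)"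
  "vf_ord X1 X2 \<le> enat 3 \<longleftrightarrow> slope_sol3 (slope X1 X2)"
  "vf_ord X1 X2 = \<infinity> \<longleftrightarrow> \<not> slope_sol3 (slope X1 X2)"
proof -
  let ?s = "slope X1 X2"
  have imp: "has_rational_first_integral X1 X2 \<Longrightarrow> slope_sol1 ?s"
    "slope_sol1 ?s \<Longrightarrow> slope_sol2 ?s" "slope_sol2 ?s \<Longrightarrow> slope_sol3 ?s"
    using first_integral_imp_sol1[OF X1] slope_sol1_imp_sol2 slope_sol2_imp_sol3 by blast+
  obtain \<Lambda> where \<Lambda>: "nontrivial_expansion X1 X2 \<Lambda>" "expansion_ord \<Lambda> = vf_ord X1 X2"
    using vf_ord_attained by blast
  \<comment> \<open>An expansion attaining a finite order r forces one of the conditions relevant to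
    r; if the order is at most k, nesting then gives the condition for k.\<close>
  have fwd: "\<not> (\<not> has_rational_first_integral X1 X2 \<and> (r = 0 \<or> \<not> slope_sol1 ?s) \<and>
      (r \<le> 1 \<or> \<not> slope_sol2 ?s) \<and> (r \<le> 2 \<or> \<not> slope_sol3 ?s))" if "vf_ord X1 X2 = enat r" for r
    using expansion_solvable[OF X1 \<Lambda>(1)] \<Lambda>(2) that by metis
  have finite: "\<exists>r \<le> k. vf_ord X1 X2 = enat r" if "vf_ord X1 X2 \<le> enat k" for k
    using that by (cases "vf_ord X1 X2") auto
  show "vf_ord X1 X2 \<le> enat 0 \<longleftrightarrow> has_rational_first_integral X1 X2"
    using vf_ord_first_integral finite[of 0] fwd by fastforce
  show "vf_ord X1 X2 \<le> enat 1 \<longleftrightarrow> slope_sol1 ?s"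
    using vf_ord_sol1 finite[of 1] fwd imp by fastforce
  show "vf_ord X1 X2 \<le> enat 2 \<longleftrightarrow> slope_sol2 ?s"
    using vf_ord_sol2 finite[of 2] fwd imp by fastforce
  show "vf_ord X1 X2 \<le> enat 3 \<longleftrightarrow> slope_sol3 ?s"
    using vf_ord_sol3 finite[of 3] fwd imp by blast
  show "vf_ord X1 X2 = \<infinity> \<longleftrightarrow> \<not> slope_sol3 ?s"
    using vf_ord_sol3 fwd imp by (cases "vf_ord X1 X2") auto
qed

section \<open>Integrating factors near a given point\<close>

lemma good_nbhdI:
  assumes "open S" "convex S" "p \<in> S" "S \<subseteq> good X1 a"
  shows "good_nbhd X1 a p S"
  using assms good_subsetD(1,2)[OF X1 assms(4)] by (auto simp: good_nbhd_def convex_connected)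

lemma integrating_factor_exp:
  assumes S: "open S" "p \<in> S" "S \<subseteq> good X1 a" and \<phi>: "hol2 \<phi> S"
    and eq: "\<And>z. z \<in> S \<Longrightarrow> pd1 \<phi> z + ratfun_eval (slope X1 X2) z * pd2 \<phi> z = - ratfun_eval (\<delta>2 (slope X1 X2)) z"
  shows "integrating_factor X1 X2 S (\<lambda>z. 1 / bipoly_eval X1 z * exp (\<phi> z))"
proof -
  have "integrating_factor X1 X2 S (\<lambda>z. exp (\<phi> z) / bipoly_eval X1 z)"
  proof (rule integrating_factorI[OF X1 S(1) _ S(3) hol2_exp[OF \<phi>]])
    show "S \<noteq> {}" using S(2) by blast
    show "\<exists>z\<in>S. exp (\<phi> z) \<noteq> 0" using S(2) exp_not_eq_zero by blast
  qed (rule exp_multiplier[OF X1 \<phi> _ eq])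
  then show ?thesis by simp
qed

text \<open>The neighbourhood comes from the construction of one branch, but the argument by
  differentiating \<alpha>^n = a applies to every branch on it.\<close>

lemma local_integrating_factor1:
  assumes a: "n \<noteq> 0" "slope_deriv (slope X1 X2) a = - (of_int n * \<delta>2 (slope X1 X2) * a)"
    and p: "bipoly_eval X1 p \<noteq> 0" "regular_at a p" "ratfun_eval a p \<noteq> 0"
  shows "\<exists>S. good_nbhd X1 a p S \<and> (\<exists>\<alpha>. root_branch a n S \<alpha>) \<and>
    (\<forall>\<alpha>. root_branch a n S \<alpha> \<longrightarrow> integrating_factor X1 X2 S (\<lambda>z. \<alpha> z / bipoly_eval X1 z))"
proof -
  have "p \<in> good X1 a" using p X1 by (simp add: good_def)
  then obtain S \<alpha> where S: "open S" "convex S" "p \<in> S" "S \<subseteq> good X1 a" and root: "root_branch a n S \<alpha>"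
    using root_branch_exists[OF X1 _ p(3) a(1)] by metis
  have "integrating_factor X1 X2 S (\<lambda>z. \<alpha> z / bipoly_eval X1 z)" if "root_branch a n S \<alpha>" for \<alpha>
  proof (rule integrating_factorI[OF X1 S(1) _ S(4)])
    show "S \<noteq> {}" using S(3) by blast
  qed (use S(3) root_branch_multiplier[OF X1 S(1,4) that a] in blast)+
  then show ?thesis using good_nbhdI[OF S] root by blast
qed

lemma local_integrating_factor2:
  assumes a: "slope_deriv (slope X1 X2) a = - (\<delta>2 (slope X1 X2) * a) - \<delta>2 (\<delta>2 (slope X1 X2))"
    and p: "bipoly_eval X1 p \<noteq> 0" "regular_at a p"
  shows "\<exists>S \<phi>. good_nbhd X1 a p S \<and>
    form_integral S p (ratfun_eval (1 / of_bipoly X1 * - (of_bipoly X2 * a - b_coeff X1 X2 0)))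
      (ratfun_eval (1 / of_bipoly X1 * (a * of_bipoly X1))) \<phi> \<and>
    integrating_factor X1 X2 S (\<lambda>z. 1 / bipoly_eval X1 z * exp (\<phi> z))"
proof -
  have "p \<in> good X1 a" using p X1 by (simp add: good_def)
  then obtain S where S: "open S" "convex S" "p \<in> S" "S \<subseteq> good X1 a"
    using exists_nbhd_box[OF open_good[OF X1]] by metis
  obtain \<phi> where \<phi>: "hol2 \<phi> S" "\<phi> p = 0"
    "\<forall>z\<in>S. pd1 \<phi> z = - (ratfun_eval (slope X1 X2) z * ratfun_eval a z) - ratfun_eval (\<delta>2 (slope X1 X2)) z"
    "\<forall>z\<in>S. pd2 \<phi> z = ratfun_eval a z"
    using potential_sol2[OF X1 S a] .
  \<comment> \<open>Since b_0 / X1 = - f', the coefficients of the form as displayed simplify in K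
    to - f a - f' and a.\<close>
  have P: "1 / of_bipoly X1 * - (of_bipoly X2 * a - b_coeff X1 X2 0) = - (slope X1 X2 * a) - \<delta>2 (slope X1 X2)"
    and Q: "1 / of_bipoly X1 * (a * of_bipoly X1) = a"
    unfolding b_coeff_eq(1) using of_bipoly_nonzero[OF X1] by (simp_all add: slope_def[of X1 X2] field_simps)
  have "form_integral S p (ratfun_eval (- (slope X1 X2 * a) - \<delta>2 (slope X1 X2))) (ratfun_eval a) \<phi>"
    by (rule form_integral_potential[OF \<phi>(1) S(1) \<phi>(2)])
      (use \<phi>(3,4) good_subsetD[OF X1 S(4)] in \<open>simp_all add: ratfun_eval_diff ratfun_eval_minus ratfun_eval_mult\<close>)
  moreover have "integrating_factor X1 X2 S (\<lambda>z. 1 / bipoly_eval X1 z * exp (\<phi> z))"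
    by (rule integrating_factor_exp[OF S(1,3,4) \<phi>(1)]) (use \<phi>(3,4) in simp)
  ultimately show ?thesis
    unfolding P Q using good_nbhdI[OF S] by blast
qed

text \<open>The neighbourhood on which the system was solved is convex, so every solution u on it,
  not only the constructed one, has a potential there.\<close>

lemma local_integrating_factor3:
  assumes a: "slope_deriv (slope X1 X2) a = - (2 * \<delta>2 (slope X1 X2) * a) - \<delta>2 (\<delta>2 (\<delta>2 (slope X1 X2)))"
    and p: "bipoly_eval X1 p \<noteq> 0" "regular_at a p"
  shows "\<exists>S. good_nbhd X1 a p S \<and> (\<exists>u. u_system X1 X2 a S u) \<and>
    (\<forall>u. u_system X1 X2 a S u \<longrightarrow>
      (\<exists>\<phi>. form_integral S p
          (\<lambda>z. - ratfun_eval (\<delta>2 (of_bipoly X2 / of_bipoly X1)) z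
               - ratfun_eval (of_bipoly X2 / of_bipoly X1) z * u z) u \<phi> \<and>
        integrating_factor X1 X2 S (\<lambda>z. 1 / bipoly_eval X1 z * exp (\<phi> z))))"
proof -
  have "p \<in> good X1 a" using p X1 by (simp add: good_def)
  from u_system_exists[OF X1 this a]
  obtain S u where S: "open S" "convex S" "p \<in> S" "S \<subseteq> good X1 a" and sys: "u_system X1 X2 a S u" .
  have "\<exists>\<phi>. form_integral S p
          (\<lambda>z. - ratfun_eval (\<delta>2 (slope X1 X2)) z - ratfun_eval (slope X1 X2) z * u z) u \<phi> \<and>
        integrating_factor X1 X2 S (\<lambda>z. 1 / bipoly_eval X1 z * exp (\<phi> z))"
    if u: "u_system X1 X2 a S u" for u
  proof -
    obtain \<phi> where \<phi>: "hol2 \<phi> S" "\<phi> p = 0"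
      "\<forall>z\<in>S. pd1 \<phi> z = - ratfun_eval (\<delta>2 (slope X1 X2)) z - ratfun_eval (slope X1 X2) z * u z"
      "\<forall>z\<in>S. pd2 \<phi> z = u z"
      using potential_u_system[OF X1 S u] .
    have "form_integral S p
        (\<lambda>z. - ratfun_eval (\<delta>2 (slope X1 X2)) z - ratfun_eval (slope X1 X2) z * u z) u \<phi>"
      by (rule form_integral_potential[OF \<phi>(1) S(1) \<phi>(2)]) (use \<phi>(3,4) in auto)
    moreover have "integrating_factor X1 X2 S (\<lambda>z. 1 / bipoly_eval X1 z * exp (\<phi> z))"
      by (rule integrating_factor_exp[OF S(1,3,4) \<phi>(1)]) (use \<phi>(3,4) in simp)
    ultimately show ?thesis by blast
  qed
  then show ?thesis
    unfolding slope_def using good_nbhdI[OF S] sys by blast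
qed

end

theorem theorem20:
  fixes X1 X2 :: bipoly
  assumes X1_nonzero: "X1 \<noteq> 0"
  shows
    "(vf_ord X1 X2 = 0 \<longleftrightarrow> has_rational_first_integral X1 X2)
     \<and>
     (vf_ord X1 X2 = 1 \<longleftrightarrow>
        \<not> has_rational_first_integral X1 X2 \<and>
        (\<exists>a n. a \<noteq> 0 \<and> n \<noteq> (0::int) \<and> vf X1 X2 a = of_int n * b_coeff X1 X2 0 * a))
     \<and>
     (vf_ord X1 X2 = 1 \<longrightarrow>
        (\<forall>a n. a \<noteq> 0 \<and> n \<noteq> (0::int) \<and> vf X1 X2 a = of_int n * b_coeff X1 X2 0 * a \<longrightarrow>
          (\<forall>p. bipoly_eval X1 p \<noteq> 0 \<and> regular_at a p \<and> ratfun_eval a p \<noteq> 0 \<longrightarrow>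
            (\<exists>\<Omega>. good_nbhd X1 a p \<Omega> \<and> (\<exists>\<alpha>. root_branch a n \<Omega> \<alpha>) \<and>
              (\<forall>\<alpha>. root_branch a n \<Omega> \<alpha> \<longrightarrow>
                integrating_factor X1 X2 \<Omega> (\<lambda>z. \<alpha> z / bipoly_eval X1 z))))))
     \<and>
     (vf_ord X1 X2 = 2 \<longleftrightarrow>
        \<not> (\<exists>a n. a \<noteq> 0 \<and> n > (0::nat) \<and> vf X1 X2 a = of_nat n * b_coeff X1 X2 0 * a) \<and>
        (\<exists>a. vf X1 X2 a = b_coeff X1 X2 0 * a + b_coeff X1 X2 1))
     \<and>
     (vf_ord X1 X2 = 2 \<longrightarrow>
        (\<forall>a. vf X1 X2 a = b_coeff X1 X2 0 * a + b_coeff X1 X2 1 \<longrightarrow>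
          (\<forall>p. bipoly_eval X1 p \<noteq> 0 \<and> regular_at a p \<longrightarrow>
            (\<exists>\<Omega> \<phi>. good_nbhd X1 a p \<Omega> \<and>
              form_integral \<Omega> p
                (ratfun_eval (1 / of_bipoly X1 * - (of_bipoly X2 * a - b_coeff X1 X2 0)))
                (ratfun_eval (1 / of_bipoly X1 * (a * of_bipoly X1))) \<phi> \<and>
              integrating_factor X1 X2 \<Omega> (\<lambda>z. 1 / bipoly_eval X1 z * exp (\<phi> z))))))
     \<and>
     (vf_ord X1 X2 = 3 \<longleftrightarrow>
        \<not> (\<exists>a. vf X1 X2 a = b_coeff X1 X2 0 * a + b_coeff X1 X2 1) \<and>
        (\<exists>a. vf X1 X2 a = 2 * b_coeff X1 X2 0 * a + b_coeff X1 X2 2))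
     \<and>
     (vf_ord X1 X2 = 3 \<longrightarrow>
        (\<forall>a. vf X1 X2 a = 2 * b_coeff X1 X2 0 * a + b_coeff X1 X2 2 \<longrightarrow>
          (\<forall>p. bipoly_eval X1 p \<noteq> 0 \<and> regular_at a p \<longrightarrow>
            (\<exists>\<Omega>. good_nbhd X1 a p \<Omega> \<and> (\<exists>u. u_system X1 X2 a \<Omega> u) \<and>
              (\<forall>u. u_system X1 X2 a \<Omega> u \<longrightarrow>
                (\<exists>\<phi>. form_integral \<Omega> p
                    (\<lambda>z. - ratfun_eval (\<delta>2 (of_bipoly X2 / of_bipoly X1)) z
                         - ratfun_eval (of_bipoly X2 / of_bipoly X1) z * u z)
                    u \<phi> \<and>
                  integrating_factor X1 X2 \<Omega> (\<lambda>z. 1 / bipoly_eval X1 z * exp (\<phi> z))))))))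
     \<and>
     (vf_ord X1 X2 = \<infinity> \<longleftrightarrow>
        \<not> (\<exists>a. vf X1 X2 a = 2 * b_coeff X1 X2 0 * a + b_coeff X1 X2 2))"
proof -
  note sols = vf_sol1_iff[OF X1_nonzero] vf_sol2_iff[OF X1_nonzero] vf_sol3_iff[OF X1_nonzero]
  note ord = vf_ord_le_iff[OF X1_nonzero, of X2]
  let ?s = "slope X1 X2"
  have int1: "(\<exists>a n. a \<noteq> 0 \<and> n \<noteq> (0::int) \<and> vf X1 X2 a = of_int n * b_coeff X1 X2 0 * a) \<longleftrightarrow> slope_sol1 ?s"
    unfolding sols slope_sol1_int ..
  have nat1: "(\<exists>a n. a \<noteq> 0 \<and> n > (0::nat) \<and> vf X1 X2 a = of_nat n * b_coeff X1 X2 0 * a) \<longleftrightarrow> slope_sol1 ?s"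
    unfolding sols slope_sol1_def ..
  have sol2: "(\<exists>a. vf X1 X2 a = b_coeff X1 X2 0 * a + b_coeff X1 X2 1) \<longleftrightarrow> slope_sol2 ?s"
    unfolding sols slope_sol2_def ..
  have sol3: "(\<exists>a. vf X1 X2 a = 2 * b_coeff X1 X2 0 * a + b_coeff X1 X2 2) \<longleftrightarrow> slope_sol3 ?s"
    unfolding sols slope_sol3_def ..
  \<comment> \<open>Order k + 1 means exceeding the threshold k but not k + 1.\<close>
  have split: "vf_ord X1 X2 = enat (Suc k) \<longleftrightarrow> \<not> vf_ord X1 X2 \<le> enat k \<and> vf_ord X1 X2 \<le> enat (Suc k)" for k
    by (cases "vf_ord X1 X2") auto
  have num: "(0::enat) = enat 0" "(1::enat) = enat (Suc 0)" "(2::enat) = enat (Suc (Suc 0))"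
    "(3::enat) = enat (Suc (Suc (Suc 0)))"
    by (simp_all add: zero_enat_def one_enat_def numeral_eq_enat)
  have ord0: "vf_ord X1 X2 = 0 \<longleftrightarrow> has_rational_first_integral X1 X2"
    using ord(1) by (simp add: zero_enat_def[symmetric])
  have ord1: "vf_ord X1 X2 = 1 \<longleftrightarrow> \<not> has_rational_first_integral X1 X2 \<and> slope_sol1 ?s"
    unfolding num split using ord(1,2) by simp
  have ord2: "vf_ord X1 X2 = 2 \<longleftrightarrow> \<not> slope_sol1 ?s \<and> slope_sol2 ?s"
    unfolding num split using ord(2,3) by (simp add: numeral_2_eq_2)
  have ord3: "vf_ord X1 X2 = 3 \<longleftrightarrow> \<not> slope_sol2 ?s \<and> slope_sol3 ?s"
    unfolding num split using ord(3,4) by (simp add: numeral_2_eq_2 numeral_3_eq_3)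
  show ?thesis
    unfolding int1 nat1 sol2 sol3 ord0 ord1 ord2 ord3 ord(5)
    unfolding sols
    by (intro conjI allI impI refl; elim conjE;
        (rule local_integrating_factor1[OF X1_nonzero] local_integrating_factor2[OF X1_nonzero]
          local_integrating_factor3[OF X1_nonzero]; assumption))
qed

end
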